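(* Let $\{\Phi_t\}_{t\ge0}$ be a quantum dynamical semigroup of unital quantum channels on $M_d$. Then the set $\{t\in[0,\infty):\Phi_t\text{ is not mixed unitary}\}$ is open in $\mathbb{R}$. Moreover, exactly one of the following holds: (i) $\Phi_t$ is mixed unitary for all $t\ge0$; (ii) there exist $0<t_0\le t_1<\infty$ such that $\Phi_t$ is not mixed unitary for every $t\in(0,t_0)$ and $\Phi_t$ is mixed unitary for every $t\in[t_1,\infty)$.
   Context: A quantum dynamical semigroup of unital quantum channels is a family $\{\Phi_t\}_{t\ge0}$ of completely positive, unital, trace-preserving linear maps on $M_d$ with $\Phi_0=\mathrm{id}$, $\Phi_s\Phi_t=\Phi_{s+t}$ and $t\mapsto\Phi_t$ continuous. A channel is mixed unitary if it equals $\sum_{j=1}^\ell\lambda_j\mathrm{Ad}_{U_j}$ with unitaries $U_j$, $\lambda_j\ge0$, $\sum_j\lambda_j=1$, where $\mathrm{Ad}_U(X)=U^*XU$. *)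

theory Defs
  imports Complex_Main "Jordan_Normal_Form.Matrix"
begin

(* Matrices in M_d are complex d x d matrices (carrier_mat d d); maps on M_d are
   functions complex mat => complex mat, only their values on carrier_mat d d matter. *)

definition adj :: "complex mat \<Rightarrow> complex mat" where
  "adj A = mat (dim_col A) (dim_row A) (\<lambda>(i,j). cnj (A $$ (j,i)))"

definition mtrace :: "complex mat \<Rightarrow> complex" where
  "mtrace A = (\<Sum>i<dim_row A. A $$ (i,i))"

definition unitary_mat :: "nat \<Rightarrow> complex mat \<Rightarrow> bool" where
  "unitary_mat d U \<longleftrightarrow> U \<in> carrier_mat d d \<and> adj U * U = 1\<^sub>m d"

definition Ad :: "complex mat \<Rightarrow> complex mat \<Rightarrow> complex mat" where
  "Ad U X = adj U * X * U"

definition psd :: "nat \<Rightarrow> complex mat \<Rightarrow> bool" where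
  "psd n A \<longleftrightarrow> A \<in> carrier_mat n n \<and>
     (\<forall>v. (\<Sum>i<n. \<Sum>j<n. cnj (v i) * A $$ (i,j) * v j) \<in> \<real> \<and>
          Re (\<Sum>i<n. \<Sum>j<n. cnj (v i) * A $$ (i,j) * v j) \<ge> 0)"

definition linear_map_on :: "nat \<Rightarrow> (complex mat \<Rightarrow> complex mat) \<Rightarrow> bool" where
  "linear_map_on d \<Phi> \<longleftrightarrow>
     (\<forall>X \<in> carrier_mat d d. \<Phi> X \<in> carrier_mat d d) \<and>
     (\<forall>X \<in> carrier_mat d d. \<forall>Y \<in> carrier_mat d d. \<Phi> (X + Y) = \<Phi> X + \<Phi> Y) \<and>
     (\<forall>X \<in> carrier_mat d d. \<forall>c. \<Phi> (c \<cdot>\<^sub>m X) = c \<cdot>\<^sub>m \<Phi> X)"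

(* (id_k \<otimes> \<Phi>) applied to a k x k block matrix with d x d blocks, viewed as a kd x kd matrix *)
definition block_apply :: "nat \<Rightarrow> nat \<Rightarrow> (complex mat \<Rightarrow> complex mat) \<Rightarrow> complex mat \<Rightarrow> complex mat" where
  "block_apply d k \<Phi> X = mat (k*d) (k*d) (\<lambda>(i,j).
      \<Phi> (mat d d (\<lambda>(a,b). X $$ ((i div d) * d + a, (j div d) * d + b))) $$ (i mod d, j mod d))"

definition completely_positive :: "nat \<Rightarrow> (complex mat \<Rightarrow> complex mat) \<Rightarrow> bool" where
  "completely_positive d \<Phi> \<longleftrightarrow>
     (\<forall>k X. psd (k*d) X \<longrightarrow> psd (k*d) (block_apply d k \<Phi> X))"

definition unital_quantum_channel :: "nat \<Rightarrow> (complex mat \<Rightarrow> complex mat) \<Rightarrow> bool" where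
  "unital_quantum_channel d \<Phi> \<longleftrightarrow>
     linear_map_on d \<Phi> \<and> completely_positive d \<Phi> \<and>
     \<Phi> (1\<^sub>m d) = 1\<^sub>m d \<and>
     (\<forall>X \<in> carrier_mat d d. mtrace (\<Phi> X) = mtrace X)"

fun msum :: "nat \<Rightarrow> (nat \<Rightarrow> complex mat) \<Rightarrow> nat \<Rightarrow> complex mat" where
  "msum d f 0 = 0\<^sub>m d d"
| "msum d f (Suc n) = msum d f n + f n"

definition mixed_unitary :: "nat \<Rightarrow> (complex mat \<Rightarrow> complex mat) \<Rightarrow> bool" where
  "mixed_unitary d \<Phi> \<longleftrightarrow>
     (\<exists>(l::nat) (lam :: nat \<Rightarrow> real) (U :: nat \<Rightarrow> complex mat).
        (\<forall>j<l. lam j \<ge> 0 \<and> unitary_mat d (U j)) \<and> (\<Sum>j<l. lam j) = 1 \<and>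
        (\<forall>X \<in> carrier_mat d d.
           \<Phi> X = msum d (\<lambda>j. complex_of_real (lam j) \<cdot>\<^sub>m Ad (U j) X) l))"

(* quantum dynamical semigroup of unital channels, indexed by t \<ge> 0;
   continuity of t \<mapsto> \<Phi>_t (finite dimensions: equivalent to entrywise continuity) *)
definition qds_unital :: "nat \<Rightarrow> (real \<Rightarrow> complex mat \<Rightarrow> complex mat) \<Rightarrow> bool" where
  "qds_unital d \<Phi> \<longleftrightarrow>
     (\<forall>t\<ge>0. unital_quantum_channel d (\<Phi> t)) \<and>
     (\<forall>X \<in> carrier_mat d d. \<Phi> 0 X = X) \<and>
     (\<forall>s t X. 0 \<le> s \<longrightarrow> 0 \<le> t \<longrightarrow> X \<in> carrier_mat d d \<longrightarrow> \<Phi> (s + t) X = \<Phi> s (\<Phi> t X)) \<and>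
     (\<forall>X \<in> carrier_mat d d. \<forall>i<d. \<forall>j<d. continuous_on {0..} (\<lambda>t. \<Phi> t X $$ (i,j)))"

end

(* The set T of times at which the semigroup is mixed unitary is closed, contains 0 and is closed under
   addition. Hence if it accumulates at 0 it is all of [0,oo), and if it contains an interval it contains
   a half-line; so it suffices to find one interval inside T.

   By compactness, along some times s_k -> oo the maps converge to an idempotent channel E, the
   expectation onto a *-algebra N, and every Phi_t acts multiplicatively and isometrically on N. If Phi_t
   is close to E there is a unitary u with m u = u Phi_t(m) for m in N, so that Psi = u Phi_t(.) u* is an
   N-bimodule map close to E. Let G be the unitary group of the commutant A of N. Every unital trace
   preserving N-bimodule map is a combination of the maps Ad_v with v in G: the symmetric tensors
   are handled by the products ad_a ad_b, and for the antisymmetric ones E is a separability idempotent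
   killing the relevant cyclic cohomology. Finally E is an interior point of the convex hull of Ad(G), as
   it absorbs Ad(G); thus Psi lies in this hull and Phi_t is mixed unitary. *)

theory Submission
  imports Defs "HOL-Analysis.Analysis" "HOL-Computational_Algebra.Fundamental_Theorem_Algebra"
begin

section \<open>Finite complex matrices as a ring\<close>

text \<open>The obstacle is that the mixed unitary maps have empty interior in the space of all
  linear maps, so closeness of Phi_t to E says nothing by itself. Both maps must first be placed in
  a linear space in which the cone has interior. That space is \<open>S\<close>, the span of the
  Ad_v with v in G; the algebraic half of the proof shows that it contains every unital trace
  preserving N-bimodule map. The twist by u is forced, because Phi_t may move N and then is no
  bimodule map. The metric half works with squared Hilbert-Schmidt norms, which do not change under
  unitary conjugation. No Haar measure is used: a norm-minimising sequence in the unital part of the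
  cone is asymptotically invariant, hence tends to E. Being a limit of the cone does not make E
  interior; this comes from a ball around one point of the cone, whose radius survives composition
  with unital members of the cone. A single mixed unitary time would give only its multiples. An
  interval is found by contradiction, since times outside T could be chosen next to every
  s_k.\<close>

text \<open>Matrices of all sizes live in one (non-unital) ring, so that no side conditions on dimensions arise in
  ring calculations; \<open>M\<^sub>n\<close> is the corner cut out by the projection \<open>idm n\<close>.\<close>

typedef fm = "{f :: nat \<Rightarrow> nat \<Rightarrow> complex. \<exists>n. \<forall>i j. f i j \<noteq> 0 \<longrightarrow> i < n \<and> j < n}"
  morphisms ent Fm
  by (rule exI[of _ "\<lambda>_ _. 0"]) simp

definition corner :: "nat \<Rightarrow> fm set" where
  "corner n = {A. \<forall>i j. ent A i j \<noteq> 0 \<longrightarrow> i < n \<and> j < n}"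

lemma fm_eqI: "(\<And>i j. ent A i j = ent B i j) \<Longrightarrow> A = B"
  by (metis ent_inject ext)

lemma cornerI: "(\<And>i j. \<not> (i < n \<and> j < n) \<Longrightarrow> ent A i j = 0) \<Longrightarrow> A \<in> corner n"
  unfolding corner_def by blast

lemma corner_ent: "A \<in> corner n \<Longrightarrow> \<not> (i < n \<and> j < n) \<Longrightarrow> ent A i j = 0"
  unfolding corner_def by blast

lemma corner_eqI:
  "A \<in> corner n \<Longrightarrow> B \<in> corner n \<Longrightarrow> (\<And>i j. i < n \<Longrightarrow> j < n \<Longrightarrow> ent A i j = ent B i j) \<Longrightarrow> A = B"
  by (rule fm_eqI) (metis corner_ent)

lemma ex_corner: "\<exists>n. A \<in> corner n"
  using ent[of A] unfolding corner_def by auto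

lemma corner_mono: "A \<in> corner m \<Longrightarrow> m \<le> n \<Longrightarrow> A \<in> corner n"
  unfolding corner_def using order_less_le_trans by blast

lemma ex_corner3: "\<exists>n. A \<in> corner n \<and> B \<in> corner n \<and> C \<in> corner n"
proof -
  obtain a b c where "A \<in> corner a" "B \<in> corner b" "C \<in> corner c" using ex_corner by metis
  then have "A \<in> corner (a + b + c)" "B \<in> corner (a + b + c)" "C \<in> corner (a + b + c)"
    by (auto elim!: corner_mono)
  then show ?thesis by blast
qed

lemma ent_Fm: "(\<And>i j. f i j \<noteq> 0 \<Longrightarrow> i < n \<and> j < n) \<Longrightarrow> ent (Fm f) = f"
  by (rule Fm_inverse) blast

instantiation fm :: ring
begin

definition "0 = Fm (\<lambda>_ _. 0)"
definition "A + B = Fm (\<lambda>i j. ent A i j + ent B i j)"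
definition "- A = Fm (\<lambda>i j. - ent A i j)"
definition "(A::fm) - B = Fm (\<lambda>i j. ent A i j - ent B i j)"
text \<open>Summing over the support of a row avoids the choice of a size; \<open>ent_mult\<close>
  replaces the support by any bound of the left factor.\<close>

definition "A * B = Fm (\<lambda>i j. \<Sum>k | ent A i k \<noteq> 0. ent A i k * ent B k j)"

lemma ent_zero: "ent 0 i j = 0"
  unfolding zero_fm_def by (subst ent_Fm[of _ 0]) auto

lemma ent_add: "ent (A + B) i j = ent A i j + ent B i j"
proof -
  obtain n where "A \<in> corner n" "B \<in> corner n" using ex_corner3 by metis
  then show ?thesis unfolding plus_fm_def
    by (subst ent_Fm[of _ n]) (auto simp: corner_def, (metis add_cancel_right_left add.right_neutral)+)
qed

lemma ent_uminus: "ent (- A) i j = - ent A i j"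
proof -
  obtain n where "A \<in> corner n" using ex_corner by metis
  then show ?thesis unfolding uminus_fm_def
    by (subst ent_Fm[of _ n]) (auto simp: corner_def)
qed

lemma ent_diff: "ent (A - B) i j = ent A i j - ent B i j"
proof -
  obtain n where "A \<in> corner n" "B \<in> corner n" using ex_corner3 by metis
  then show ?thesis unfolding minus_fm_def
    by (subst ent_Fm[of _ n]) (auto simp: corner_def, (metis diff_self diff_zero)+)
qed

lemma ent_mult:
  assumes "A \<in> corner n"
  shows "ent (A * B) i j = (\<Sum>k<n. ent A i k * ent B k j)"
proof -
  obtain m where m: "A \<in> corner m" "B \<in> corner m" using ex_corner3 by metis
  have fin: "finite {k. ent A i k \<noteq> 0}" for i
    by (rule finite_subset[of _ "{..<n}"]) (use assms in \<open>auto simp: corner_def\<close>)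
  have *: "(\<Sum>k | ent A i k \<noteq> 0. ent A i k * ent B k j) = (\<Sum>k<n. ent A i k * ent B k j)" for i j
    by (rule sum.mono_neutral_left) (use assms in \<open>auto simp: corner_def\<close>)
  have "(\<Sum>k<n. ent A i k * ent B k j) = 0" if "\<not> (i < m \<and> j < m)" for i j
    by (rule sum.neutral) (use that m in \<open>auto simp: corner_def\<close>)
  then show ?thesis unfolding times_fm_def *
    by (subst ent_Fm[of _ m]) auto
qed

instance
proof
  fix A B C :: fm
  obtain n where n: "A \<in> corner n" "B \<in> corner n" "C \<in> corner n" using ex_corner3 by metis
  have AB: "A * B \<in> corner n"
    by (rule cornerI, subst ent_mult[OF n(1)], rule sum.neutral) (use n in \<open>auto simp: corner_def\<close>)
  have ApB: "A + B \<in> corner n"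
    by (rule cornerI) (use n in \<open>auto simp: ent_add corner_ent\<close>)
  show "A * B * C = A * (B * C)"
  proof (rule fm_eqI)
    fix i j
    have "ent (A * B * C) i j = (\<Sum>k<n. \<Sum>l<n. ent A i l * ent B l k * ent C k j)"
      by (simp add: ent_mult[OF AB] ent_mult[OF n(1)] sum_distrib_right)
    also have "\<dots> = (\<Sum>l<n. \<Sum>k<n. ent A i l * ent B l k * ent C k j)"
      by (rule sum.swap)
    also have "\<dots> = ent (A * (B * C)) i j"
      by (simp add: ent_mult[OF n(1)] ent_mult[OF n(2)] sum_distrib_left mult.assoc)
    finally show "ent (A * B * C) i j = ent (A * (B * C)) i j" .
  qed
  show "(A + B) * C = A * C + B * C"
    by (rule fm_eqI) (simp add: ent_mult[OF ApB] ent_mult[OF n(1)] ent_mult[OF n(2)] ent_add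
        distrib_right sum.distrib)
  show "A * (B + C) = A * B + A * C"
    by (rule fm_eqI) (simp add: ent_mult[OF n(1)] ent_add distrib_left sum.distrib)
qed (rule fm_eqI, simp add: ent_add ent_zero ent_uminus ent_diff)+

end

lemma ent_sum: "ent (sum f S) i j = (\<Sum>x\<in>S. ent (f x) i j)"
  by (induction S rule: infinite_finite_induct) (auto simp: ent_zero ent_add)

section \<open>Scalar multiples, adjoints and matrix units\<close>

definition cs :: "complex \<Rightarrow> fm \<Rightarrow> fm" where
  "cs c A = Fm (\<lambda>i j. c * ent A i j)"

definition star :: "fm \<Rightarrow> fm" where
  "star A = Fm (\<lambda>i j. cnj (ent A j i))"

definition unit :: "nat \<Rightarrow> nat \<Rightarrow> fm" where
  "unit p q = Fm (\<lambda>i j. if i = p \<and> j = q then 1 else 0)"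

definition idm :: "nat \<Rightarrow> fm" where
  "idm n = Fm (\<lambda>i j. if i = j \<and> i < n then 1 else 0)"

lemma ent_cs: "ent (cs c A) i j = c * ent A i j"
proof -
  obtain n where "A \<in> corner n" using ex_corner by metis
  then show ?thesis unfolding cs_def
    by (subst ent_Fm[of _ n]) (auto simp: corner_def)
qed

lemma ent_star: "ent (star A) i j = cnj (ent A j i)"
proof -
  obtain n where "A \<in> corner n" using ex_corner by metis
  then show ?thesis unfolding star_def
    by (subst ent_Fm[of _ n]) (auto simp: corner_def)
qed

lemma ent_unit: "ent (unit p q) i j = (if i = p \<and> j = q then 1 else 0)"
  unfolding unit_def by (subst ent_Fm[of _ "Suc (max p q)"]) (auto split: if_splits)

lemma ent_idm: "ent (idm n) i j = (if i = j \<and> i < n then 1 else 0)"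
  unfolding idm_def by (subst ent_Fm[of _ n]) (auto split: if_splits)

lemmas ent_simps = ent_zero ent_add ent_uminus ent_diff ent_sum ent_cs ent_star ent_unit ent_idm

lemma corner_zero [simp]: "0 \<in> corner n"
  and corner_add [simp]: "A \<in> corner n \<Longrightarrow> B \<in> corner n \<Longrightarrow> A + B \<in> corner n"
  and corner_uminus [simp]: "A \<in> corner n \<Longrightarrow> - A \<in> corner n"
  and corner_diff [simp]: "A \<in> corner n \<Longrightarrow> B \<in> corner n \<Longrightarrow> A - B \<in> corner n"
  and corner_cs [simp]: "A \<in> corner n \<Longrightarrow> cs c A \<in> corner n"
  and corner_star [simp]: "A \<in> corner n \<Longrightarrow> star A \<in> corner n"
  and corner_idm [simp]: "idm n \<in> corner n"
  and corner_unit [simp]: "p < n \<Longrightarrow> q < n \<Longrightarrow> unit p q \<in> corner n"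
  by (rule cornerI, auto simp: ent_simps corner_ent)+

lemma corner_sum [simp]: "(\<And>x. x \<in> S \<Longrightarrow> f x \<in> corner n) \<Longrightarrow> sum f S \<in> corner n"
  by (induction S rule: infinite_finite_induct) auto

lemma corner_mult [simp]: "A \<in> corner n \<Longrightarrow> B \<in> corner n \<Longrightarrow> A * B \<in> corner n"
  by (rule cornerI, subst ent_mult, assumption, rule sum.neutral) (auto simp: corner_def)

lemma ent_idm_mult: "ent (idm n * A) i j = (if i < n then ent A i j else 0)"
proof -
  have "ent (idm n * A) i j = (\<Sum>k<n. if k = i then ent A i j else 0)"
    by (subst ent_mult[OF corner_idm], rule sum.cong) (auto simp: ent_idm)
  then show ?thesis by simp
qed

lemma ent_mult_idm: "ent (A * idm n) i j = (if j < n then ent A i j else 0)"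
proof -
  obtain m where m: "A \<in> corner m" using ex_corner by metis
  have "ent (A * idm n) i j = (\<Sum>k<m. if k = j then (if j < n then ent A i j else 0) else 0)"
    by (subst ent_mult[OF m], rule sum.cong) (auto simp: ent_idm)
  also have "\<dots> = (if j < n then ent A i j else 0)"
    using m by (auto simp: corner_ent)
  finally show ?thesis .
qed

lemma idm_mult [simp]: "A \<in> corner n \<Longrightarrow> idm n * A = A"
  by (rule fm_eqI) (auto simp: ent_idm_mult corner_ent)

lemma mult_idm [simp]: "A \<in> corner n \<Longrightarrow> A * idm n = A"
  by (rule fm_eqI) (auto simp: ent_mult_idm corner_ent)

lemma corner_cut [simp]: "idm n * A * idm n \<in> corner n"
  by (rule cornerI) (auto simp: ent_idm_mult ent_mult_idm)

lemma mult_sandwich_corner [simp]: "A \<in> corner n \<Longrightarrow> B \<in> corner n \<Longrightarrow> A * X * B \<in> corner n"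
proof -
  assume a: "A \<in> corner n" "B \<in> corner n"
  then have "A * X * B = A * (idm n * X * idm n) * B"
    by (metis idm_mult mult_idm mult.assoc)
  then show ?thesis using a by simp
qed

lemma vs_cs: "vector_space cs"
  by unfold_locales (rule fm_eqI; simp add: ent_simps algebra_simps)+

interpretation cs: vector_space cs
  by (rule vs_cs)

lemma cs_mult_left [simp]: "cs c A * B = cs c (A * B)"
proof -
  obtain n where n: "A \<in> corner n" using ex_corner by metis
  show ?thesis
    by (rule fm_eqI) (simp add: ent_mult[OF n] ent_mult[OF corner_cs[OF n]] ent_cs
        sum_distrib_left mult.assoc)
qed

lemma cs_mult_right [simp]: "A * cs c B = cs c (A * B)"
proof -
  obtain n where n: "A \<in> corner n" using ex_corner by metis
  show ?thesis
    by (rule fm_eqI) (simp add: ent_mult[OF n] ent_cs sum_distrib_left mult.left_commute)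
qed

lemmas cs_distribs = cs.scale_right_distrib cs.scale_left_distrib
  cs.scale_right_diff_distrib cs.scale_left_diff_distrib

lemma star_star [simp]: "star (star A) = A"
  and star_zero [simp]: "star 0 = 0"
  and star_add [simp]: "star (A + B) = star A + star B"
  and star_diff [simp]: "star (A - B) = star A - star B"
  and star_uminus [simp]: "star (- A) = - star A"
  and star_cs [simp]: "star (cs c A) = cs (cnj c) (star A)"
  and star_idm [simp]: "star (idm n) = idm n"
  and star_unit [simp]: "star (unit p q) = unit q p"
  by (rule fm_eqI, auto simp: ent_simps)+

lemma star_sum: "star (sum f S) = (\<Sum>x\<in>S. star (f x))"
  by (induction S rule: infinite_finite_induct) auto

lemma star_mult [simp]: "star (A * B) = star B * star A"
proof -
  obtain n where n: "A \<in> corner n" "B \<in> corner n" using ex_corner3 by metis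
  show ?thesis
    by (rule fm_eqI) (simp add: ent_mult[OF n(1)] ent_mult[OF corner_star[OF n(2)]] ent_star mult.commute)
qed

section \<open>Trace and Hilbert-Schmidt norm\<close>

definition tr :: "nat \<Rightarrow> fm \<Rightarrow> complex" where
  "tr n A = (\<Sum>i<n. ent A i i)"

lemma tr_simps [simp]: "tr n 0 = 0" "tr n (A + B) = tr n A + tr n B" "tr n (A - B) = tr n A - tr n B"
  "tr n (- A) = - tr n A" "tr n (cs c A) = c * tr n A" "tr n (star A) = cnj (tr n A)"
  by (simp_all add: tr_def ent_simps sum.distrib sum_subtractf sum_negf sum_distrib_left)

lemma tr_sum: "tr n (sum f S) = (\<Sum>x\<in>S. tr n (f x))"
  by (induction S rule: infinite_finite_induct) auto

lemma tr_mult_commute: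
  assumes "A \<in> corner n" "B \<in> corner n"
  shows "tr n (A * B) = tr n (B * A)"
proof -
  have "tr n (A * B) = (\<Sum>i<n. \<Sum>k<n. ent A i k * ent B k i)"
    unfolding tr_def by (simp add: ent_mult[OF assms(1)])
  also have "\<dots> = (\<Sum>k<n. \<Sum>i<n. ent A i k * ent B k i)" by (rule sum.swap)
  also have "\<dots> = tr n (B * A)"
    unfolding tr_def by (simp add: ent_mult[OF assms(2)] mult.commute)
  finally show ?thesis .
qed

text \<open>The squared norm, so that the parallelogram law and the trace formula are free of
  roots.\<close>

definition hs :: "nat \<Rightarrow> fm \<Rightarrow> real" where
  "hs n A = (\<Sum>i<n. \<Sum>j<n. (cmod (ent A i j))\<^sup>2)"

lemma hs_nonneg [simp]: "hs n A \<ge> 0"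
  unfolding hs_def by (intro sum_nonneg) auto

lemma tr_star_mult:
  assumes "A \<in> corner n"
  shows "tr n (star A * A) = complex_of_real (hs n A)"
proof -
  have "tr n (star A * A) = (\<Sum>i<n. \<Sum>k<n. cnj (ent A k i) * ent A k i)"
    unfolding tr_def by (simp add: ent_mult[OF corner_star[OF assms]] ent_star)
  also have "\<dots> = (\<Sum>k<n. \<Sum>i<n. cnj (ent A k i) * ent A k i)" by (rule sum.swap)
  also have "\<dots> = complex_of_real (hs n A)"
    unfolding hs_def of_real_sum
    by (intro sum.cong refl) (metis complex_norm_square mult.commute)
  finally show ?thesis .
qed

lemma hs_eq_tr: "A \<in> corner n \<Longrightarrow> hs n A = Re (tr n (star A * A))"
  by (simp add: tr_star_mult)

lemma ent_le_hs: "i < n \<Longrightarrow> j < n \<Longrightarrow> (cmod (ent A i j))\<^sup>2 \<le> hs n A"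
proof -
  assume a: "i < n" "j < n"
  have "(cmod (ent A i j))\<^sup>2 \<le> (\<Sum>j<n. (cmod (ent A i j))\<^sup>2)"
    by (rule member_le_sum) (use a in auto)
  also have "\<dots> \<le> hs n A" unfolding hs_def
    by (rule member_le_sum) (use a in \<open>auto intro: sum_nonneg\<close>)
  finally show ?thesis .
qed

lemma hs_eq_0: "A \<in> corner n \<Longrightarrow> hs n A = 0 \<Longrightarrow> A = 0"
  by (rule corner_eqI) (use ent_le_hs[of _ n _ A] in \<open>auto simp: ent_zero\<close>)

lemma star_mult_eq_0:
  assumes "A \<in> corner n" "star A * A = 0"
  shows "A = 0"
  using assms by (intro hs_eq_0) (auto simp: hs_eq_tr)

text \<open>The test element X = \<open>star A\<close> suffices.\<close>

lemma tr_nondegenerate: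
  assumes "A \<in> corner n" "\<And>X. X \<in> corner n \<Longrightarrow> tr n (X * A) = 0"
  shows "A = 0"
  using assms by (intro hs_eq_0) (auto simp: hs_eq_tr)

lemma hs_parallelogram: "hs n (A + B) + hs n (A - B) = 2 * hs n A + 2 * hs n B"
proof -
  have "(cmod (a + b))\<^sup>2 + (cmod (a - b))\<^sup>2 = 2 * (cmod a)\<^sup>2 + 2 * (cmod b)\<^sup>2" for a b
    unfolding cmod_power2 by (simp add: power2_eq_square algebra_simps)
  then show ?thesis
    unfolding hs_def ent_add ent_diff sum_distrib_left by (simp add: sum.distrib[symmetric])
qed

lemma hs_cs: "hs n (cs c A) = (cmod c)\<^sup>2 * hs n A"
  by (simp add: hs_def ent_cs norm_mult power_mult_distrib sum_distrib_left)

lemma unit_mult: "unit p q * unit r s = (if q = r then unit p s else 0)"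
proof -
  have c: "unit p q \<in> corner (Suc (max p q))" by simp
  show ?thesis
  proof (rule fm_eqI)
    fix i j
    have "ent (unit p q * unit r s) i j
        = (\<Sum>k<Suc (max p q). if k = q then (if i = p \<and> q = r \<and> j = s then 1 else 0) else 0)"
      unfolding ent_mult[OF c] by (intro sum.cong refl) (auto simp: ent_unit)
    also have "\<dots> = ent (if q = r then unit p s else 0) i j"
      by (auto simp: ent_unit ent_zero)
    finally show "ent (unit p q * unit r s) i j = ent (if q = r then unit p s else 0) i j" .
  qed
qed

lemma corner_expand:
  assumes "X \<in> corner n"
  shows "X = (\<Sum>p<n. \<Sum>q<n. cs (ent X p q) (unit p q))"
proof (rule corner_eqI[of _ n])
  fix i j assume ij: "i < n" "j < n"
  have "ent (\<Sum>p<n. \<Sum>q<n. cs (ent X p q) (unit p q)) i j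
      = (\<Sum>p<n. \<Sum>q<n. if p = i then (if q = j then ent X i j else 0) else 0)"
    unfolding ent_simps by (intro sum.cong refl) auto
  also have "\<dots> = (\<Sum>p<n. if p = i then ent X i j else 0)"
    by (intro sum.cong refl) (use ij in auto)
  also have "\<dots> = ent X i j" using ij by simp
  finally show "ent X i j = ent (\<Sum>p<n. \<Sum>q<n. cs (ent X p q) (unit p q)) i j" by simp
qed (use assms in \<open>auto intro!: corner_sum\<close>)

text \<open>Linear maps on \<open>M\<^sub>n\<close> are total functions that ignore all entries outside the corner, so that they can
  be compared by plain equality.\<close>

definition op :: "nat \<Rightarrow> (fm \<Rightarrow> fm) \<Rightarrow> bool" where
  "op n T \<longleftrightarrow> (\<forall>X Y. T (X + Y) = T X + T Y) \<and> (\<forall>c X. T (cs c X) = cs c (T X)) \<and>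
     (\<forall>X. T (idm n * X * idm n) = T X) \<and> (\<forall>X. T X \<in> corner n)"

lemma op_add: "op n T \<Longrightarrow> T (X + Y) = T X + T Y"
  and op_cs: "op n T \<Longrightarrow> T (cs c X) = cs c (T X)"
  and op_cut: "op n T \<Longrightarrow> T (idm n * X * idm n) = T X"
  and op_corner: "op n T \<Longrightarrow> T X \<in> corner n"
  unfolding op_def by blast+

lemma op_zero: "op n T \<Longrightarrow> T 0 = 0"
  using op_add[of n T 0 0] by simp

lemma op_uminus: "op n T \<Longrightarrow> T (- X) = - T X"
  using op_add[of n T X "- X"] op_zero[of n T] by (simp add: eq_neg_iff_add_eq_0 add.commute)

lemma op_diff: "op n T \<Longrightarrow> T (X - Y) = T X - T Y"
  using op_add[of n T X "- Y"] op_uminus[of n T Y] by simp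

lemma op_sum: "op n T \<Longrightarrow> T (sum f S) = (\<Sum>x\<in>S. T (f x))"
  by (induction S rule: infinite_finite_induct) (auto simp: op_zero op_add)

lemma op_expand:
  assumes "op n T" "X \<in> corner n"
  shows "T X = (\<Sum>p<n. \<Sum>q<n. cs (ent X p q) (T (unit p q)))"
  by (subst corner_expand[OF assms(2)]) (simp add: op_sum[OF assms(1)] op_cs[OF assms(1)])

lemma op_eqI:
  assumes T: "op n T" and S: "op n S"
    and eq: "\<And>p q. p < n \<Longrightarrow> q < n \<Longrightarrow> T (unit p q) = S (unit p q)"
  shows "T = S"
proof
  fix X
  have "T (idm n * X * idm n) = S (idm n * X * idm n)"
    unfolding op_expand[OF T corner_cut] op_expand[OF S corner_cut]
    by (intro sum.cong refl) (simp add: eq)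
  then show "T X = S X" by (simp add: op_cut[OF T] op_cut[OF S])
qed

lemma op_eqI':
  assumes "op n T" "op n S" "\<And>X. X \<in> corner n \<Longrightarrow> T X = S X"
  shows "T = S"
  by (rule op_eqI[OF assms(1,2)]) (simp add: assms(3))

lemma opI:
  assumes "\<And>X Y. T (X + Y) = T X + T Y" "\<And>c X. T (cs c X) = cs c (T X)"
    "\<And>X. T (idm n * X * idm n) = T X" "\<And>X. T X \<in> corner n"
  shows "op n T"
  using assms unfolding op_def by blast

lemma op_zero_map: "op n (\<lambda>X. 0)"
  by (rule opI) auto

lemma op_add_map:
  assumes "op n T" "op n S"
  shows "op n (\<lambda>X. T X + S X)"
  by (rule opI) (simp_all add: op_add[OF assms(1)] op_add[OF assms(2)] op_cs[OF assms(1)]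
      op_cs[OF assms(2)] op_cut[OF assms(1)] op_cut[OF assms(2)] op_corner[OF assms(1)]
      op_corner[OF assms(2)] cs.scale_right_distrib)

lemma op_diff_map:
  assumes "op n T" "op n S"
  shows "op n (\<lambda>X. T X - S X)"
  by (rule opI) (simp_all add: op_add[OF assms(1)] op_add[OF assms(2)] op_cs[OF assms(1)]
      op_cs[OF assms(2)] op_cut[OF assms(1)] op_cut[OF assms(2)] op_corner[OF assms(1)]
      op_corner[OF assms(2)] cs.scale_right_diff_distrib)

lemma op_cs_map:
  assumes "op n T"
  shows "op n (\<lambda>X. cs c (T X))"
  by (rule opI) (simp_all add: op_add[OF assms] op_cs[OF assms] op_cut[OF assms] op_corner[OF assms]
      cs.scale_right_distrib mult.commute)

lemma op_comp:
  assumes "op n T" "op n S"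
  shows "op n (\<lambda>X. T (S X))"
  by (rule opI) (simp_all add: op_add[OF assms(1)] op_add[OF assms(2)] op_cs[OF assms(1)]
      op_cs[OF assms(2)] op_cut[OF assms(2)] op_corner[OF assms(1)])

lemma op_sandwich:
  assumes "A \<in> corner n" "B \<in> corner n"
  shows "op n (\<lambda>X. A * X * B)"
proof (rule opI)
  fix X
  have "A * (idm n * X * idm n) * B = (A * idm n) * X * (idm n * B)"
    by (simp only: mult.assoc)
  then show "A * (idm n * X * idm n) * B = A * X * B"
    using assms by simp
qed (use assms in \<open>simp_all add: distrib_left distrib_right\<close>)

lemma op_sum_map: "(\<And>x. x \<in> S \<Longrightarrow> op n (f x)) \<Longrightarrow> op n (\<lambda>X. \<Sum>x\<in>S. f x X)"
  by (induction S rule: infinite_finite_induct) (auto intro!: op_add_map op_zero_map)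

lemma op_mult_right:
  assumes "op n T" "A \<in> corner n"
  shows "op n (\<lambda>X. T X * A)"
  by (rule opI) (use assms(2) in \<open>simp_all add: op_add[OF assms(1)] op_cs[OF assms(1)]
      op_cut[OF assms(1)] op_corner[OF assms(1)] distrib_right\<close>)

section \<open>Polynomial functional calculus\<close>

text \<open>Gaussian elimination: a vector \<open>v k\<close> with nonzero entry at \<open>i\<close>
  clears that entry from the other vectors, and a relation among the reduced vectors determines the
  coefficient of \<open>v k\<close>.\<close>

lemma exists_linear_relation:
  fixes v :: "'j \<Rightarrow> 'i \<Rightarrow> 'a::field"
  assumes "finite I" "finite J" "card I < card J"
  shows "\<exists>c. (\<exists>j\<in>J. c j \<noteq> 0) \<and> (\<forall>i\<in>I. (\<Sum>j\<in>J. c j * v j i) = 0)"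
  using assms
proof (induction I arbitrary: J v rule: finite_induct)
  case empty
  then have "J \<noteq> {}" by auto
  then show ?case by (intro exI[of _ "\<lambda>_. 1"]) auto
next
  case (insert i I)
  show ?case
  proof (cases "\<forall>j\<in>J. v j i = 0")
    case True
    have "card I < card J" using insert by simp
    from insert.IH[OF insert.prems(1) this] obtain c
      where c: "\<exists>j\<in>J. c j \<noteq> 0" "\<forall>i\<in>I. (\<Sum>j\<in>J. c j * v j i) = 0" by blast
    then show ?thesis using True by (intro exI[of _ c]) auto
  next
    case False
    then obtain k where k: "k \<in> J" "v k i \<noteq> 0" by blast
    have "card I < card (J - {k})" using insert k by auto
    from insert.IH[OF _ this, of "\<lambda>j l. v j l - v j i / v k i * v k l"] insert.prems(1)
    obtain c where c: "\<exists>j\<in>J - {k}. c j \<noteq> 0"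
        "\<forall>l\<in>I. (\<Sum>j\<in>J - {k}. c j * (v j l - v j i / v k i * v k l)) = 0"
      by auto
    define b where "b = (\<lambda>j. if j = k then - (\<Sum>j\<in>J - {k}. c j * (v j i / v k i)) else c j)"
    have eq: "(\<Sum>j\<in>J. b j * v j l) = (\<Sum>j\<in>J - {k}. c j * (v j l - v j i / v k i * v k l))" for l
    proof -
      have "(\<Sum>j\<in>J. b j * v j l) = b k * v k l + (\<Sum>j\<in>J - {k}. b j * v j l)"
        by (rule sum.remove) (use insert.prems k in auto)
      also have "(\<Sum>j\<in>J - {k}. b j * v j l) = (\<Sum>j\<in>J - {k}. c j * v j l)"
        by (rule sum.cong) (auto simp: b_def)
      also have "b k * v k l = - (\<Sum>j\<in>J - {k}. c j * (v j i / v k i * v k l))"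
        by (simp add: b_def sum_distrib_right mult.assoc)
      finally show ?thesis by (simp add: right_diff_distrib sum_subtractf)
    qed
    have "(\<Sum>j\<in>J. b j * v j l) = 0" if "l \<in> insert i I" for l
      unfolding eq using that c(2) k(2) by auto
    moreover have "\<exists>j\<in>J. b j \<noteq> 0" using c(1) by (auto simp: b_def)
    ultimately show ?thesis by blast
  qed
qed

text \<open>Newton interpolation: a multiple of \<open>w\<close>, which vanishes at the old nodes,
  corrects the value at the new one.\<close>

lemma exists_interpolating_poly:
  fixes f :: "'a::field \<Rightarrow> 'a"
  assumes "finite R"
  shows "\<exists>p. \<forall>x\<in>R. poly p x = f x"
  using assms
proof (induction R rule: finite_induct)
  case (insert y R)
  then obtain p where p: "\<forall>x\<in>R. poly p x = f x" by blast
  define w where "w = (\<Prod>x\<in>R. [:- x, 1:])"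
  have w: "poly w y \<noteq> 0" "\<forall>x\<in>R. poly w x = 0"
    using insert by (auto simp: w_def poly_prod)
  show ?case
    by (rule exI[of _ "p + smult ((f y - poly p y) / poly w y) w"]) (use p w in auto)
qed auto

text \<open>Evaluation of \<open>p\<close> at \<open>h\<close> by Horner's scheme. The ring has no
  unit, so constants go to multiples of the unit \<open>idm n\<close> of the corner.\<close>

definition pe :: "nat \<Rightarrow> fm \<Rightarrow> complex poly \<Rightarrow> fm" where
  "pe n h p = fold_coeffs (\<lambda>a x. cs a (idm n) + h * x) p 0"

lemma pe_0 [simp]: "pe n h 0 = 0"
  by (simp add: pe_def)

lemma pe_pCons [simp]: "pe n h (pCons a p) = cs a (idm n) + h * pe n h p"
  by (cases "p = 0 \<and> a = 0") (auto simp: pe_def)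

lemma pe_corner [simp]: "h \<in> corner n \<Longrightarrow> pe n h p \<in> corner n"
  by (induction p) auto

lemma pe_add: "pe n h (p + q) = pe n h p + pe n h q"
  by (induction p q rule: poly_induct2) (auto simp: cs_distribs distrib_left)

lemma pe_smult: "pe n h (smult c p) = cs c (pe n h p)"
  by (induction p) (auto simp: cs_distribs)

lemma pe_uminus: "pe n h (- p) = - pe n h p"
  using pe_smult[of n h "-1" p] by simp

lemma pe_diff: "pe n h (p - q) = pe n h p - pe n h q"
  using pe_add[of n h p "- q"] by (simp add: pe_uminus)

lemma pe_mult: "h \<in> corner n \<Longrightarrow> pe n h (p * q) = pe n h p * pe n h q"
  by (induction p) (auto simp: pe_add pe_smult distrib_right mult.assoc)

lemma pe_sum: "pe n h (sum f S) = (\<Sum>x\<in>S. pe n h (f x))"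
  by (induction S rule: infinite_finite_induct) (auto simp: pe_add)

lemma pe_commute:
  assumes "x \<in> corner n" "x * h = h * x"
  shows "x * pe n h p = pe n h p * x"
proof (induction p)
  case (pCons a p)
  have "x * (h * pe n h p) = h * (x * pe n h p)"
    by (metis assms(2) mult.assoc)
  also have "\<dots> = h * pe n h p * x" by (simp only: pCons mult.assoc)
  finally show ?case using assms(1) by (simp add: distrib_left distrib_right)
qed auto

lemma star_pe:
  assumes "h \<in> corner n" "star h = h"
  shows "star (pe n h p) = pe n h (map_poly cnj p)"
proof (induction p)
  case (pCons a p)
  have "star (pe n h (pCons a p)) = cs (cnj a) (idm n) + pe n h (map_poly cnj p) * h"
    by (simp add: assms pCons)
  also have "pe n h (map_poly cnj p) * h = h * pe n h (map_poly cnj p)"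
    by (rule pe_commute[symmetric]) (use assms in auto)
  also have "cs (cnj a) (idm n) + \<dots> = pe n h (map_poly cnj (pCons a p))"
    by (simp add: map_poly_pCons)
  finally show ?case .
qed auto

text \<open>A Hermitian nilpotent b is zero: for k > 0 the square of b^k is a multiple of b^(k+1) =
  0, and b^k is Hermitian, so \<open>star_mult_eq_0\<close> gives b^k = 0 and the exponent descends.
  For k = 0 the hypothesis does not speak of \<open>p\<close>.\<close>

lemma herm_nilpotent_poly:
  assumes h: "h \<in> corner n" "star (pe n h p) = pe n h p" and "pe n h (p ^ k) = 0"
  shows "pe n h p = 0 \<or> k = 0"
  using assms(3)
proof (induction k)
  case (Suc k)
  show ?case
  proof (cases "k = 0")
    case True
    then show ?thesis using Suc.prems by simp
  next
    case False
    have st: "star (pe n h (p ^ k)) = pe n h (p ^ k)"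
    proof (induction k)
      case 0
      then show ?case by (simp add: one_pCons)
    next
      case (Suc k)
      have "star (pe n h (p ^ Suc k)) = pe n h (p ^ k * p)"
        using Suc h by (simp only: power_Suc pe_mult star_mult)
      then show ?case by (simp add: mult.commute)
    qed
    have "pe n h (p ^ k) * pe n h (p ^ k) = pe n h (p ^ Suc k) * pe n h (p ^ (k - 1))"
      using False by (simp only: pe_mult[OF h(1), symmetric] power_add[symmetric]) simp
    also have "\<dots> = 0" using Suc.prems by simp
    finally have "star (pe n h (p ^ k)) * pe n h (p ^ k) = 0" unfolding st .
    then have "pe n h (p ^ k) = 0" by (rule star_mult_eq_0[OF pe_corner[OF h(1)]])
    then show ?thesis using Suc.IH False by auto
  qed
qed auto

fun pw :: "nat \<Rightarrow> fm \<Rightarrow> nat \<Rightarrow> fm" where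
  "pw n h 0 = idm n"
| "pw n h (Suc k) = h * pw n h k"

lemma pe_monom: "h \<in> corner n \<Longrightarrow> pe n h (monom c k) = cs c (pw n h k)"
  by (induction k) (auto simp: monom_0 monom_Suc)

text \<open>The n*n + 1 powers of \<open>h\<close> up to exponent n*n have only n*n entries
  each.\<close>

lemma exists_annihilating_poly:
  assumes h: "h \<in> corner n"
  shows "\<exists>q. q \<noteq> 0 \<and> pe n h q = 0"
proof -
  obtain c where c: "\<exists>j\<in>{..n * n}. c j \<noteq> 0"
    "\<forall>i\<in>{..<n} \<times> {..<n}. (\<Sum>j\<in>{..n * n}. c j * ent (pw n h j) (fst i) (snd i)) = 0"
    using exists_linear_relation[of "{..<n} \<times> {..<n}" "{..n * n}"
        "\<lambda>j i. ent (pw n h j) (fst i) (snd i)"] by auto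
  define q where "q = (\<Sum>j\<le>n * n. monom (c j) j)"
  have "coeff q j = c j" if "j \<le> n * n" for j
    using that by (simp add: q_def coeff_sum)
  then have "q \<noteq> 0" using c(1) by (metis atMost_iff coeff_0)
  moreover have "pe n h q = 0"
  proof (rule corner_eqI[of _ n])
    fix i j assume "i < n" "j < n"
    then show "ent (pe n h q) i j = ent 0 i j"
      using c(2) by (auto simp: q_def pe_sum pe_monom[OF h] ent_simps)
  qed (use h in auto)
  ultimately show ?thesis by blast
qed

lemma poly_map_cnj: "poly (map_poly cnj p) (cnj x) = cnj (poly p x)"
  by (induction p) (auto simp: map_poly_pCons)

text \<open>R is the root set of an annihilating polynomial q of least degree. A root mu gives q =
  (x - mu) r with r(h) nonzero, and the matrix r(h) itself serves as eigenvector, so no space of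
  vectors is needed. Self-adjointness makes mu real.\<close>

lemma hermitian_spectrum:
  assumes h: "h \<in> corner n" "star h = h"
  obtains R :: "real set" where "finite R"
    "\<And>p. (\<And>\<mu>. \<mu> \<in> R \<Longrightarrow> poly p (complex_of_real \<mu>) = 0) \<Longrightarrow> pe n h p = 0"
    "\<And>\<mu>. \<mu> \<in> R \<Longrightarrow> \<exists>x\<in>corner n. x \<noteq> 0 \<and> h * x = cs (complex_of_real \<mu>) x"
proof -
  define q where "q = (ARG_MIN degree q. q \<noteq> 0 \<and> pe n h q = 0)"
  from exists_annihilating_poly[OF h(1)] obtain q0 where "q0 \<noteq> 0 \<and> pe n h q0 = 0" by blast
  then have q: "q \<noteq> 0" "pe n h q = 0"
    unfolding q_def using arg_min_natI[of "\<lambda>q. q \<noteq> 0 \<and> pe n h q = 0" q0 degree] by auto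
  have min: "degree q \<le> degree r" if "r \<noteq> 0" "pe n h r = 0" for r
    unfolding q_def using arg_min_nat_le[of "\<lambda>q. q \<noteq> 0 \<and> pe n h q = 0" r degree] that by auto
  have eig: "\<exists>x\<in>corner n. x \<noteq> 0 \<and> h * x = cs \<mu> x" if mu: "poly q \<mu> = 0" for \<mu>
  proof -
    obtain r where r: "q = [:- \<mu>, 1:] * r" using mu by (metis dvdE poly_eq_0_iff_dvd)
    have "r \<noteq> 0" using q(1) r by auto
    then have "degree r < degree q" unfolding r by (subst degree_mult_eq) auto
    then have "pe n h r \<noteq> 0" using min \<open>r \<noteq> 0\<close> by force
    moreover have "h * pe n h r = cs \<mu> (pe n h r)"
      using q(2) h(1) unfolding r pe_mult[OF h(1)] by (simp add: algebra_simps)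
    ultimately show ?thesis using h(1) by (intro bexI[of _ "pe n h r"]) auto
  qed
  have real: "Im \<mu> = 0" if mu: "poly q \<mu> = 0" for \<mu>
  proof -
    obtain x where x: "x \<in> corner n" "x \<noteq> 0" "h * x = cs \<mu> x" using eig[OF mu] by blast
    have "star x * (h * x) = cs \<mu> (star x * x)" using x by simp
    moreover have "star x * (h * x) = cs (cnj \<mu>) (star x * x)"
      using arg_cong[OF x(3), of star] h(2) by (metis cs_mult_left mult.assoc star_cs star_mult)
    ultimately have "\<mu> * hs n x = cnj \<mu> * hs n x"
      using x(1) by (metis tr_simps(5) tr_star_mult)
    moreover have "hs n x \<noteq> 0" using hs_eq_0 x by blast
    ultimately have "\<mu> = cnj \<mu>" by simp
    then show ?thesis by (metis Im_complex_of_real complex_cnj_cancel_iff complex.sel(2) add.inverse_neutral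
          cnj.sel(2) equal_neg_zero)
  qed
  define R where "R = {\<mu>::real. poly q (complex_of_real \<mu>) = 0}"
  have "finite R"
  proof -
    have "finite (complex_of_real ` R)"
      by (rule finite_subset[OF _ poly_roots_finite[OF q(1)]]) (auto simp: R_def)
    then show ?thesis by (rule finite_imageD) (auto simp: inj_on_def)
  qed
  moreover have "pe n h p = 0" if p: "\<And>\<mu>. \<mu> \<in> R \<Longrightarrow> poly p (complex_of_real \<mu>) = 0" for p
  proof -
    have "poly p x = 0" if "poly q x = 0" for x
    proof -
      have "x = complex_of_real (Re x)" using real[OF that] by (simp add: complex_eq_iff)
      then show ?thesis using p[of "Re x"] that unfolding R_def by (metis mem_Collect_eq)
    qed
    \<comment> \<open>Vanishing at all roots of \<open>q\<close> makes \<open>p\<close> nilpotent at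
      \<open>h\<close>.\<close>
    then have "q dvd p ^ degree q" using nullstellensatz_univariate[of q p] q(1) by blast
    then obtain s where s: "p ^ degree q = q * s" by blast
    \<comment> \<open>The value of \<open>p\<close> at \<open>h\<close> need not be Hermitian, but
      that of \<open>p'\<close> is \<open>star (pe n h p) * pe n h p\<close>. The exponent
      \<open>Suc (degree q)\<close> used below excludes the alternative k = 0 of
      \<open>herm_nilpotent_poly\<close>.\<close>
    define p' where "p' = map_poly cnj p * p"
    have st: "star (pe n h p) = pe n h (map_poly cnj p)" by (rule star_pe[OF h])
    have "pe n h (p' ^ Suc (degree q)) = 0"
      unfolding p'_def power_mult_distrib power_Suc s using h(1) q(2)
      by (simp add: pe_mult)
    moreover have "star (pe n h p') = pe n h p'"
      unfolding p'_def pe_mult[OF h(1)] st[symmetric] by simp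
    ultimately have "pe n h p' = 0" using herm_nilpotent_poly[OF h(1)] by blast
    then have "star (pe n h p) * pe n h p = 0"
      unfolding p'_def pe_mult[OF h(1)] st .
    then show ?thesis using h(1) star_mult_eq_0 pe_corner by blast
  qed
  moreover have "\<exists>x\<in>corner n. x \<noteq> 0 \<and> h * x = cs (complex_of_real \<mu>) x" if "\<mu> \<in> R" for \<mu>
    using eig that unfolding R_def by blast
  ultimately show ?thesis using that by blast
qed

text \<open>The values and the nodes are real, so an interpolating polynomial and its conjugate
  agree on \<open>R\<close>, hence also at \<open>h\<close>.\<close>

lemma hermitian_poly:
  assumes h: "h \<in> corner n" "star h = h" and R: "finite R"
    "\<And>p. (\<And>\<mu>. \<mu> \<in> R \<Longrightarrow> poly p (complex_of_real \<mu>) = 0) \<Longrightarrow> pe n h p = 0"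
  obtains p where "\<And>\<mu>. \<mu> \<in> R \<Longrightarrow> poly p (complex_of_real \<mu>) = complex_of_real (f \<mu>)"
    "star (pe n h p) = pe n h p"
proof -
  obtain p where p: "\<forall>x\<in>complex_of_real ` R. poly p x = complex_of_real (f (Re x))"
    using exists_interpolating_poly[of "complex_of_real ` R" "\<lambda>x. complex_of_real (f (Re x))"] R(1)
    by auto
  have "pe n h (map_poly cnj p - p) = 0"
  proof (rule R(2))
    fix \<mu> assume "\<mu> \<in> R"
    then show "poly (map_poly cnj p - p) (complex_of_real \<mu>) = 0"
      using p poly_map_cnj[of p "complex_of_real \<mu>"] by simp
  qed
  then have "star (pe n h p) = pe n h p" by (simp add: star_pe[OF h] pe_diff)
  with p show ?thesis by (intro that[of p]) auto
qed

text \<open>The spectral theorem by Lagrange polynomials \<open>L\<close> evaluated at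
  \<open>h\<close>. As polynomials in \<open>h\<close> the projections stay in every commutant that
  contains \<open>h\<close>; the last clause records this.\<close>

lemma hermitian_sum_projections:
  assumes h: "h \<in> corner n" "star h = h"
  obtains R :: "real set" and P where "finite R" "h = (\<Sum>\<mu>\<in>R. cs (complex_of_real \<mu>) (P \<mu>))"
    "\<forall>\<mu>\<in>R. P \<mu> \<in> corner n \<and> P \<mu> * P \<mu> = P \<mu> \<and> star (P \<mu>) = P \<mu>"
    "\<forall>\<mu>\<in>R. \<forall>x\<in>corner n. x * h = h * x \<longrightarrow> x * P \<mu> = P \<mu> * x"
proof -
  obtain R where R: "finite R"
    "\<And>p. (\<And>\<mu>. \<mu> \<in> R \<Longrightarrow> poly p (complex_of_real \<mu>) = 0) \<Longrightarrow> pe n h p = 0"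
    using hermitian_spectrum[OF h] by metis
  have "\<exists>p. (\<forall>\<mu>\<in>R. poly p (complex_of_real \<mu>) = complex_of_real (of_bool (\<mu> = \<nu>))) \<and>
      star (pe n h p) = pe n h p" for \<nu>
    using hermitian_poly[OF h R, of "\<lambda>\<mu>. of_bool (\<mu> = \<nu>)"] by metis
  then obtain L where L: "\<And>\<nu> \<mu>. \<mu> \<in> R \<Longrightarrow> poly (L \<nu>) (complex_of_real \<mu>) = complex_of_real (of_bool (\<mu> = \<nu>))"
    "\<And>\<nu>. star (pe n h (L \<nu>)) = pe n h (L \<nu>)"
    by metis
  define P where "P = (\<lambda>\<nu>. pe n h (L \<nu>))"
  have "pe n h ([:0, 1:] - (\<Sum>\<nu>\<in>R. smult (complex_of_real \<nu>) (L \<nu>))) = 0"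
  proof (rule R(2))
    fix \<mu> assume mu: "\<mu> \<in> R"
    have "(\<Sum>\<nu>\<in>R. complex_of_real \<nu> * complex_of_real (of_bool (\<mu> = \<nu>)))
        = (\<Sum>\<nu>\<in>R. if \<nu> = \<mu> then complex_of_real \<mu> else 0)"
      by (rule sum.cong) auto
    then show "poly ([:0, 1:] - (\<Sum>\<nu>\<in>R. smult (complex_of_real \<nu>) (L \<nu>))) (complex_of_real \<mu>) = 0"
      using mu R(1) L(1)[OF mu] by (simp add: poly_sum)
  qed
  then have "h = (\<Sum>\<mu>\<in>R. cs (complex_of_real \<mu>) (P \<mu>))"
    using h(1) by (simp add: pe_diff pe_sum pe_smult P_def)
  moreover have "P \<nu> * P \<nu> = P \<nu>" for \<nu>
  proof -
    have "pe n h (L \<nu> * L \<nu> - L \<nu>) = 0" by (rule R(2)) (auto simp: L(1))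
    then show ?thesis using h(1) by (simp add: pe_diff pe_mult P_def)
  qed
  moreover have "x * P \<mu> = P \<mu> * x" if "x \<in> corner n" "x * h = h * x" for x \<mu>
    unfolding P_def by (rule pe_commute[OF that])
  moreover have "P \<mu> \<in> corner n" "star (P \<mu>) = P \<mu>" for \<mu>
    using L(2) h(1) by (simp_all add: P_def)
  ultimately show ?thesis using that[of R P] R(1) by blast
qed

text \<open>Functional calculus with 1 / sqrt for \<open>star w * w\<close>. The spectrum is
  positive: an eigenmatrix x for mu satisfies hs (w x) = mu * hs x, and injectivity keeps the left
  side nonzero.\<close>

lemma inverse_sqrt:
  assumes w: "w \<in> corner n" and inj: "\<And>x. x \<in> corner n \<Longrightarrow> w * x = 0 \<Longrightarrow> x = 0"
  obtains b where "b \<in> corner n" "star b = b" "b * (star w * w) * b = idm n"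
    "\<And>x. x \<in> corner n \<Longrightarrow> x * (star w * w) = (star w * w) * x \<Longrightarrow> x * b = b * x"
proof -
  define h where "h = star w * w"
  have h: "h \<in> corner n" "star h = h" using w by (auto simp: h_def)
  obtain R where R: "finite R"
    "\<And>p. (\<And>\<mu>. \<mu> \<in> R \<Longrightarrow> poly p (complex_of_real \<mu>) = 0) \<Longrightarrow> pe n h p = 0"
    "\<And>\<mu>. \<mu> \<in> R \<Longrightarrow> \<exists>x\<in>corner n. x \<noteq> 0 \<and> h * x = cs (complex_of_real \<mu>) x"
    using hermitian_spectrum[OF h] by metis
  have pos: "\<mu> > 0" if mu: "\<mu> \<in> R" for \<mu>
  proof -
    obtain x where x: "x \<in> corner n" "x \<noteq> 0" "h * x = cs (complex_of_real \<mu>) x"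
      using R(3)[OF mu] by blast
    have wx: "hs n (w * x) \<noteq> 0" "hs n x \<noteq> 0" using inj x w hs_eq_0 corner_mult by blast+
    have "star (w * x) * (w * x) = star x * (h * x)" by (simp add: h_def mult.assoc)
    also have "\<dots> = cs (complex_of_real \<mu>) (star x * x)" by (simp add: x(3))
    finally have "complex_of_real (hs n (w * x)) = complex_of_real \<mu> * complex_of_real (hs n x)"
      using x(1) w by (metis tr_simps(5) tr_star_mult corner_mult)
    then have "hs n (w * x) = \<mu> * hs n x" by (metis of_real_eq_iff of_real_mult)
    then show ?thesis using wx hs_nonneg[of n "w * x"] hs_nonneg[of n x]
      by (metis less_eq_real_def mult_eq_0_iff zero_less_mult_pos2)
  qed
  obtain p where p: "\<And>\<mu>. \<mu> \<in> R \<Longrightarrow> poly p (complex_of_real \<mu>) = complex_of_real (1 / sqrt \<mu>)"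
    "star (pe n h p) = pe n h p"
    using hermitian_poly[OF h R(1,2), of "\<lambda>\<mu>. 1 / sqrt \<mu>"] by metis
  have "pe n h (p * [:0, 1:] * p - 1) = 0"
  proof (rule R(2))
    fix \<mu> assume mu: "\<mu> \<in> R"
    have "1 / sqrt \<mu> * \<mu> * (1 / sqrt \<mu>) = 1" using pos[OF mu] by (simp add: real_div_sqrt)
    then have "complex_of_real (1 / sqrt \<mu>) * complex_of_real \<mu> * complex_of_real (1 / sqrt \<mu>) = 1"
      by (metis of_real_1 of_real_mult)
    then show "poly (p * [:0, 1:] * p - 1) (complex_of_real \<mu>) = 0"
      using p(1)[OF mu] by simp
  qed
  then have "pe n h p * h * pe n h p = idm n"
    using h(1) unfolding pe_diff pe_mult[OF h(1)] by (simp add: one_pCons)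
  moreover have "x * pe n h p = pe n h p * x" if "x \<in> corner n" "x * h = h * x" for x
    by (rule pe_commute[OF that])
  ultimately show ?thesis
    using that[OF pe_corner[OF h(1), of p] p(2)] unfolding h_def by blast
qed

section \<open>The linear span of unitary conjugations\<close>

text \<open>Finite combinations of the maps Ad_u with coefficients in \<open>Q\<close>: the linear
  span for \<open>Q = UNIV\<close>, the convex cone when \<open>Q\<close> is the set of nonnegative
  reals.\<close>

inductive_set comb :: "complex set \<Rightarrow> fm set \<Rightarrow> (fm \<Rightarrow> fm) set" for Q G where
  comb_zero: "(\<lambda>X. 0) \<in> comb Q G"
| comb_step: "T \<in> comb Q G \<Longrightarrow> u \<in> G \<Longrightarrow> c \<in> Q \<Longrightarrow> (\<lambda>X. T X + cs c (star u * X * u)) \<in> comb Q G"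

lemma comb_mono: "T \<in> comb Q G \<Longrightarrow> Q \<subseteq> Q' \<Longrightarrow> G \<subseteq> G' \<Longrightarrow> T \<in> comb Q' G'"
  by (induction rule: comb.induct) (auto intro: comb.intros)

lemma comb_single:
  assumes "u \<in> G" "c \<in> Q"
  shows "(\<lambda>X. cs c (star u * X * u)) \<in> comb Q G"
  using comb_step[OF comb_zero assms] by simp

lemma comb_add:
  assumes "S \<in> comb Q G" "T \<in> comb Q G"
  shows "(\<lambda>X. T X + S X) \<in> comb Q G"
  using assms(1)
proof (induction rule: comb.induct)
  case (comb_step S u c)
  have "(\<lambda>X. T X + (S X + cs c (star u * X * u))) = (\<lambda>X. (T X + S X) + cs c (star u * X * u))"
    by (simp add: add.assoc)
  then show ?case using comb.comb_step[OF comb_step.IH comb_step.hyps(2,3)] by simp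
qed (use assms in simp)

lemma comb_sum:
  "(\<And>x. x \<in> S \<Longrightarrow> f x \<in> comb Q G) \<Longrightarrow> (\<lambda>X. \<Sum>x\<in>S. f x X) \<in> comb Q G"
  by (induction S rule: infinite_finite_induct) (auto intro: comb_zero comb_add)

lemma comb_cs:
  assumes "T \<in> comb Q G" and "\<And>b. b \<in> Q \<Longrightarrow> c * b \<in> Q"
  shows "(\<lambda>X. cs c (T X)) \<in> comb Q G"
  using assms(1)
proof (induction rule: comb.induct)
  case (comb_step T u b)
  have "(\<lambda>X. cs c (T X + cs b (star u * X * u))) = (\<lambda>X. cs c (T X) + cs (c * b) (star u * X * u))"
    by (simp add: cs.scale_right_distrib)
  then show ?case using comb.comb_step[OF comb_step.IH comb_step.hyps(2)] comb_step.hyps(3) assms(2)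
    by simp
qed (simp add: comb_zero)

text \<open>Ad_v followed by Ad_u is Ad of \<open>v * u\<close>, so each unitary is multiplied by
  \<open>u\<close> on the right.\<close>

lemma comb_conj:
  assumes "T \<in> comb Q G" and "\<And>v. v \<in> G \<Longrightarrow> v * u \<in> G"
  shows "(\<lambda>X. star u * T X * u) \<in> comb Q G"
  using assms(1)
proof (induction rule: comb.induct)
  case (comb_step T v b)
  have "(\<lambda>X. star u * (T X + cs b (star v * X * v)) * u)
      = (\<lambda>X. star u * T X * u + cs b (star (v * u) * X * (v * u)))"
    by (simp add: distrib_left distrib_right mult.assoc)
  moreover have "(\<lambda>X. star u * T X * u + cs b (star (v * u) * X * (v * u))) \<in> comb Q G"
    by (rule comb.comb_step[OF comb_step.IH assms(2)[OF comb_step.hyps(2)] comb_step.hyps(3)])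
  ultimately show ?case by (simp only:)
qed (simp add: comb_zero)

lemma comb_comp:
  assumes "T \<in> comb Q G" "S \<in> comb Q G" and "\<And>v u. v \<in> G \<Longrightarrow> u \<in> G \<Longrightarrow> v * u \<in> G"
    and "\<And>b c. b \<in> Q \<Longrightarrow> c \<in> Q \<Longrightarrow> b * c \<in> Q"
  shows "(\<lambda>X. T (S X)) \<in> comb Q G"
  using assms(1)
proof (induction rule: comb.induct)
  case (comb_step T u c)
  have "(\<lambda>X. cs c (star u * S X * u)) \<in> comb Q G"
    by (intro comb_cs comb_conj assms(2)) (use assms(3,4) comb_step.hyps in auto)
  then show ?case by (rule comb_add) (rule comb_step.IH)
qed (simp add: comb_zero)

lemma comb_op:
  assumes "T \<in> comb Q G" "G \<subseteq> corner n"
  shows "op n T"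
  using assms(1)
proof (induction rule: comb.induct)
  case (comb_step T u c)
  then show ?case using assms(2) by (auto intro!: op_add_map op_cs_map op_sandwich)
qed (rule op_zero_map)

lemma comb_UNIV_diff:
  assumes "T \<in> comb UNIV G" "S \<in> comb UNIV G"
  shows "(\<lambda>X. T X - S X) \<in> comb UNIV G"
  using comb_add[OF comb_cs[OF assms(2), of "-1"] assms(1)] by simp

section \<open>The commutant of N, its unitary group and its inner derivations\<close>

locale star_alg =
  fixes n :: nat and N :: "fm set"
  assumes N_corner: "N \<subseteq> corner n" and N_star: "x \<in> N \<Longrightarrow> star x \<in> N"
begin

definition A :: "fm set" where
  "A = {a \<in> corner n. \<forall>x\<in>N. a * x = x * a}"

definition G :: "fm set" where
  "G = {u \<in> A. star u * u = idm n \<and> u * star u = idm n}"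

abbreviation S :: "(fm \<Rightarrow> fm) set" where
  "S \<equiv> comb UNIV G"

lemma A_corner [simp]: "a \<in> A \<Longrightarrow> a \<in> corner n"
  unfolding A_def by blast

lemma A_commute: "a \<in> A \<Longrightarrow> x \<in> N \<Longrightarrow> a * x = x * a"
  unfolding A_def by blast

lemma A_I: "a \<in> corner n \<Longrightarrow> (\<And>x. x \<in> N \<Longrightarrow> a * x = x * a) \<Longrightarrow> a \<in> A"
  unfolding A_def by blast

lemma A_add [simp]: "a \<in> A \<Longrightarrow> b \<in> A \<Longrightarrow> a + b \<in> A"
  by (rule A_I) (simp_all add: distrib_left distrib_right A_commute)

lemma A_diff [simp]: "a \<in> A \<Longrightarrow> b \<in> A \<Longrightarrow> a - b \<in> A"
  by (rule A_I) (simp_all add: left_diff_distrib right_diff_distrib A_commute)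

lemma A_zero [simp]: "0 \<in> A"
  by (rule A_I) simp_all

lemma A_cs [simp]: "a \<in> A \<Longrightarrow> cs c a \<in> A"
  by (rule A_I) (simp_all add: A_commute)

lemma A_idm [simp]: "idm n \<in> A"
  by (rule A_I) (use N_corner in \<open>simp_all add: subset_iff\<close>)

lemma A_mult [simp]: "a \<in> A \<Longrightarrow> b \<in> A \<Longrightarrow> a * b \<in> A"
proof -
  assume a: "a \<in> A" "b \<in> A"
  have "a * b * x = x * (a * b)" if "x \<in> N" for x
  proof -
    have "a * b * x = a * (b * x)" by (rule mult.assoc)
    also have "\<dots> = (a * x) * b" using A_commute[OF a(2) that] by (simp add: mult.assoc)
    also have "\<dots> = x * (a * b)" using A_commute[OF a(1) that] by (simp add: mult.assoc)
    finally show ?thesis .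
  qed
  then show ?thesis using a by (intro A_I) simp_all
qed

lemma A_star [simp]: "a \<in> A \<Longrightarrow> star a \<in> A"
proof -
  assume a: "a \<in> A"
  have "star a * x = x * star a" if "x \<in> N" for x
    using arg_cong[OF A_commute[OF a N_star[OF that]], of star] by simp
  then show ?thesis using a by (intro A_I) simp_all
qed

lemma A_sum [simp]: "(\<And>x. x \<in> J \<Longrightarrow> f x \<in> A) \<Longrightarrow> sum f J \<in> A"
  by (induction J rule: infinite_finite_induct) auto

lemma G_A: "u \<in> G \<Longrightarrow> u \<in> A"
  by (simp add: G_def)

lemma G_corner: "G \<subseteq> corner n"
  using G_A by auto

lemma G_mult: "u \<in> G \<Longrightarrow> v \<in> G \<Longrightarrow> u * v \<in> G"
proof -
  assume a: "u \<in> G" "v \<in> G"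
  then have c: "u \<in> corner n" "v \<in> corner n" using G_A by auto
  have "star (u * v) * (u * v) = star v * (star u * u) * v" by (simp add: mult.assoc)
  also have "\<dots> = idm n" using a c by (simp add: G_def)
  finally have 1: "star (u * v) * (u * v) = idm n" .
  have "u * v * star (u * v) = u * (v * star v) * star u" by (simp add: mult.assoc)
  also have "\<dots> = idm n" using a c by (simp add: G_def)
  finally show ?thesis using 1 a by (simp add: G_def)
qed

lemma G_star: "u \<in> G \<Longrightarrow> star u \<in> G"
  by (simp add: G_def)

lemma G_idm: "idm n \<in> G"
  by (simp add: G_def)

lemma S_op: "T \<in> S \<Longrightarrow> op n T"
  by (rule comb_op[OF _ G_corner])

lemma S_cs: "T \<in> S \<Longrightarrow> (\<lambda>X. cs c (T X)) \<in> S"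
  by (rule comb_cs) auto

lemma S_comp: "T \<in> S \<Longrightarrow> R \<in> S \<Longrightarrow> (\<lambda>X. T (R X)) \<in> S"
  by (rule comb_comp) (auto intro: G_mult)

lemma S_eqI:
  assumes "T \<in> S" "op n T'" "\<And>X. X \<in> corner n \<Longrightarrow> T' X = T X"
  shows "T' \<in> S"
  using op_eqI'[OF assms(2) S_op[OF assms(1)] assms(3)] assms(1) by simp

text \<open>The factors \<open>idm n\<close> make the commutator depend only on the corner of
  \<open>X\<close>, as \<open>op n\<close> demands.\<close>

definition ad :: "fm \<Rightarrow> fm \<Rightarrow> fm" where
  "ad a X = a * X * idm n - idm n * X * a"

lemma ad_corner: "X \<in> corner n \<Longrightarrow> a \<in> corner n \<Longrightarrow> ad a X = a * X - X * a"
  unfolding ad_def by simp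

lemma ad_op: "a \<in> corner n \<Longrightarrow> op n (ad a)"
  unfolding ad_def by (intro op_diff_map op_sandwich) auto

text \<open>The unitaries \<open>u\<close> and \<open>v = star u\<close> act as i and -i on the
  range of \<open>p\<close>. In v X u - u X v the terms X and p X p cancel and 2i (X p - p X)
  remains, whence the coefficients i/2 and -i/2.\<close>

lemma ad_projection:
  assumes p: "p \<in> A" "p * p = p" "star p = p"
  shows "ad p \<in> S"
proof -
  define u where "u = idm n + cs (\<i> - 1) p"
  define v where "v = idm n + cs (- \<i> - 1) p"
  have uv: "star u = v" "star v = u" using p(3) by (simp_all add: u_def v_def)
  have z: "(\<i> - 1) * (- \<i> - 1) = (2::complex)" "(- \<i> - 1) * (\<i> - 1) = (2::complex)"
    by (simp_all add: algebra_simps)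
  have two: "cs (\<i> - 1) p + cs (- \<i> - 1) p + cs 2 p = 0"
    by (simp add: cs.scale_left_distrib[symmetric])
  have pc: "p \<in> corner n" using p by simp
  have "u * v = idm n + (cs (\<i> - 1) p + cs (- \<i> - 1) p + cs ((\<i> - 1) * (- \<i> - 1)) p)"
    using pc p(2) by (simp add: u_def v_def distrib_left distrib_right cs.scale_right_distrib mult.commute)
  then have 1: "u * v = idm n" unfolding z two by simp
  have "v * u = idm n + (cs (\<i> - 1) p + cs (- \<i> - 1) p + cs ((\<i> - 1) * (- \<i> - 1)) p)"
    using pc p(2) by (simp add: u_def v_def distrib_left distrib_right cs.scale_right_distrib mult.commute)
  then have 2: "v * u = idm n" unfolding z two by simp
  have G: "u \<in> G" "v \<in> G" using p(1) uv 1 2 by (simp_all add: G_def) (simp_all add: u_def v_def)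
  have "(\<lambda>X. cs (\<i> / 2) (star u * X * u) + cs (- \<i> / 2) (star v * X * v)) \<in> S"
    by (intro comb_add comb_single G UNIV_I)
  then show ?thesis
  proof (rule S_eqI)
    fix X assume X: "X \<in> corner n"
    show "ad p X = cs (\<i> / 2) (star u * X * u) + cs (- \<i> / 2) (star v * X * v)"
      unfolding ad_corner[OF X pc] uv using X pc
      by (intro fm_eqI) (simp add: u_def v_def distrib_left distrib_right ent_simps field_simps)
  qed (rule ad_op[OF pc])
qed

text \<open>The spectral projections of \<open>h\<close> lie in \<open>A\<close>, because every
  element of \<open>N\<close> commutes with \<open>h\<close>; this reduces the claim to
  \<open>ad_projection\<close>.\<close>

lemma ad_hermitian:
  assumes h: "h \<in> A" "star h = h"
  shows "ad h \<in> S"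
proof -
  obtain R P where R: "finite R" "h = (\<Sum>\<mu>\<in>R. cs (complex_of_real \<mu>) (P \<mu>))"
    "\<forall>\<mu>\<in>R. P \<mu> \<in> corner n \<and> P \<mu> * P \<mu> = P \<mu> \<and> star (P \<mu>) = P \<mu>"
    "\<forall>\<mu>\<in>R. \<forall>x\<in>corner n. x * h = h * x \<longrightarrow> x * P \<mu> = P \<mu> * x"
    by (rule hermitian_sum_projections[OF A_corner[OF h(1)] h(2)])
  have "P \<mu> \<in> A" if "\<mu> \<in> R" for \<mu>
  proof (rule A_I)
    fix x assume x: "x \<in> N"
    then have "x \<in> corner n" using N_corner by blast
    then show "P \<mu> * x = x * P \<mu>" using R(4) that A_commute[OF h(1) x] by simp
  qed (use R(3) that in simp)
  then have "ad (P \<mu>) \<in> S" if "\<mu> \<in> R" for \<mu>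
    using ad_projection R(3) that by blast
  then have "(\<lambda>X. \<Sum>\<mu>\<in>R. cs (complex_of_real \<mu>) (ad (P \<mu>) X)) \<in> S"
    by (intro comb_sum S_cs)
  moreover have "(\<lambda>X. \<Sum>\<mu>\<in>R. cs (complex_of_real \<mu>) (ad (P \<mu>) X)) = ad (\<Sum>\<mu>\<in>R. cs (complex_of_real \<mu>) (P \<mu>))"
    by (rule ext) (simp add: ad_def sum_distrib_left sum_distrib_right cs.scale_right_diff_distrib sum_subtractf)
  ultimately show ?thesis unfolding R(2)[symmetric] by simp
qed

lemma ad_in_S:
  assumes a: "a \<in> A"
  shows "ad a \<in> S"
proof -
  have "ad (a + star a) \<in> S" "ad (cs \<i> (a - star a)) \<in> S"
    using a by (auto intro!: ad_hermitian simp: cs_distribs add.commute)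
  then have "(\<lambda>X. cs (1/2) (ad (a + star a) X) + cs (- \<i> / 2) (ad (cs \<i> (a - star a)) X)) \<in> S"
    by (intro comb_add S_cs)
  then show ?thesis
    by (rule S_eqI) (use a in \<open>auto intro!: ad_op fm_eqI
        simp: ad_corner distrib_left distrib_right left_diff_distrib right_diff_distrib ent_simps field_simps\<close>)
qed

text \<open>The third iterate of \<open>ad a\<close> is a^3 X - 3 a^2 X a + 3 a X a^2 - X a^3, so
  \<open>ad (a * a * a)\<close> minus this iterate is three times the claimed map, and
  \<open>S\<close> is closed under composition.\<close>

lemma square_wedge_in_S:
  assumes a: "a \<in> A"
  shows "(\<lambda>X. (a * a) * X * a - a * X * (a * a)) \<in> S"
proof -
  have "ad a \<in> S" "ad (a * a * a) \<in> S" using a by (auto intro: ad_in_S)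
  then have "(\<lambda>X. cs (1/3) (ad (a * a * a) X - ad a (ad a (ad a X)))) \<in> S"
    using S_comp[of "ad a" "\<lambda>X. ad a (ad a X)"] S_comp[of "ad a" "ad a"]
    by (intro S_cs comb_UNIV_diff) auto
  then show ?thesis
  proof (rule S_eqI)
    fix X assume X: "X \<in> corner n"
    have "ad a (ad a (ad a X)) = a * a * a * X - (a * a * X * a + a * a * X * a + a * a * X * a)
        + (a * X * a * a + a * X * a * a + a * X * a * a) - X * a * a * a"
      using X a by (simp add: ad_corner algebra_simps)
    moreover have "cs (1/3) (x + x + x) = x" for x
      by (rule fm_eqI) (simp add: ent_simps)
    ultimately show "(a * a) * X * a - a * X * (a * a) = cs (1/3) (ad (a * a * a) X - ad a (ad a (ad a X)))"
      using X a by (intro fm_eqI) (simp add: ad_corner ent_simps mult.assoc)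
  qed (use a in \<open>intro op_diff_map op_sandwich; simp\<close>)
qed

text \<open>Polarisation of the previous lemma: the boundary relation of cyclic homology.\<close>

lemma cyclic_wedge_in_S:
  assumes a: "a \<in> A" and b: "b \<in> A" and c: "c \<in> A"
  shows "(\<lambda>X. ((a * b + b * a) * X * c - c * X * (a * b + b * a)) +
      ((b * c + c * b) * X * a - a * X * (b * c + c * b)) +
      ((c * a + a * c) * X * b - b * X * (c * a + a * c))) \<in> S"
proof -
  let ?q = "\<lambda>a X. (a * a) * X * a - a * X * (a * a)"
  have "(\<lambda>X. ((?q (a + b + c) X - (?q (a + b) X + ?q (b + c) X + ?q (a + c) X))
      + (?q a X + ?q b X + ?q c X))) \<in> S"
    using a b c by (intro comb_add comb_UNIV_diff square_wedge_in_S A_add)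
  then show ?thesis
  proof (rule S_eqI)
    show "op n (\<lambda>X. ((a * b + b * a) * X * c - c * X * (a * b + b * a)) +
      ((b * c + c * b) * X * a - a * X * (b * c + c * b)) +
      ((c * a + a * c) * X * b - b * X * (c * a + a * c)))"
      using a b c by (intro op_add_map op_diff_map op_sandwich) auto
  qed (simp add: algebra_simps)
qed

end

text \<open>The tensor sum of \<open>p j\<close> and \<open>q j\<close> is a symmetric separability
  idempotent of \<open>A\<close>, written through the map that it defines: \<open>E_idm\<close> says
  that it multiplies to the unit, \<open>E_flip\<close> is the symmetry, and
  \<open>E_central\<close> moves an element of \<open>A\<close> from the outer left to the outer
  right. \<open>E_trace\<close> does the same on the inner sides.\<close>

locale expectation = star_alg +
  fixes E :: "fm \<Rightarrow> fm" and J :: "(nat \<times> nat) set" and p q :: "nat \<times> nat \<Rightarrow> fm"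
  assumes J: "finite J" and p: "j \<in> J \<Longrightarrow> p j \<in> A" and q: "j \<in> J \<Longrightarrow> q j \<in> A"
    and E_eq: "E X = (\<Sum>j\<in>J. p j * X * q j)"
    and E_flip: "X \<in> corner n \<Longrightarrow> E X = (\<Sum>j\<in>J. q j * X * p j)"
    and E_idm: "E (idm n) = idm n"
    and E_idem: "E (E X) = E X"
    and E_central: "a \<in> A \<Longrightarrow> a * E X = E X * a"
    and E_trace: "a \<in> A \<Longrightarrow> X \<in> corner n \<Longrightarrow> E (a * X) = E (X * a)"
begin

lemma E_op: "op n E"
proof -
  have "op n (\<lambda>X. \<Sum>j\<in>J. p j * X * q j)"
    using p q by (intro op_sum_map op_sandwich) auto
  then show ?thesis using E_eq by presburger
qed

lemma E_A: "a \<in> A \<Longrightarrow> E a \<in> A"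
  unfolding E_eq using p q by (intro A_sum) auto

text \<open>The obstruction term: modulo \<open>S\<close> the map a X b - b X a will turn out to be
  \<open>F (a * b - b * a)\<close>, which depends on the commutator alone and linearly.\<close>

definition F :: "fm \<Rightarrow> fm \<Rightarrow> fm" where
  "F c X = E X * c - E (c * X * idm n)"

lemma F_corner: "c \<in> corner n \<Longrightarrow> X \<in> corner n \<Longrightarrow> F c X = E X * c - E (c * X)"
  by (simp add: F_def)

lemma F_op: "c \<in> corner n \<Longrightarrow> op n (F c)"
  unfolding F_def
  by (intro op_diff_map op_mult_right[OF E_op] op_comp[OF E_op] op_sandwich) auto

text \<open>Contraction with the separability idempotent: the cyclic relation for the triple
  \<open>q j * a\<close>, \<open>p j\<close>, \<open>b\<close> is summed over j. Its first part
  becomes the wedge of \<open>E a + a\<close> with \<open>b\<close>. In the other two parts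
  centrality and the trace property cancel everything except minus \<open>F\<close> of the
  commutator.\<close>

lemma wedge_aux:
  assumes a: "a \<in> A" and b: "b \<in> A"
  shows "(\<lambda>X. (E a + a) * X * b - b * X * (E a + a) - F (a * b - b * a) X) \<in> S"
proof -
  let ?J = "\<lambda>x y z X. ((x * y + y * x) * X * z - z * X * (x * y + y * x)) +
      ((y * z + z * y) * X * x - x * X * (y * z + z * y)) +
      ((z * x + x * z) * X * y - y * X * (z * x + x * z))"
  have "(\<lambda>X. \<Sum>j\<in>J. ?J (q j * a) (p j) b X) \<in> S"
    using a b p q by (intro comb_sum cyclic_wedge_in_S) auto
  then show ?thesis
  proof (rule S_eqI)
    show "op n (\<lambda>X. (E a + a) * X * b - b * X * (E a + a) - F (a * b - b * a) X)"
      using a b E_A by (intro op_diff_map op_sandwich F_op) auto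
    fix X assume X: "X \<in> corner n"
    have ab: "a \<in> corner n" "b \<in> corner n" using a b by auto
    have qp: "(\<Sum>j\<in>J. q j * p j) = idm n"
      using E_flip[OF corner_idm] E_idm p q by (simp cong: sum.cong)
    have pq: "(\<Sum>j\<in>J. p j * q j) = idm n"
      using E_eq[of "idm n"] E_idm p q by (simp cong: sum.cong)
    have flip: "(\<Sum>j\<in>J. q j * (Y * p j)) = E Y" "(\<Sum>j\<in>J. p j * (Y * q j)) = E Y"
      if "Y \<in> corner n" for Y
      using that E_eq[of Y] E_flip[of Y] by (simp_all add: mult.assoc)
    have flipr: "(\<Sum>j\<in>J. q j * (Y * (p j * Z))) = E Y * Z" "(\<Sum>j\<in>J. p j * (Y * (q j * Z))) = E Y * Z"
      if "Y \<in> corner n" for Y Z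
      using arg_cong[OF flip(1)[OF that], of "\<lambda>W. W * Z"] arg_cong[OF flip(2)[OF that], of "\<lambda>W. W * Z"]
      by (simp_all add: sum_distrib_right mult.assoc)
    have pqr: "(\<Sum>j\<in>J. p j * (q j * Z)) = Z" if "Z \<in> corner n" for Z
      using that pq by (simp add: sum_distrib_right[symmetric] mult.assoc[symmetric])
    have l: "(\<Sum>j\<in>J. Z * f j) = Z * (\<Sum>j\<in>J. f j)" for Z and f :: "nat \<times> nat \<Rightarrow> fm"
      by (simp add: sum_distrib_left)
    have flips: "(\<Sum>j\<in>J. q j * (a * (b * (X * p j)))) = E (a * (b * X))"
      "(\<Sum>j\<in>J. q j * (a * (X * (b * p j)))) = E (a * (X * b))"
      using flip(1)[of "a * (b * X)"] flip(1)[of "a * (X * b)"] X ab by (simp_all add: mult.assoc)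
    have "(\<Sum>j\<in>J. ?J (q j * a) (p j) b X) =
        (E a * (X * b) + a * (X * b) - (b * (X * E a) + b * (X * a))) +
        ((E (b * X) * a + b * (E X * a)) - (E (a * X) * b + E (a * (X * b)))) +
        ((b * E (a * X) + E (a * (b * X))) - (E (X * b) * a + E X * (a * b)))"
      using X ab
      by (simp add: distrib_left distrib_right left_diff_distrib right_diff_distrib sum.distrib
          sum_subtractf mult.assoc l flips flip flipr pqr flip[of "_ * _", unfolded mult.assoc]
          flipr[of "_ * _", unfolded mult.assoc])
    also have "b * (E X * a) = E X * (b * a)"
      using E_central[OF b] by (metis mult.assoc)
    also have "b * E (a * X) = E (a * X) * b" by (rule E_central[OF b])
    also have "E (b * X) = E (X * b)" by (rule E_trace[OF b X])
    also have "E (a * (X * b)) = E (b * (a * X))"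
      using E_trace[OF b, of "a * X"] X ab by (simp add: mult.assoc)
    finally show "(E a + a) * X * b - b * X * (E a + a) - F (a * b - b * a) X
        = (\<Sum>j\<in>J. ?J (q j * a) (p j) b X)"
      using X ab by (simp add: F_corner algebra_simps op_diff[OF E_op])
  qed
qed

text \<open>\<open>E a\<close> commutes with \<open>b\<close>, so \<open>wedge_aux\<close> for
  \<open>E a\<close> has no \<open>F\<close> term and gives twice the wedge of \<open>E a\<close>
  with \<open>b\<close>. Half of it removes the unwanted summand.\<close>

lemma wedge:
  assumes a: "a \<in> A" and b: "b \<in> A"
  shows "(\<lambda>X. a * X * b - b * X * a - F (a * b - b * a) X) \<in> S"
proof -
  have z: "E a \<in> A" "E (E a) = E a" "E a * b = b * E a"
    using E_A[OF a] E_idem E_central[OF b] by auto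
  have "(\<lambda>X. ((E a + a) * X * b - b * X * (E a + a) - F (a * b - b * a) X)
      - cs (1/2) ((E (E a) + E a) * X * b - b * X * (E (E a) + E a) - F (E a * b - b * E a) X)) \<in> S"
    by (intro comb_UNIV_diff S_cs wedge_aux z a b)
  then show ?thesis
  proof (rule S_eqI)
    show "op n (\<lambda>X. a * X * b - b * X * a - F (a * b - b * a) X)"
      using a b by (intro op_diff_map op_sandwich F_op) auto
    fix X assume X: "X \<in> corner n"
    have "F 0 X = 0" using X by (simp add: F_corner op_zero[OF E_op])
    then show "a * X * b - b * X * a - F (a * b - b * a) X =
      ((E a + a) * X * b - b * X * (E a + a) - F (a * b - b * a) X)
      - cs (1/2) ((E (E a) + E a) * X * b - b * X * (E (E a) + E a) - F (E a * b - b * E a) X)"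
      using z by (intro fm_eqI) (simp add: distrib_left distrib_right ent_simps diff_divide_distrib)
  qed
qed

text \<open>The hypotheses say that the map kills the unit and that its values have trace zero. For
  the symmetric part, x X y + y X x = x y X + X y x - ad x (ad y X), whose first two terms sum to
  zero over j. The antisymmetric part is, modulo \<open>S\<close>, \<open>F\<close> of a sum of
  commutators, and this sum is zero as well.\<close>

lemma unital_tp_combination_in_S:
  fixes x y :: "'j \<Rightarrow> fm"
  assumes x: "\<And>j. j \<in> K \<Longrightarrow> x j \<in> A" and y: "\<And>j. j \<in> K \<Longrightarrow> y j \<in> A"
    and xy: "(\<Sum>j\<in>K. x j * y j) = 0" and yx: "(\<Sum>j\<in>K. y j * x j) = 0"
  shows "(\<lambda>X. \<Sum>j\<in>K. x j * X * y j) \<in> S"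
proof -
  let ?w = "\<lambda>j X. x j * X * y j - y j * X * x j - F (x j * y j - y j * x j) X"
  have "(\<lambda>X. ad (x j) (ad (y j) X)) \<in> S" if "j \<in> K" for j
    using S_comp[OF ad_in_S[OF x[OF that]] ad_in_S[OF y[OF that]]] .
  then have "(\<lambda>X. \<Sum>j\<in>K. cs (1/2) (?w j X - ad (x j) (ad (y j) X))) \<in> S"
    using x y by (intro comb_sum S_cs comb_UNIV_diff wedge)
  then show ?thesis
  proof (rule S_eqI)
    show "op n (\<lambda>X. \<Sum>j\<in>K. x j * X * y j)"
      using x y by (intro op_sum_map op_sandwich) auto
    fix X assume X: "X \<in> corner n"
    have "(\<Sum>j\<in>K. cs (1/2) (?w j X - ad (x j) (ad (y j) X)))
        = (\<Sum>j\<in>K. cs (1/2) (?w j X - (x j * y j * X - x j * X * y j - y j * X * x j + X * (y j * x j))))"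
      using x y X by (intro sum.cong refl) (simp add: ad_corner algebra_simps)
    also have "\<dots> = (\<Sum>j\<in>K. x j * X * y j - cs (1/2) (x j * y j * X) - cs (1/2) (X * (y j * x j))
        - cs (1/2) (F (x j * y j - y j * x j) X))"
      by (intro sum.cong refl fm_eqI) (simp add: ent_simps field_simps)
    also have "\<dots> = (\<Sum>j\<in>K. x j * X * y j) - cs (1/2) ((\<Sum>j\<in>K. x j * y j) * X)
        - cs (1/2) (X * (\<Sum>j\<in>K. y j * x j)) - cs (1/2) (\<Sum>j\<in>K. F (x j * y j - y j * x j) X)"
      by (simp add: sum_subtractf sum_distrib_left sum_distrib_right cs.scale_sum_right)
    also have "(\<Sum>j\<in>K. F (x j * y j - y j * x j) X)
        = F ((\<Sum>j\<in>K. x j * y j) - (\<Sum>j\<in>K. y j * x j)) X"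
      by (simp add: F_def sum_subtractf op_diff[OF E_op] op_sum[OF E_op] sum_distrib_left
          sum_distrib_right left_diff_distrib right_diff_distrib)
    also have "\<dots> = 0" by (simp add: xy yx F_def op_zero[OF E_op])
    finally show "(\<Sum>j\<in>K. x j * X * y j) = (\<Sum>j\<in>K. cs (1/2) (?w j X - ad (x j) (ad (y j) X)))"
      by (simp add: xy yx)
  qed
qed

end

section \<open>Interior points of the unitary cone\<close>

inductive_set lspan :: "('i \<Rightarrow> complex) set \<Rightarrow> ('i \<Rightarrow> complex) set" for V where
  lspan_zero: "(\<lambda>i. 0) \<in> lspan V"
| lspan_step: "x \<in> lspan V \<Longrightarrow> v \<in> V \<Longrightarrow> (\<lambda>i. x i + c * v i) \<in> lspan V"

text \<open>A basis with a norm bound: even for infinite \<open>V\<close>, finitely many elements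
  represent the whole span on \<open>I\<close> with coefficients controlled by the l1 norm. In the
  induction an element \<open>v0\<close> clears the coordinate \<open>i\<close> and joins the
  family.\<close>

lemma bounded_coordinates:
  assumes "finite I"
  shows "\<exists>(m::nat) f K. (\<forall>k<m. f k \<in> V) \<and> 0 \<le> K \<and> (\<forall>x\<in>lspan V. \<exists>c.
    (\<forall>i\<in>I. x i = (\<Sum>k<m. c k * f k i)) \<and> (\<forall>k<m. cmod (c k) \<le> K * (\<Sum>i\<in>I. cmod (x i))))"
  using assms
proof (induction I arbitrary: V rule: finite_induct)
  case empty
  show ?case by (rule exI[of _ 0]) auto
next
  case (insert i I)
  show ?case
  proof (cases "\<forall>v\<in>V. v i = 0")
    case True
    have x0: "x i = 0" if "x \<in> lspan V" for x
      using that by (induction rule: lspan.induct) (use True in auto)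
    obtain m :: nat and f K where *: "\<forall>k<m. f k \<in> V" "0 \<le> K" "\<forall>x\<in>lspan V. \<exists>c.
      (\<forall>i\<in>I. x i = (\<Sum>k<m. c k * f k i)) \<and> (\<forall>k<m. cmod (c k) \<le> K * (\<Sum>i\<in>I. cmod (x i)))"
      using insert.IH[of V] by blast
    have "\<exists>c. (\<forall>i\<in>insert i I. x i = (\<Sum>k<m. c k * f k i)) \<and>
        (\<forall>k<m. cmod (c k) \<le> K * (\<Sum>i\<in>insert i I. cmod (x i)))" if x: "x \<in> lspan V" for x
    proof -
      obtain c where c: "\<forall>i\<in>I. x i = (\<Sum>k<m. c k * f k i)"
        "\<forall>k<m. cmod (c k) \<le> K * (\<Sum>i\<in>I. cmod (x i))" using *(3) x by blast
      have "(\<Sum>k<m. c k * f k i) = 0" by (rule sum.neutral) (use True *(1) in auto)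
      then show ?thesis using c x0[OF x] insert.hyps by (intro exI[of _ c]) auto
    qed
    then show ?thesis using *(1,2) by blast
  next
    case False
    then obtain v0 where v0: "v0 \<in> V" "v0 i \<noteq> 0" by blast
    define g where "g = (\<lambda>(v::'a \<Rightarrow> complex) j. v j - v i / v0 i * v0 j)"
    obtain m :: nat and f K where *: "\<forall>k<m. f k \<in> g ` V" "0 \<le> K" "\<forall>x\<in>lspan (g ` V). \<exists>c.
      (\<forall>i\<in>I. x i = (\<Sum>k<m. c k * f k i)) \<and> (\<forall>k<m. cmod (c k) \<le> K * (\<Sum>i\<in>I. cmod (x i)))"
      using insert.IH[of "g ` V"] by blast
    from *(1) have "\<forall>k. \<exists>w. k < m \<longrightarrow> w \<in> V \<and> f k = g w" by blast
    then obtain w where w: "\<And>k. k < m \<Longrightarrow> w k \<in> V" "\<And>k. k < m \<Longrightarrow> f k = g (w k)" by metis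
    \<comment> \<open>Clearing the coordinate \<open>i\<close> enlarges the l1 norm by at most the
      factor 1 + B. \<open>D\<close> measures how much of \<open>v0\<close> was removed from the
      \<open>w k\<close>, and must be put back through the coefficient of \<open>v0\<close>;
      \<open>L\<close> bounds old and new coefficients together.\<close>
    define B where "B = (\<Sum>j\<in>I. cmod (v0 j)) / cmod (v0 i)"
    define D where "D = (\<Sum>k<m. cmod (w k i / v0 i))"
    define L where "L = K * (1 + B) + 1 / cmod (v0 i) + K * (1 + B) * D"
    have nn: "0 \<le> B" "0 \<le> D" unfolding B_def D_def by (auto intro!: divide_nonneg_nonneg sum_nonneg)
    have KB: "0 \<le> K * (1 + B)" using *(2) nn by simp
    have gspan: "g x \<in> lspan (g ` V)" if "x \<in> lspan V" for x
      using that
    proof (induction rule: lspan.induct)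
      case lspan_zero
      then show ?case by (simp add: g_def lspan.lspan_zero)
    next
      case (lspan_step x v c)
      have "g (\<lambda>i. x i + c * v i) = (\<lambda>j. g x j + c * g v j)"
        by (rule ext) (simp add: g_def field_simps v0)
      then show ?case using lspan.lspan_step[OF lspan_step.IH, of "g v" c] lspan_step.hyps by simp
    qed
    have "\<exists>c. (\<forall>j\<in>insert i I. x j = (\<Sum>k<Suc m. c k * (w(m := v0)) k j)) \<and>
        (\<forall>k<Suc m. cmod (c k) \<le> L * (\<Sum>j\<in>insert i I. cmod (x j)))" if x: "x \<in> lspan V" for x
    proof -
      define N where "N = (\<Sum>j\<in>insert i I. cmod (x j))"
      have N: "N = cmod (x i) + (\<Sum>j\<in>I. cmod (x j))" unfolding N_def using insert.hyps by simp
      have xi: "cmod (x i) \<le> N" "0 \<le> N" unfolding N by (auto intro!: sum_nonneg add_nonneg_nonneg)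
      obtain c where c: "\<forall>j\<in>I. g x j = (\<Sum>k<m. c k * f k j)"
        "\<forall>k<m. cmod (c k) \<le> K * (\<Sum>j\<in>I. cmod (g x j))" using *(3) gspan[OF x] by blast
      have "(\<Sum>j\<in>I. cmod (g x j)) \<le> (\<Sum>j\<in>I. cmod (x j) + cmod (x i) / cmod (v0 i) * cmod (v0 j))"
        unfolding g_def
        by (intro sum_mono order_trans[OF norm_triangle_ineq4]) (simp add: norm_mult norm_divide)
      also have "\<dots> = (\<Sum>j\<in>I. cmod (x j)) + cmod (x i) * B"
        by (simp add: sum.distrib B_def sum_distrib_left sum_divide_distrib)
      also have "\<dots> \<le> N + N * B" using xi nn N by (intro add_mono mult_right_mono) auto
      finally have gx: "(\<Sum>j\<in>I. cmod (g x j)) \<le> (1 + B) * N" by (simp add: algebra_simps)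
      have ck: "cmod (c k) \<le> K * (1 + B) * N" if "k < m" for k
        using c(2) that mult_left_mono[OF gx *(2)] by (force simp: mult.assoc)
      define b where "b = c(m := x i / v0 i - (\<Sum>k<m. c k * (w k i / v0 i)))"
      have "x j = (\<Sum>k<Suc m. b k * (w(m := v0)) k j)" if "j \<in> insert i I" for j
      proof -
        have s: "(\<Sum>k<Suc m. b k * (w(m := v0)) k j) = (\<Sum>k<m. c k * w k j)
            + (x i / v0 i - (\<Sum>k<m. c k * (w k i / v0 i))) * v0 j"
          by (simp add: b_def)
        also have "\<dots> = (\<Sum>k<m. c k * g (w k) j) + x i / v0 i * v0 j"
          by (simp add: g_def right_diff_distrib sum_subtractf left_diff_distrib sum_distrib_right mult.assoc)
        finally have s: "(\<Sum>k<Suc m. b k * (w(m := v0)) k j)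
            = (\<Sum>k<m. c k * g (w k) j) + x i / v0 i * v0 j" .
        show ?thesis
        proof (cases "j = i")
          case True
          have "g v i = 0" for v using v0 by (simp add: g_def)
          then show ?thesis unfolding s using v0 by (simp add: True)
        next
          case False
          then have "g x j = (\<Sum>k<m. c k * g (w k) j)" using c(1) that w(2) by simp
          then show ?thesis unfolding s by (simp add: g_def diff_eq_eq)
        qed
      qed
      moreover have "cmod (b k) \<le> L * N" if k: "k < Suc m" for k
      proof (cases "k = m")
        case True
        have "cmod (b k) \<le> cmod (x i / v0 i) + cmod (\<Sum>k<m. c k * (w k i / v0 i))"
          unfolding True b_def by (simp add: norm_triangle_ineq4)
        also have "cmod (\<Sum>k<m. c k * (w k i / v0 i)) \<le> (\<Sum>k<m. cmod (c k) * cmod (w k i / v0 i))"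
          by (rule order_trans[OF norm_sum]) (simp add: norm_mult norm_divide)
        also have "\<dots> \<le> (\<Sum>k<m. K * (1 + B) * N * cmod (w k i / v0 i))"
          by (intro sum_mono mult_right_mono ck) auto
        also have "\<dots> = K * (1 + B) * D * N" by (simp add: D_def sum_distrib_left mult_ac)
        also have "cmod (x i / v0 i) \<le> 1 / cmod (v0 i) * N"
          using xi by (simp add: norm_divide divide_right_mono)
        finally show ?thesis using mult_nonneg_nonneg[OF KB xi(2)] by (simp add: L_def algebra_simps)
      next
        case False
        then have "cmod (b k) \<le> K * (1 + B) * N" using ck k by (simp add: b_def)
        moreover have "0 \<le> (1 / cmod (v0 i) + K * (1 + B) * D) * N" using KB nn xi by simp
        ultimately show ?thesis by (simp add: L_def algebra_simps)
      qed
      ultimately show ?thesis unfolding N_def by blast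
    qed
    moreover have "\<forall>k<Suc m. (w(m := v0)) k \<in> V" using w v0 by auto
    moreover have "0 \<le> L" unfolding L_def using KB nn by simp
    ultimately show ?thesis by blast
  qed
qed

text \<open>The squared Hilbert-Schmidt norm of a linear map.\<close>

definition sz :: "nat \<Rightarrow> (fm \<Rightarrow> fm) \<Rightarrow> real" where
  "sz n T = (\<Sum>p<n. \<Sum>q<n. hs n (T (unit p q)))"

lemma sz_nonneg [simp]: "0 \<le> sz n T"
  unfolding sz_def by (intro sum_nonneg) auto

lemma sz_parallelogram:
  "sz n (\<lambda>X. T X + S X) + sz n (\<lambda>X. T X - S X) = 2 * sz n T + 2 * sz n S"
proof -
  have "sz n (\<lambda>X. T X + S X) + sz n (\<lambda>X. T X - S X)
      = (\<Sum>p<n. \<Sum>q<n. 2 * hs n (T (unit p q)) + 2 * hs n (S (unit p q)))"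
    unfolding sz_def hs_parallelogram[symmetric] by (simp add: sum.distrib)
  then show ?thesis by (simp add: sz_def sum.distrib sum_distrib_left)
qed

lemma sz_add_le: "sz n (\<lambda>X. T X + S X) \<le> 2 * sz n T + 2 * sz n S"
  using sz_parallelogram[of n T S] sz_nonneg[of n "\<lambda>X. T X - S X"] by linarith

lemma sz_cs: "sz n (\<lambda>X. cs c (T X)) = (cmod c)\<^sup>2 * sz n T"
  by (simp add: sz_def hs_cs sum_distrib_left)

lemma sz_diff_commute: "sz n (\<lambda>X. T X - S X) = sz n (\<lambda>X. S X - T X)"
  using sz_cs[of n "-1" "\<lambda>X. T X - S X"] by simp

lemma hs_conj:
  assumes "X \<in> corner n" "u \<in> corner n" "u * star u = idm n"
  shows "hs n (star u * X * u) = hs n X"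
proof -
  have "tr n (star (star u * X * u) * (star u * X * u)) = tr n (star u * (star X * (u * star u) * X * u))"
    by (simp add: mult.assoc)
  also have "\<dots> = tr n ((star X * (u * star u) * X * u) * star u)"
    by (rule tr_mult_commute) (use assms in auto)
  also have "\<dots> = tr n (star X * (u * star u) * X * (u * star u))"
    by (simp add: mult.assoc)
  also have "\<dots> = tr n (star X * X)" using assms by simp
  finally show ?thesis using assms by (simp add: hs_eq_tr)
qed

lemma sz_conj:
  assumes "op n T" "u \<in> corner n" "u * star u = idm n"
  shows "sz n (\<lambda>X. star u * T X * u) = sz n T"
  unfolding sz_def using hs_conj[OF op_corner[OF assms(1)] assms(2,3)] by simp

lemma ent_le_sz:
  assumes "a < n" "b < n" "p < n" "q < n"
  shows "cmod (ent (T (unit p q)) a b) \<le> sqrt (sz n T)"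
proof -
  have "(cmod (ent (T (unit p q)) a b))\<^sup>2 \<le> hs n (T (unit p q))"
    by (rule ent_le_hs[OF assms(1,2)])
  also have "\<dots> \<le> (\<Sum>q<n. hs n (T (unit p q)))"
    by (rule member_le_sum) (use assms in auto)
  also have "\<dots> \<le> sz n T" unfolding sz_def
    by (rule member_le_sum) (use assms in \<open>auto intro: sum_nonneg\<close>)
  finally show ?thesis by (rule real_le_rsqrt)
qed

text \<open>Cauchy-Schwarz over the matrix units, separately for each entry of \<open>T X\<close>:
  the Hilbert-Schmidt norm of a map bounds its operator norm.\<close>

lemma hs_op_le:
  assumes T: "op n T" and X: "X \<in> corner n"
  shows "hs n (T X) \<le> hs n X * sz n T"
proof -
  have "(cmod (ent (T X) i j))\<^sup>2 \<le> hs n X * (\<Sum>p<n. \<Sum>q<n. (cmod (ent (T (unit p q)) i j))\<^sup>2)" for i j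
  proof -
    let ?I = "{..<n} \<times> {..<n}"
    have "cmod (ent (T X) i j) \<le> (\<Sum>p<n. \<Sum>q<n. cmod (ent X p q) * cmod (ent (T (unit p q)) i j))"
      unfolding op_expand[OF T X] ent_sum ent_cs
      by (intro order_trans[OF norm_sum] sum_mono) (simp add: norm_mult)
    also have "\<dots> = (\<Sum>x\<in>?I. cmod (ent X (fst x) (snd x)) * cmod (ent (T (unit (fst x) (snd x))) i j))"
      by (simp add: sum.cartesian_product case_prod_unfold)
    finally have "(cmod (ent (T X) i j))\<^sup>2
        \<le> (\<Sum>x\<in>?I. cmod (ent X (fst x) (snd x)) * cmod (ent (T (unit (fst x) (snd x))) i j))\<^sup>2"
      by (intro power_mono) auto
    also have "\<dots> \<le> (\<Sum>x\<in>?I. (cmod (ent X (fst x) (snd x)))\<^sup>2)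
        * (\<Sum>x\<in>?I. (cmod (ent (T (unit (fst x) (snd x))) i j))\<^sup>2)"
      by (rule Cauchy_Schwarz_ineq_sum)
    also have "\<dots> = hs n X * (\<Sum>p<n. \<Sum>q<n. (cmod (ent (T (unit p q)) i j))\<^sup>2)"
      by (simp add: hs_def sum.cartesian_product case_prod_unfold)
    finally show ?thesis .
  qed
  then have "hs n (T X) \<le> (\<Sum>i<n. \<Sum>j<n. hs n X * (\<Sum>p<n. \<Sum>q<n. (cmod (ent (T (unit p q)) i j))\<^sup>2))"
    unfolding hs_def[of n "T X"] by (intro sum_mono)
  also have "\<dots> = hs n X * (\<Sum>i<n. \<Sum>j<n. \<Sum>p<n. \<Sum>q<n. (cmod (ent (T (unit p q)) i j))\<^sup>2)"
    by (simp add: sum_distrib_left)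
  also have "(\<Sum>i<n. \<Sum>j<n. \<Sum>p<n. \<Sum>q<n. (cmod (ent (T (unit p q)) i j))\<^sup>2) = sz n T"
  proof -
    define g where "g = (\<lambda>i j p q. (cmod (ent (T (unit p q)) i j))\<^sup>2)"
    have P: "(\<Sum>x\<in>{..<n} \<times> {..<n}. f (fst x) (snd x)) = (\<Sum>i<n. \<Sum>j<n. f i j)" for f :: "nat \<Rightarrow> nat \<Rightarrow> real"
      by (simp add: sum.cartesian_product case_prod_unfold)
    have "(\<Sum>i<n. \<Sum>j<n. \<Sum>p<n. \<Sum>q<n. g i j p q)
        = (\<Sum>x\<in>{..<n}\<times>{..<n}. \<Sum>y\<in>{..<n}\<times>{..<n}. g (fst x) (snd x) (fst y) (snd y))"
      by (simp only: P[of "g _ _"] P[of "\<lambda>i j. \<Sum>p<n. \<Sum>q<n. g i j p q"])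
    also have "\<dots> = (\<Sum>y\<in>{..<n}\<times>{..<n}. \<Sum>x\<in>{..<n}\<times>{..<n}. g (fst x) (snd x) (fst y) (snd y))"
      by (rule sum.swap)
    also have "\<dots> = (\<Sum>p<n. \<Sum>q<n. \<Sum>i<n. \<Sum>j<n. g i j p q)"
      by (simp only: P[of "\<lambda>i j. g i j _ _"] P[of "\<lambda>p q. \<Sum>i<n. \<Sum>j<n. g i j p q"])
    finally show ?thesis by (simp add: g_def sz_def hs_def)
  qed
  finally show ?thesis .
qed

lemma sz_comp_le:
  assumes T: "op n T" and S: "op n S"
  shows "sz n (\<lambda>X. T (S X)) \<le> sz n S * sz n T"
  unfolding sz_def[of n "\<lambda>X. T (S X)"] sz_def[of n S] sum_distrib_right
  by (intro sum_mono hs_op_le[OF T] op_corner[OF S])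

definition Rnn :: "complex set" where
  "Rnn = complex_of_real ` {0..}"

lemma Rnn_I [simp]: "0 \<le> r \<Longrightarrow> complex_of_real r \<in> Rnn"
  by (auto simp: Rnn_def)

lemma Rnn_1 [simp]: "1 \<in> Rnn"
  using Rnn_I[of 1] by simp

lemma Rnn_mult: "a \<in> Rnn \<Longrightarrow> b \<in> Rnn \<Longrightarrow> a * b \<in> Rnn"
  by (auto simp: Rnn_def simp flip: of_real_mult intro!: imageI)

section \<open>Balls inside the cone\<close>

context star_alg
begin

abbreviation K :: "(fm \<Rightarrow> fm) set" where
  "K \<equiv> comb Rnn G"

lemma K_S: "T \<in> K \<Longrightarrow> T \<in> S"
  by (rule comb_mono) auto

lemma K_op: "T \<in> K \<Longrightarrow> op n T"
  by (rule S_op[OF K_S])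

lemma G_unitary: "u \<in> G \<Longrightarrow> u * star u = idm n" "u \<in> G \<Longrightarrow> star u * u = idm n"
  by (simp_all add: G_def)

lemma G_conj_idm: "u \<in> G \<Longrightarrow> star u * idm n * u = idm n"
  using G_corner by (auto simp: G_unitary)

text \<open>\<open>bounded_coordinates\<close> applied to the vectors of all entries of all images
  of matrix units.\<close>

lemma S_bounded_coordinates:
  "\<exists>(m::nat) u B. 0 < m \<and> (\<forall>k<m. u k \<in> G) \<and> 0 \<le> B \<and>
    (\<forall>T\<in>S. \<exists>c. T = (\<lambda>X. \<Sum>k<m. cs (c k) (star (u k) * X * u k)) \<and>
        (\<forall>k<m. cmod (c k) \<le> B * sqrt (sz n T)))"
proof -
  let ?I = "{..<n} \<times> {..<n} \<times> {..<n} \<times> {..<n}"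
  define e where "e = (\<lambda>T (a, b, p, q). ent (T (unit p q)) a b)"
  define V where "V = (\<lambda>u. e (\<lambda>X. star u * X * u)) ` G"
  have span: "e T \<in> lspan V" if "T \<in> S" for T
    using that
  proof (induction rule: comb.induct)
    case comb_zero
    then show ?case using lspan_zero[of V] by (simp add: e_def ent_zero case_prod_unfold)
  next
    case (comb_step T u c)
    have "e (\<lambda>X. T X + cs c (star u * X * u)) = (\<lambda>i. e T i + c * e (\<lambda>X. star u * X * u) i)"
      by (auto simp: e_def ent_simps)
    then show ?case using lspan_step[OF comb_step.IH, of "e (\<lambda>X. star u * X * u)" c] comb_step.hyps
      by (simp add: V_def)
  qed
  obtain m :: nat and f B where *: "\<forall>k<m. f k \<in> V" "0 \<le> B" "\<forall>x\<in>lspan V. \<exists>c.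
    (\<forall>i\<in>?I. x i = (\<Sum>k<m. c k * f k i)) \<and> (\<forall>k<m. cmod (c k) \<le> B * (\<Sum>i\<in>?I. cmod (x i)))"
    using bounded_coordinates[of ?I V] by blast
  have "\<forall>k. \<exists>w. k < m \<longrightarrow> w \<in> G \<and> f k = e (\<lambda>X. star w * X * w)"
    using *(1) unfolding V_def by blast
  then obtain w where w: "\<And>k. k < m \<Longrightarrow> w k \<in> G"
    "\<And>k. k < m \<Longrightarrow> f k = e (\<lambda>X. star (w k) * X * w k)" by metis
  \<comment> \<open>A further index with unitary \<open>idm n\<close> and coefficient 0 keeps the
    family nonempty, so that an average over it makes sense.\<close>
  define u where "u = w(m := idm n)"
  have u: "u k \<in> G" if "k < Suc m" for k using that w G_idm by (auto simp: u_def)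
  define C where "C = B * card ?I"
  have "\<exists>c. T = (\<lambda>X. \<Sum>k<Suc m. cs (c k) (star (u k) * X * u k)) \<and>
        (\<forall>k<Suc m. cmod (c k) \<le> C * sqrt (sz n T))" if T: "T \<in> S" for T
  proof -
    obtain c where c: "\<forall>i\<in>?I. e T i = (\<Sum>k<m. c k * f k i)"
      "\<forall>k<m. cmod (c k) \<le> B * (\<Sum>i\<in>?I. cmod (e T i))" using *(3) span[OF T] by blast
    have "(\<Sum>i\<in>?I. cmod (e T i)) \<le> (\<Sum>i\<in>?I. sqrt (sz n T))"
      by (intro sum_mono) (auto simp: e_def intro: ent_le_sz)
    then have "B * (\<Sum>i\<in>?I. cmod (e T i)) \<le> C * sqrt (sz n T)"
      using mult_left_mono[OF _ *(2)] by (fastforce simp: C_def mult.assoc)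
    then have 1: "cmod ((c(m := 0)) k) \<le> C * sqrt (sz n T)" if "k < Suc m" for k
      using c(2) that *(2) by (force simp: C_def less_Suc_eq)
    have cop: "op n (\<lambda>X. \<Sum>k<m. cs (c k) (star (w k) * X * w k))"
      by (intro op_sum_map op_cs_map op_sandwich) (use w(1) G_A in auto)
    have "T = (\<lambda>X. \<Sum>k<m. cs (c k) (star (w k) * X * w k))"
    proof (rule op_eqI[OF S_op[OF T] cop])
      fix p q assume pq: "p < n" "q < n"
      show "T (unit p q) = (\<Sum>k<m. cs (c k) (star (w k) * unit p q * w k))"
      proof (rule corner_eqI[OF op_corner[OF S_op[OF T]] op_corner[OF cop]])
        fix a b assume ab: "a < n" "b < n"
        have "ent (T (unit p q)) a b = (\<Sum>k<m. c k * f k (a, b, p, q))"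
          using c(1)[rule_format, of "(a, b, p, q)"] pq ab by (simp add: e_def)
        also have "\<dots> = (\<Sum>k<m. c k * ent (star (w k) * unit p q * w k) a b)"
          by (intro sum.cong) (auto simp: w(2) e_def)
        finally show "ent (T (unit p q)) a b = ent (\<Sum>k<m. cs (c k) (star (w k) * unit p q * w k)) a b"
          by (simp add: ent_simps)
      qed
    qed
    then have "T = (\<lambda>X. \<Sum>k<Suc m. cs ((c(m := 0)) k) (star (u k) * X * u k))"
      by (simp add: u_def)
    with 1 show ?thesis by blast
  qed
  moreover have "0 \<le> C" unfolding C_def using *(2) by simp
  ultimately show ?thesis using u by (intro exI[of _ "Suc m"] exI[of _ u] exI[of _ C]) blast
qed

definition herm :: "(fm \<Rightarrow> fm) \<Rightarrow> bool" where
  "herm T \<longleftrightarrow> (\<forall>X. T (star X) = star (T X))"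

text \<open>\<open>C\<close> is the average of the finitely many conjugations that span
  \<open>S\<close>. A small \<open>R\<close> has coordinates of modulus at most 1/m, and as
  \<open>R\<close> is Hermitian they may be replaced by their real parts; all weights of C + R are
  then nonnegative.\<close>

lemma exists_interior_point:
  "\<exists>C\<in>K. \<exists>\<delta>>0. C (idm n) = idm n \<and>
    (\<forall>R\<in>S. herm R \<longrightarrow> sz n R \<le> \<delta> \<longrightarrow> (\<lambda>X. C X + R X) \<in> K)"
proof -
  obtain m :: nat and u B where m: "0 < m" "\<And>k. k < m \<Longrightarrow> u k \<in> G" "0 \<le> B"
    and B: "\<And>T. T \<in> S \<Longrightarrow> \<exists>c. T = (\<lambda>X. \<Sum>k<m. cs (c k) (star (u k) * X * u k)) \<and>
        (\<forall>k<m. cmod (c k) \<le> B * sqrt (sz n T))"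
    using S_bounded_coordinates by blast
  define C where "C = (\<lambda>X. \<Sum>k<m. cs (complex_of_real (1 / m)) (star (u k) * X * u k))"
  \<comment> \<open>Chosen so that B * sqrt delta is at most 1/m; B + 1 instead of B allows for B =
    0.\<close>
  define \<delta> where "\<delta> = (1 / (m * (B + 1)))\<^sup>2"
  have pos: "0 < 1 / (m * (B + 1))" using m by simp
  have "C \<in> K" unfolding C_def using m by (intro comb_sum comb_single Rnn_I) auto
  moreover have "C (idm n) = idm n"
  proof -
    have "C (idm n) = (\<Sum>k<m. cs (complex_of_real (1 / m)) (idm n))"
      unfolding C_def using m(2) by (intro sum.cong) (auto simp: G_conj_idm)
    also have "\<dots> = idm n" using m(1) by (simp add: cs.scale_sum_left[symmetric])
    finally show ?thesis .
  qed
  moreover have "(\<lambda>X. C X + R X) \<in> K" if R: "R \<in> S" "herm R" "sz n R \<le> \<delta>" for R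
  proof -
    obtain c where c: "R = (\<lambda>X. \<Sum>k<m. cs (c k) (star (u k) * X * u k))"
      "\<forall>k<m. cmod (c k) \<le> B * sqrt (sz n R)" using B[OF R(1)] by blast
    have "sqrt (sz n R) \<le> 1 / (m * (B + 1))"
      by (rule real_le_lsqrt) (use R(3) pos in \<open>auto simp: \<delta>_def\<close>)
    then have "B * sqrt (sz n R) \<le> B * (1 / (m * (B + 1)))" using m(3) by (rule mult_left_mono)
    also have "\<dots> = B / (B + 1) * (1 / m)" by simp
    also have "\<dots> \<le> 1 * (1 / m)" using m by (intro mult_right_mono) auto
    also have "\<dots> = 1 / m" by simp
    finally have Bm: "B * sqrt (sz n R) \<le> 1 / m" .
    have re: "0 \<le> 1 / m + Re (c k)" if "k < m" for k
      using c(2) that Bm abs_Re_le_cmod[of "c k"] by (smt (verit))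
    have R2: "R X = (\<Sum>k<m. cs (complex_of_real (Re (c k))) (star (u k) * X * u k))" for X
    proof -
      have "R X = cs (1/2) (R X + star (R (star X)))"
        using R(2) by (intro fm_eqI) (simp add: herm_def ent_simps)
      also have "R X + star (R (star X)) = (\<Sum>k<m. cs (c k) (star (u k) * X * u k))
          + (\<Sum>k<m. cs (cnj (c k)) (star (u k) * X * u k))"
        unfolding c(1) by (simp add: star_sum mult.assoc)
      also have "\<dots> = (\<Sum>k<m. cs (c k + cnj (c k)) (star (u k) * X * u k))"
        by (simp add: cs.scale_left_distrib sum.distrib)
      also have "cs (1/2) \<dots> = (\<Sum>k<m. cs (complex_of_real (Re (c k))) (star (u k) * X * u k))"
        by (simp add: cs.scale_sum_right complex_add_cnj)
      finally show ?thesis .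
    qed
    have "(\<lambda>X. C X + R X) = (\<lambda>X. \<Sum>k<m. cs (complex_of_real (1 / m + Re (c k))) (star (u k) * X * u k))"
      unfolding R2 C_def of_real_add cs.scale_left_distrib sum.distrib by simp
    also have "\<dots> \<in> K"
      using m(2) re by (intro comb_sum comb_single Rnn_I) auto
    finally show ?thesis .
  qed
  moreover have "0 < \<delta>" unfolding \<delta>_def using pos by (intro zero_less_power)
  ultimately show ?thesis by blast
qed

text \<open>The ball around \<open>C\<close> has the same radius after translation by any \<open>v \<in> G\<close>, hence around every convex
  combination of translates.\<close>

lemma uniform_interior:
  assumes C: "\<And>R. R \<in> S \<Longrightarrow> herm R \<Longrightarrow> sz n R \<le> \<delta> \<Longrightarrow> (\<lambda>X. C X + R X) \<in> K"
    and R: "R \<in> S" "herm R" "sz n R \<le> \<delta>" and y: "y \<in> K"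
  shows "\<exists>w. y (idm n) = cs w (idm n) \<and> (\<lambda>X. y (C X) + cs w (R X)) \<in> K"
  using y
proof (induction rule: comb.induct)
  case comb_zero
  show ?case by (rule exI[of _ 0]) (simp add: comb.comb_zero)
next
  case (comb_step T u c)
  then obtain w where w: "T (idm n) = cs w (idm n)" "(\<lambda>X. T (C X) + cs w (R X)) \<in> K" by blast
  have u: "u \<in> corner n" "u * star u = idm n" "star u * u = idm n"
    using comb_step.hyps G_corner G_unitary by blast+
  \<comment> \<open>\<open>R\<close> is conjugated by \<open>star u\<close>, which keeps its size,
    so that Ad_u carries C + R' to Ad_u C + R. The scalar \<open>w\<close> in the induction is the
    total weight of \<open>y\<close>, read off at the unit.\<close>
  define R' where "R' = (\<lambda>X. star (star u) * R X * star u)"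
  have "R' \<in> S" unfolding R'_def
    by (rule comb_conj[OF R(1)]) (use comb_step.hyps G_star G_mult in blast)
  moreover have "herm R'" using R(2) by (simp add: herm_def R'_def mult.assoc)
  moreover have "sz n R' = sz n R"
    unfolding R'_def by (rule sz_conj[OF S_op[OF R(1)]]) (use u in auto)
  ultimately have "(\<lambda>X. C X + R' X) \<in> K" using C R(3) by simp
  then have "(\<lambda>X. cs c (star u * (C X + R' X) * u)) \<in> K"
    using comb_step.hyps by (intro comb_cs comb_conj Rnn_mult G_mult)
  then have "(\<lambda>X. (T (C X) + cs w (R X)) + cs c (star u * (C X + R' X) * u)) \<in> K"
    using comb_add w(2) by blast
  moreover have "star u * R' X * u = R X" for X
  proof -
    have "star u * R' X * u = (star u * u) * R X * (star u * u)" by (simp add: R'_def mult.assoc)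
    then show ?thesis using u op_corner[OF S_op[OF R(1)]] by simp
  qed
  then have "(\<lambda>X. (T (C X) + cs w (R X)) + cs c (star u * (C X + R' X) * u))
      = (\<lambda>X. (T (C X) + cs c (star u * C X * u)) + cs (w + c) (R X))"
    by (auto simp: distrib_left distrib_right cs_distribs add_ac)
  ultimately show ?case using w(1) u by (intro exI[of _ "w + c"]) (auto simp: cs_distribs)
qed

end

section \<open>The expectation as an interior point of the cone\<close>

context expectation
begin

lemma id_S: "(\<lambda>X. idm n * X * idm n) \<in> S"
  using comb_single[OF G_idm, of 1 UNIV] by simp

text \<open>Subtracting the identity map makes both sums vanish. The index \<open>None\<close>
  carries this extra term, with left factor \<open>- idm n\<close> and right factor
  \<open>idm n\<close>.\<close>

lemma unital_tp_in_S:
  fixes x y :: "'j \<Rightarrow> fm"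
  assumes K: "finite K'" and x: "\<And>j. j \<in> K' \<Longrightarrow> x j \<in> A" and y: "\<And>j. j \<in> K' \<Longrightarrow> y j \<in> A"
    and xy: "(\<Sum>j\<in>K'. x j * y j) = idm n" and yx: "(\<Sum>j\<in>K'. y j * x j) = idm n"
  shows "(\<lambda>X. \<Sum>j\<in>K'. x j * X * y j) \<in> S"
proof -
  let ?L = "insert None (Some ` K')"
  define x' where "x' = (\<lambda>j. case j of None \<Rightarrow> - idm n | Some j \<Rightarrow> x j)"
  define y' where "y' = (\<lambda>j. case j of None \<Rightarrow> idm n | Some j \<Rightarrow> y j)"
  have sum: "(\<Sum>j\<in>?L. f j) = f None + (\<Sum>j\<in>K'. f (Some j))" for f :: "'j option \<Rightarrow> fm"
    using K by (subst sum.insert) (auto simp: sum.reindex)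
  have "(\<lambda>X. \<Sum>j\<in>?L. x' j * X * y' j) \<in> S"
  proof (rule unital_tp_combination_in_S)
    show "x' j \<in> A" if "j \<in> ?L" for j using that x A_diff[OF A_zero A_idm] by (auto simp: x'_def)
    show "y' j \<in> A" if "j \<in> ?L" for j using that y by (auto simp: y'_def)
  qed (simp_all only: sum, simp_all add: x'_def y'_def xy yx)
  then have "(\<lambda>X. idm n * X * idm n + (\<Sum>j\<in>?L. x' j * X * y' j)) \<in> S"
    using comb_add id_S by blast
  then show ?thesis unfolding sum by (simp add: x'_def y'_def)
qed

lemma E_qp: "(\<Sum>j\<in>J. q j * p j) = idm n" and E_pq: "(\<Sum>j\<in>J. p j * q j) = idm n"
  using E_flip[OF corner_idm] E_eq[of "idm n"] E_idm p q by (simp_all cong: sum.cong)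

lemma E_S: "E \<in> S"
proof -
  have "(\<lambda>X. \<Sum>j\<in>J. p j * X * q j) \<in> S"
    using J p q E_pq E_qp by (intro unital_tp_in_S)
  then show ?thesis using E_eq by presburger
qed

text \<open>\<open>E_trace\<close> moves \<open>star u\<close> to the far right, where it cancels
  \<open>u\<close>. It is stated for elements of the corner, so \<open>X\<close> is cut
  first.\<close>

lemma E_conj:
  assumes u: "u \<in> G"
  shows "E (star u * X * u) = E X"
proof -
  have uA: "star u \<in> A" "star u \<in> corner n" "u \<in> corner n" using u G_A A_star A_corner by blast+
  let ?Y = "idm n * X * idm n"
  have "star u * X * u = (star u * idm n) * X * (idm n * u)" using uA by simp
  then have "E (star u * X * u) = E (star u * (?Y * u))" by (simp only: mult.assoc)
  also have "\<dots> = E (?Y * u * star u)" using uA by (intro E_trace) auto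
  also have "?Y * u * star u = ?Y * (u * star u)" by (simp only: mult.assoc)
  also have "\<dots> = ?Y" using u by (simp add: G_unitary)
  finally show ?thesis by (simp add: op_cut[OF E_op])
qed

lemma E_comb: "y \<in> comb Q G \<Longrightarrow> \<exists>w. y (idm n) = cs w (idm n) \<and> (\<forall>X. E (y X) = cs w (E X))"
proof (induction rule: comb.induct)
  case comb_zero
  show ?case by (rule exI[of _ 0]) (simp add: op_zero[OF E_op])
next
  case (comb_step T u c)
  then obtain w where w: "T (idm n) = cs w (idm n)" "\<forall>X. E (T X) = cs w (E X)" by blast
  have "star u * idm n * u = idm n" using comb_step.hyps G_corner G_unitary by (simp add: subset_iff)
  then show ?case using w E_conj[OF comb_step.hyps(2)]
    by (intro exI[of _ "w + c"]) (simp add: op_add[OF E_op] op_cs[OF E_op] cs_distribs)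
qed

lemma cs_eq_idm: "cs w (idm n) = idm n \<Longrightarrow> X \<in> corner n \<Longrightarrow> cs w X = X"
  by (metis cs_mult_left idm_mult)

lemma E_unital_comb: "y \<in> comb Q G \<Longrightarrow> y (idm n) = idm n \<Longrightarrow> E (y X) = E X"
  using E_comb[of y Q] cs_eq_idm op_corner[OF E_op] by metis

text \<open>A sequence y_k in the unital cone whose norm tends to the infimum is asymptotically
  fixed by every Ad_u with u in \<open>G\<close>. Hence T y_k is close to w y_k for every T in
  \<open>S\<close> with T(1) = w 1. Since \<open>E\<close> lies in \<open>S\<close> and E y_k = E,
  the y_k tend to \<open>E\<close>.\<close>

lemma unital_cone_approximates_E:
  "\<exists>y. (\<forall>k. y k \<in> K \<and> y k (idm n) = idm n) \<and> (\<lambda>k. sz n (\<lambda>X. y k X - E X)) \<longlonglongrightarrow> 0"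
proof -
  define C1 where "C1 = {y \<in> K. y (idm n) = idm n}"
  define I where "I = Inf (sz n ` C1)"
  have "(\<lambda>X. idm n * X * idm n) \<in> K"
    using comb_single[OF G_idm Rnn_1] by simp
  then have ne: "sz n ` C1 \<noteq> {}" unfolding C1_def by auto
  have bdd: "bdd_below (sz n ` C1)" by (rule bdd_belowI[of _ 0]) auto
  have I_le: "I \<le> sz n y" if "y \<in> C1" for y
    unfolding I_def by (rule cInf_lower) (use that bdd in auto)
  have "\<exists>y\<in>C1. sz n y < I + 1 / Suc k" for k
    using cInf_lessD[OF ne, of "I + 1 / Suc k"] unfolding I_def by auto
  then obtain y where y: "\<And>k. y k \<in> C1" "\<And>k. sz n (y k) < I + 1 / Suc k" by metis
  have yK: "y k \<in> K" "y k (idm n) = idm n" for k using y(1) by (auto simp: C1_def)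
  have "(\<lambda>k. 4 * (1 / real (Suc k))) \<longlonglongrightarrow> 4 * 0"
    by (intro tendsto_mult tendsto_const LIMSEQ_Suc lim_1_over_n)
  then have lim4: "(\<lambda>k. 4 * (1 / real (Suc k))) \<longlonglongrightarrow> 0" by simp
  \<comment> \<open>The mean of Ad_u y_k and y_k is again in the unital cone, so its squared norm is
    at least I. The parallelogram law then bounds the squared distance by 4 (sz y_k - I), which is
    below 4 / (k + 1).\<close>
  have diff: "(\<lambda>k. sz n (\<lambda>X. star u * y k X * u - y k X)) \<longlonglongrightarrow> 0" if u: "u \<in> G" for u
  proof (rule tendsto_sandwich[OF _ _ tendsto_const lim4])
    have "sz n (\<lambda>X. star u * y k X * u - y k X) \<le> 4 * (1 / real (Suc k))" for k
    proof -
      let ?a = "\<lambda>X. star u * y k X * u"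
      have aK: "?a \<in> K" by (rule comb_conj[OF yK(1)]) (use u G_mult in blast)
      have uc: "u \<in> corner n" "u * star u = idm n" "star u * u = idm n"
        using u G_corner G_unitary by blast+
      have "(\<lambda>X. cs (complex_of_real (1/2)) (?a X + y k X)) \<in> K"
        by (intro comb_cs comb_add aK yK Rnn_mult Rnn_I) auto
      moreover have "cs (complex_of_real (1/2)) (?a (idm n) + y k (idm n)) = idm n"
        using uc by (simp add: yK(2)) (rule fm_eqI, simp add: ent_simps)
      ultimately have "I \<le> sz n (\<lambda>X. cs (complex_of_real (1/2)) (?a X + y k X))"
        by (intro I_le) (simp add: C1_def)
      then have "4 * I \<le> sz n (\<lambda>X. ?a X + y k X)"
        unfolding sz_cs by (simp add: power2_eq_square)
      moreover have "sz n ?a = sz n (y k)"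
        by (rule sz_conj[OF K_op[OF yK(1)] uc(1,2)])
      ultimately show ?thesis
        using sz_parallelogram[of n ?a "y k"] y(2)[of k] by (simp add: algebra_simps)
    qed
    then show "\<forall>\<^sub>F k in sequentially. sz n (\<lambda>X. star u * y k X * u - y k X) \<le> 4 * (1 / real (Suc k))"
      by simp
  qed simp
  have diffS: "\<exists>w. T (idm n) = cs w (idm n) \<and>
      (\<lambda>k. sz n (\<lambda>X. T (y k X) - cs w (y k X))) \<longlonglongrightarrow> 0" if "T \<in> S" for T
    using that
  proof (induction rule: comb.induct)
    case comb_zero
    show ?case by (rule exI[of _ 0]) (simp add: sz_def hs_def ent_zero)
  next
    case (comb_step T u c)
    then obtain w where w: "T (idm n) = cs w (idm n)"
      "(\<lambda>k. sz n (\<lambda>X. T (y k X) - cs w (y k X))) \<longlonglongrightarrow> 0" by blast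
    let ?d = "\<lambda>k X. star u * y k X * u - y k X"
    have "(\<lambda>k. 2 * sz n (\<lambda>X. T (y k X) - cs w (y k X)) + 2 * ((cmod c)\<^sup>2 * sz n (?d k)))
        \<longlonglongrightarrow> 2 * 0 + 2 * ((cmod c)\<^sup>2 * 0)"
      by (intro tendsto_intros w(2) diff comb_step.hyps)
    then have lim: "(\<lambda>k. 2 * sz n (\<lambda>X. T (y k X) - cs w (y k X)) + 2 * ((cmod c)\<^sup>2 * sz n (?d k)))
        \<longlonglongrightarrow> 0" by simp
    have "sz n (\<lambda>X. T (y k X) + cs c (star u * y k X * u) - cs (w + c) (y k X))
        \<le> 2 * sz n (\<lambda>X. T (y k X) - cs w (y k X)) + 2 * ((cmod c)\<^sup>2 * sz n (?d k))" for k
    proof -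
      have "(\<lambda>X. T (y k X) + cs c (star u * y k X * u) - cs (w + c) (y k X))
          = (\<lambda>X. (T (y k X) - cs w (y k X)) + cs c (?d k X))"
        by (simp add: cs_distribs algebra_simps)
      then show ?thesis
        using sz_add_le[of n "\<lambda>X. T (y k X) - cs w (y k X)" "\<lambda>X. cs c (?d k X)"]
        by (simp only: sz_cs)
    qed
    then have "(\<lambda>k. sz n (\<lambda>X. T (y k X) + cs c (star u * y k X * u) - cs (w + c) (y k X))) \<longlonglongrightarrow> 0"
      by (intro tendsto_sandwich[OF _ _ tendsto_const lim]) auto
    moreover have "star u * idm n * u = idm n"
      using comb_step.hyps G_corner G_unitary by (simp add: subset_iff)
    ultimately show ?case using w(1) by (intro exI[of _ "w + c"]) (simp add: cs_distribs)
  qed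
  \<comment> \<open>E minus the identity kills the unit, so its composites with y_k tend to zero;
    these composites are E - y_k.\<close>
  have "(\<lambda>X. E X - idm n * X * idm n) \<in> S" by (intro comb_UNIV_diff E_S id_S)
  from diffS[OF this] obtain w where w: "cs w (idm n) = 0"
    "(\<lambda>k. sz n (\<lambda>X. (E (y k X) - idm n * y k X * idm n) - cs w (y k X))) \<longlonglongrightarrow> 0"
    by (auto simp: E_idm)
  have w0: "cs w X = 0" if "X \<in> corner n" for X
    using w(1) that by (metis cs_mult_left idm_mult mult_zero_left)
  have yc: "y k X \<in> corner n" for k X by (rule op_corner[OF K_op[OF yK(1)]])
  have "sz n (\<lambda>X. (E (y k X) - idm n * y k X * idm n) - cs w (y k X)) = sz n (\<lambda>X. y k X - E X)" for k
  proof -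
    have "(\<lambda>X. (E (y k X) - idm n * y k X * idm n) - cs w (y k X)) = (\<lambda>X. E X - y k X)"
      using w0[OF yc] yc E_unital_comb[OF yK] by auto
    then show ?thesis by (simp add: sz_diff_commute)
  qed
  then show ?thesis using yK w(2) by (intro exI[of _ y]) simp
qed

text \<open>The maps y_k approximate E but need not carry a ball. The composites y_k C do, with the
  radius of the ball around \<open>C\<close> by \<open>uniform_interior\<close>, and they still
  approximate E because E C = E.\<close>

theorem near_expectation_in_cone:
  "\<exists>\<epsilon>>0. \<forall>\<Psi>\<in>S. herm \<Psi> \<longrightarrow> \<Psi> (idm n) = idm n \<longrightarrow> sz n (\<lambda>X. \<Psi> X - E X) \<le> \<epsilon> \<longrightarrow> \<Psi> \<in> K"
proof -
  obtain C \<delta> where C: "C \<in> K" "C (idm n) = idm n" "0 < \<delta>"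
    "\<And>R. R \<in> S \<Longrightarrow> herm R \<Longrightarrow> sz n R \<le> \<delta> \<Longrightarrow> (\<lambda>X. C X + R X) \<in> K"
    using exists_interior_point by blast
  obtain y where y: "\<And>k. y k \<in> K" "\<And>k. y k (idm n) = idm n"
    "(\<lambda>k. sz n (\<lambda>X. y k X - E X)) \<longlonglongrightarrow> 0"
    using unital_cone_approximates_E by blast
  have "(\<lambda>k. sz n C * sz n (\<lambda>X. y k X - E X)) \<longlonglongrightarrow> sz n C * 0"
    by (intro tendsto_intros y(3))
  then have "\<forall>\<^sub>F k in sequentially. sz n C * sz n (\<lambda>X. y k X - E X) < \<delta> / 4"
    by (rule order_tendstoD(2)) (use C(3) in simp)
  then obtain k where k: "sz n C * sz n (\<lambda>X. y k X - E X) < \<delta> / 4"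
    by (auto simp: eventually_sequentially)
  have CE: "E (C X) = E X" for X by (rule E_unital_comb[OF C(1,2)])
  have yE: "sz n (\<lambda>X. y k (C X) - E X) \<le> \<delta> / 4"
    using sz_comp_le[OF op_diff_map[OF K_op[OF y(1)[of k]] E_op] K_op[OF C(1)]] k
    by (simp add: CE mult.commute)
  have KH: "T (star X) = star (T X)" if "T \<in> K" for T X
    using that
  proof (induction rule: comb.induct)
    case (comb_step T u c)
    then have "cnj c = c" by (auto simp: Rnn_def)
    then show ?case using comb_step by (simp add: mult.assoc)
  qed simp
  \<comment> \<open>The triangle inequality for squared norms costs a factor 2, so two distances of
    delta/4 add up to at most delta.\<close>
  have "\<Psi> \<in> K" if \<Psi>: "\<Psi> \<in> S" "herm \<Psi>" "\<Psi> (idm n) = idm n" "sz n (\<lambda>X. \<Psi> X - E X) \<le> \<delta> / 4" for \<Psi>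
  proof -
    define R where "R = (\<lambda>X. \<Psi> X - y k (C X))"
    have yC: "(\<lambda>X. y k (C X)) \<in> K"
      by (rule comb_comp[OF y(1) C(1) G_mult Rnn_mult])
    have "R \<in> S" unfolding R_def by (intro comb_UNIV_diff \<Psi>(1) K_S[OF yC])
    moreover have "herm R" using \<Psi>(2) KH[OF yC] by (simp add: herm_def R_def)
    moreover have "sz n R \<le> \<delta>"
    proof -
      have "sz n R \<le> 2 * sz n (\<lambda>X. \<Psi> X - E X) + 2 * sz n (\<lambda>X. E X - y k (C X))"
        using sz_add_le[of n "\<lambda>X. \<Psi> X - E X" "\<lambda>X. E X - y k (C X)"]
        by (simp add: R_def)
      then show ?thesis using yE \<Psi>(4) sz_diff_commute[of n E "\<lambda>X. y k (C X)"] by simp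
    qed
    ultimately obtain w where w: "y k (idm n) = cs w (idm n)" "(\<lambda>X. y k (C X) + cs w (R X)) \<in> K"
      using uniform_interior[OF C(4) _ _ _ y(1)] by blast
    have "cs w (R X) = R X" for X
      using w(1) y(2) cs_eq_idm op_corner[OF S_op[OF \<open>R \<in> S\<close>]] by metis
    then have "(\<lambda>X. y k (C X) + cs w (R X)) = \<Psi>" by (simp add: R_def)
    then show ?thesis using w(2) by simp
  qed
  then show ?thesis using C(3) by (intro exI[of _ "\<delta> / 4"]) simp
qed

end

section \<open>Bimodule maps, multiplicative domains and intertwiners\<close>

lemma unit_mult_expand:
  assumes "m \<in> corner n" "p < n" "q < n"
  shows "unit q p * m = (\<Sum>r<n. cs (ent m p r) (unit q r))"
    and "m * unit q p = (\<Sum>r<n. cs (ent m r q) (unit r p))"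
proof -
  show "unit q p * m = (\<Sum>r<n. cs (ent m p r) (unit q r))"
  proof (rule corner_eqI[of _ n])
    fix i j assume ij: "i < n" "j < n"
    have "ent (unit q p * m) i j = (\<Sum>k<n. if k = p then (if i = q then ent m p j else 0) else 0)"
      unfolding ent_mult[OF corner_unit[OF assms(3,2)]] by (intro sum.cong) (auto simp: ent_unit)
    also have "\<dots> = (\<Sum>r<n. if r = j then (if i = q then ent m p j else 0) else 0)"
      using assms ij by simp
    also have "\<dots> = (\<Sum>r<n. ent m p r * (if i = q \<and> j = r then 1 else 0))"
      by (intro sum.cong) auto
    finally show "ent (unit q p * m) i j = ent (\<Sum>r<n. cs (ent m p r) (unit q r)) i j"
      by (simp add: ent_simps)
  qed (use assms in \<open>auto intro!: corner_sum\<close>)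
  show "m * unit q p = (\<Sum>r<n. cs (ent m r q) (unit r p))"
  proof (rule corner_eqI[of _ n])
    fix i j assume ij: "i < n" "j < n"
    have "ent (m * unit q p) i j = (\<Sum>k<n. if k = q then (if j = p then ent m i q else 0) else 0)"
      unfolding ent_mult[OF assms(1)] by (intro sum.cong) (auto simp: ent_unit)
    also have "\<dots> = (\<Sum>r<n. if r = i then (if j = p then ent m i q else 0) else 0)"
      using assms ij by simp
    also have "\<dots> = (\<Sum>r<n. ent m r q * (if i = r \<and> j = p then 1 else 0))"
      by (intro sum.cong) auto
    finally show "ent (m * unit q p) i j = ent (\<Sum>r<n. cs (ent m r q) (unit r p)) i j"
      by (simp add: ent_simps)
  qed (use assms in \<open>auto intro!: corner_sum\<close>)
qed

lemma idm_eq_sum: "idm n = (\<Sum>k<n. unit k k)"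
proof (rule fm_eqI)
  fix i j
  have "(\<Sum>k<n. if i = k \<and> j = k then 1 else 0) = (\<Sum>k<n. if k = i then (if i = j then 1 else 0) else (0::complex))"
    by (rule sum.cong) auto
  then show "ent (idm n) i j = ent (\<Sum>k<n. unit k k) i j" by (simp add: ent_simps)
qed

text \<open>If \<open>T X\<close> is the sum of the \<open>x\<^sub>j * X * y\<^sub>j\<close> then \<open>slice n T g\<close> is the sum of the \<open>y\<^sub>j\<close> weighted by the
  traces of \<open>x\<^sub>j * g\<close>; it makes sense without choosing such a decomposition.\<close>

definition slice :: "nat \<Rightarrow> (fm \<Rightarrow> fm) \<Rightarrow> fm \<Rightarrow> fm" where
  "slice n T g = (\<Sum>p<n. \<Sum>q<n. unit q p * g * T (unit p q))"

lemma slice_corner: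
  assumes "op n T" "g \<in> corner n"
  shows "slice n T g \<in> corner n"
  unfolding slice_def by (intro corner_sum corner_mult op_corner[OF assms(1)] assms(2) corner_unit) auto

lemma slice_sum: "slice n T (sum f J) = (\<Sum>j\<in>J. slice n T (f j))"
proof -
  have "slice n T (sum f J) = (\<Sum>p<n. \<Sum>q<n. \<Sum>j\<in>J. unit q p * f j * T (unit p q))"
    by (simp add: slice_def sum_distrib_left sum_distrib_right)
  also have "\<dots> = (\<Sum>p<n. \<Sum>j\<in>J. \<Sum>q<n. unit q p * f j * T (unit p q))"
    by (intro sum.cong refl sum.swap)
  also have "\<dots> = (\<Sum>j\<in>J. slice n T (f j))" unfolding slice_def by (rule sum.swap)
  finally show ?thesis .
qed

text \<open>The sum of the tensors of \<open>unit q p\<close> and \<open>unit p q\<close> carries a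
  left factor m of one leg to a right factor m of the other. A factor outside the slice thus becomes
  a right factor inside \<open>T\<close>; in \<open>slice_mult\<close> a factor of \<open>g\<close>
  becomes a left factor inside \<open>T\<close>.\<close>

lemma slice_left:
  assumes T: "op n T" and m: "m \<in> corner n"
  shows "m * slice n T g = (\<Sum>p<n. \<Sum>r<n. unit r p * g * T (unit p r * m))"
proof -
  have "m * slice n T g = (\<Sum>p<n. \<Sum>q<n. (m * unit q p) * (g * T (unit p q)))"
    by (simp add: slice_def sum_distrib_left mult.assoc)
  also have "\<dots> = (\<Sum>p<n. \<Sum>q<n. \<Sum>r<n. cs (ent m r q) (unit r p * g * T (unit p q)))"
    by (intro sum.cong refl) (simp add: unit_mult_expand(2)[OF m] sum_distrib_right mult.assoc)
  also have "\<dots> = (\<Sum>p<n. \<Sum>r<n. \<Sum>q<n. cs (ent m r q) (unit r p * g * T (unit p q)))"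
    by (intro sum.cong refl sum.swap)
  also have "\<dots> = (\<Sum>p<n. \<Sum>r<n. unit r p * g * T (unit p r * m))"
    by (intro sum.cong refl)
      (simp add: unit_mult_expand(1)[OF m] op_sum[OF T] op_cs[OF T] sum_distrib_left)
  finally show ?thesis .
qed

lemma slice_mult:
  assumes T: "op n T" and m: "m \<in> corner n"
  shows "slice n T (m * g) = (\<Sum>p<n. \<Sum>r<n. unit r p * g * T (m * unit p r))"
proof -
  have "slice n T (m * g) = (\<Sum>p<n. \<Sum>q<n. (unit q p * m) * (g * T (unit p q)))"
    by (simp add: slice_def mult.assoc)
  also have "\<dots> = (\<Sum>p<n. \<Sum>q<n. \<Sum>r<n. cs (ent m p r) (unit q r * g * T (unit p q)))"
    by (intro sum.cong refl) (simp add: unit_mult_expand(1)[OF m] sum_distrib_right mult.assoc)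
  also have "\<dots> = (\<Sum>p<n. \<Sum>r<n. \<Sum>q<n. cs (ent m p r) (unit q r * g * T (unit p q)))"
    by (intro sum.cong refl sum.swap)
  also have "\<dots> = (\<Sum>r<n. \<Sum>p<n. \<Sum>q<n. cs (ent m p r) (unit q r * g * T (unit p q)))"
    by (rule sum.swap)
  also have "\<dots> = (\<Sum>r<n. \<Sum>q<n. \<Sum>p<n. cs (ent m p r) (unit q r * g * T (unit p q)))"
    by (intro sum.cong refl sum.swap)
  also have "\<dots> = (\<Sum>r<n. \<Sum>q<n. unit q r * g * T (m * unit r q))"
    by (intro sum.cong refl)
      (simp add: unit_mult_expand(2)[OF m] op_sum[OF T] op_cs[OF T] sum_distrib_left)
  finally show ?thesis .
qed

text \<open>The right coefficients of any map can be taken to be slices. This matters because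
  linearity of \<open>T\<close> over \<open>N\<close> passes to slices without reference to a
  decomposition.\<close>

lemma slice_expansion:
  assumes T: "op n T"
  shows "T X = (\<Sum>j\<in>{..<n} \<times> {..<n}. unit (fst j) (snd j) * X * slice n T (unit (snd j) (fst j)))"
proof -
  let ?R = "\<lambda>X. \<Sum>j\<in>{..<n} \<times> {..<n}. unit (fst j) (snd j) * X * slice n T (unit (snd j) (fst j))"
  have "op n ?R" by (intro op_sum_map op_sandwich slice_corner T) auto
  then have "T = ?R"
  proof (rule op_eqI[OF T])
    fix a b assume ab: "a < n" "b < n"
    have sl: "slice n T (unit l k) = (\<Sum>q<n. unit q k * T (unit l q))" if "l < n" for l k
    proof -
      have "slice n T (unit l k) = (\<Sum>p<n. if p = l then (\<Sum>q<n. unit q k * T (unit l q)) else 0)"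
        unfolding slice_def by (intro sum.cong refl) (auto simp: unit_mult)
      then show ?thesis using that by simp
    qed
    have "?R (unit a b) = (\<Sum>k<n. \<Sum>l<n. unit k l * unit a b * slice n T (unit l k))"
      by (simp add: sum.cartesian_product case_prod_unfold)
    also have "\<dots> = (\<Sum>k<n. \<Sum>l<n. if l = a then unit k b * slice n T (unit a k) else 0)"
      by (intro sum.cong refl) (auto simp: unit_mult)
    also have "\<dots> = (\<Sum>k<n. unit k b * slice n T (unit a k))"
      using ab by simp
    also have "\<dots> = (\<Sum>k<n. unit k k * T (unit a b))"
    proof (rule sum.cong[OF refl])
      fix k
      have "unit k b * slice n T (unit a k) = (\<Sum>q<n. (unit k b * unit q k) * T (unit a q))"
        by (simp add: sl[OF ab(1)] sum_distrib_left mult.assoc)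
      also have "\<dots> = (\<Sum>q<n. if q = b then unit k k * T (unit a b) else 0)"
        by (rule sum.cong) (auto simp: unit_mult)
      finally show "unit k b * slice n T (unit a k) = unit k k * T (unit a b)" using ab by simp
    qed
    also have "\<dots> = (\<Sum>k<n. unit k k) * T (unit a b)"
      by (simp add: sum_distrib_right)
    also have "\<dots> = T (unit a b)"
      using op_corner[OF T] by (simp add: idm_eq_sum[symmetric])
    finally show "T (unit a b) = ?R (unit a b)" by simp
  qed
  then show ?thesis by (rule fun_cong)
qed

section \<open>Decompositions with independent right coefficients\<close>

definition indep :: "'j set \<Rightarrow> ('j \<Rightarrow> fm) \<Rightarrow> bool" where
  "indep J y \<longleftrightarrow> (\<forall>c. (\<Sum>j\<in>J. cs (c j) (y j)) = 0 \<longrightarrow> (\<forall>j\<in>J. c j = 0))"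

text \<open>A relation among the \<open>y j\<close> eliminates one of them by changing the left
  coefficients of the others. The surviving \<open>y j\<close> are untouched, so slices remain
  slices.\<close>

lemma reduce_to_indep:
  assumes "finite J" "\<And>j. j \<in> J \<Longrightarrow> x j \<in> corner n"
  shows "\<exists>J' x'. J' \<subseteq> J \<and> (\<forall>j\<in>J'. x' j \<in> corner n) \<and> indep J' y \<and>
    (\<forall>X. (\<Sum>j\<in>J. x j * X * y j) = (\<Sum>j\<in>J'. x' j * X * y j))"
  using assms
proof (induction J arbitrary: x rule: finite_psubset_induct)
  case (psubset J)
  show ?case
  proof (cases "indep J y")
    case True
    then show ?thesis using psubset.prems by blast
  next
    case False
    then obtain c k where c: "(\<Sum>j\<in>J. cs (c j) (y j)) = 0" and k: "k \<in> J" "c k \<noteq> 0"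
      unfolding indep_def by blast
    define x' where "x' = (\<lambda>j. x j - cs (c j / c k) (x k))"
    have "\<exists>J' x''. J' \<subseteq> J - {k} \<and> (\<forall>j\<in>J'. x'' j \<in> corner n) \<and> indep J' y \<and>
        (\<forall>X. (\<Sum>j\<in>J - {k}. x' j * X * y j) = (\<Sum>j\<in>J'. x'' j * X * y j))"
      by (rule psubset.IH) (use k psubset.prems in \<open>auto simp: x'_def\<close>)
    then obtain J' x'' where J': "J' \<subseteq> J - {k}" "\<forall>j\<in>J'. x'' j \<in> corner n" "indep J' y"
      "\<forall>X. (\<Sum>j\<in>J - {k}. x' j * X * y j) = (\<Sum>j\<in>J'. x'' j * X * y j)" by blast
    have "(\<Sum>j\<in>J. x j * X * y j) = (\<Sum>j\<in>J - {k}. x' j * X * y j)" for X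
    proof -
      have "cs (1 / c k) (x k * X * (\<Sum>j\<in>J. cs (c j) (y j))) = (\<Sum>j\<in>J. cs (c j / c k) (x k) * X * y j)"
        by (simp add: sum_distrib_left cs.scale_sum_right)
      then have z: "(\<Sum>j\<in>J. cs (c j / c k) (x k) * X * y j) = 0" by (simp add: c)
      have "(\<Sum>j\<in>J. x j * X * y j) = (\<Sum>j\<in>J. x' j * X * y j)"
        using z by (simp add: x'_def left_diff_distrib sum_subtractf)
      also have "\<dots> = x' k * X * y k + (\<Sum>j\<in>J - {k}. x' j * X * y j)"
        by (rule sum.remove) (use psubset.hyps k in auto)
      also have "x' k = 0" using k by (simp add: x'_def)
      finally show ?thesis by simp
    qed
    then show ?thesis using J' by (intro exI[of _ J'] exI[of _ x'']) auto
  qed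
qed

text \<open>At X = \<open>unit p q\<close> the entry (a, b) of w j X y j is the product of
  \<open>ent (w j) a p\<close> and \<open>ent (y j) q b\<close>. For fixed a and p this is a linear
  relation among the \<open>y j\<close>.\<close>

lemma indep_tensor_zero:
  assumes "indep J y" "\<And>j. j \<in> J \<Longrightarrow> w j \<in> corner n"
    and z: "\<And>X. X \<in> corner n \<Longrightarrow> (\<Sum>j\<in>J. w j * X * y j) = 0" and y: "\<And>j. j \<in> J \<Longrightarrow> y j \<in> corner n"
    and j: "j \<in> J"
  shows "w j = 0"
proof (rule corner_eqI[OF assms(2)[OF j] corner_zero])
  fix a p assume ap: "a < n" "p < n"
  have "(\<Sum>j\<in>J. cs (ent (w j) a p) (y j)) = 0"
  proof (rule corner_eqI[of _ n])
    fix q b assume qb: "q < n" "b < n"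
    have e: "ent (w j * unit p q * y j) a b = ent (w j) a p * ent (y j) q b" if "j \<in> J" for j
    proof -
      have wc: "w j \<in> corner n" by (rule assms(2)[OF that])
      have u: "ent (unit p q * y j) k b = (if k = p then ent (y j) q b else 0)" if "k < n" for k
      proof -
        have "ent (unit p q * y j) k b = (\<Sum>l<n. if l = q then (if k = p then ent (y j) q b else 0) else 0)"
          unfolding ent_mult[OF corner_unit[OF ap(2) qb(1)]] by (intro sum.cong) (auto simp: ent_unit)
        then show ?thesis using qb by simp
      qed
      have "ent (w j * unit p q * y j) a b = (\<Sum>k<n. if k = p then ent (w j) a p * ent (y j) q b else 0)"
        unfolding mult.assoc ent_mult[OF wc] by (intro sum.cong) (auto simp: u)
      then show ?thesis using ap by simp
    qed
    have "ent (\<Sum>j\<in>J. w j * unit p q * y j) a b = 0"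
      using z[of "unit p q"] ap qb by (simp add: ent_zero)
    then show "ent (\<Sum>j\<in>J. cs (ent (w j) a p) (y j)) q b = ent 0 q b"
      by (simp add: ent_sum ent_cs ent_zero e)
  qed (use y in \<open>auto intro!: corner_sum\<close>)
  then have "ent (w j) a p = 0"
    using assms(1)[unfolded indep_def, rule_format, of "\<lambda>j. ent (w j) a p"] j by blast
  then show "ent (w j) a p = ent 0 a p" by (simp add: ent_zero)
qed

context star_alg
begin

text \<open>Slices commute with \<open>N\<close> by right linearity of \<open>T\<close>. Left
  linearity gives that the sum of (x j m - m x j) X y j vanishes for all X, and independence of the
  slices y j then forces each x j into the commutant.\<close>

lemma bimodule_representation:
  assumes T: "op n T" and left: "\<And>m X. m \<in> N \<Longrightarrow> X \<in> corner n \<Longrightarrow> T (m * X) = m * T X"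
    and right: "\<And>m X. m \<in> N \<Longrightarrow> X \<in> corner n \<Longrightarrow> T (X * m) = T X * m"
  shows "\<exists>(J :: (nat \<times> nat) set) x g. finite J \<and>
    (\<forall>j\<in>J. x j \<in> A \<and> g j \<in> corner n \<and> slice n T (g j) \<in> A) \<and>
    (\<forall>X. T X = (\<Sum>j\<in>J. x j * X * slice n T (g j)))"
proof -
  define g where "g = (\<lambda>j. unit (snd j) (fst j))"
  let ?J0 = "{..<n} \<times> {..<n}"
  have g: "g j \<in> corner n" if "j \<in> ?J0" for j using that by (auto simp: g_def)
  have eq: "(\<Sum>j\<in>?J0. unit (fst j) (snd j) * X * slice n T (g j)) = T X" for X
    unfolding g_def by (rule slice_expansion[OF T, symmetric])
  have "\<exists>J x. J \<subseteq> ?J0 \<and> (\<forall>j\<in>J. x j \<in> corner n) \<and> indep J (\<lambda>j. slice n T (g j)) \<and>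
    (\<forall>X. T X = (\<Sum>j\<in>J. x j * X * slice n T (g j)))"
    by (rule reduce_to_indep[of ?J0 "\<lambda>j. unit (fst j) (snd j)" n "\<lambda>j. slice n T (g j)", unfolded eq]) auto
  then obtain J x where J: "J \<subseteq> ?J0" "\<forall>j\<in>J. x j \<in> corner n" "indep J (\<lambda>j. slice n T (g j))"
    "\<And>X. T X = (\<Sum>j\<in>J. x j * X * slice n T (g j))"
    by blast
  have sc: "slice n T (g j) \<in> corner n" if "j \<in> J" for j
    by (rule slice_corner[OF T g]) (use that J(1) in blast)
  have sA: "slice n T (g j) \<in> A" if "j \<in> J" for j
  proof (rule A_I[OF sc[OF that]])
    fix m assume m: "m \<in> N"
    then have mc: "m \<in> corner n" using N_corner by blast
    show "slice n T (g j) * m = m * slice n T (g j)"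
      unfolding slice_left[OF T mc] by (simp add: slice_def sum_distrib_right right[OF m] mult.assoc)
  qed
  have xA: "x j \<in> A" if j: "j \<in> J" for j
  proof (rule A_I)
    show "x j \<in> corner n" using J(2) j by blast
    fix m assume m: "m \<in> N"
    then have mc: "m \<in> corner n" using N_corner by blast
    have "x j * m - m * x j = 0"
    proof (rule indep_tensor_zero[OF J(3) _ _ sc j])
      fix X assume X: "X \<in> corner n"
      have "(\<Sum>j\<in>J. (x j * m - m * x j) * X * slice n T (g j)) = T (m * X) - m * T X"
        by (simp add: J(4)[of "m * X"] J(4)[of X] sum_distrib_left left_diff_distrib sum_subtractf mult.assoc)
      then show "(\<Sum>j\<in>J. (x j * m - m * x j) * X * slice n T (g j)) = 0"
        using left[OF m X] by simp
    qed (use J(2) mc in auto)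
    then show "x j * m = m * x j" by simp
  qed
  have "finite J" using J(1) finite_subset by blast
  moreover have "\<forall>j\<in>J. x j \<in> A \<and> g j \<in> corner n \<and> slice n T (g j) \<in> A"
    using sA xA g J(1) by blast
  ultimately show ?thesis using J(4) by (intro exI[of _ J] exI[of _ x] exI[of _ g] conjI allI)
qed

end

section \<open>Norm estimates and unitarity\<close>

lemma hs_mult_le:
  assumes A: "A \<in> corner n"
  shows "hs n (A * B) \<le> hs n A * hs n B"
proof -
  have "(cmod (ent (A * B) i j))\<^sup>2 \<le> (\<Sum>k<n. (cmod (ent A i k))\<^sup>2) * (\<Sum>k<n. (cmod (ent B k j))\<^sup>2)" for i j
  proof -
    have "cmod (ent (A * B) i j) \<le> (\<Sum>k<n. cmod (ent A i k) * cmod (ent B k j))"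
      unfolding ent_mult[OF A] by (rule order_trans[OF norm_sum]) (simp add: norm_mult)
    then have "(cmod (ent (A * B) i j))\<^sup>2 \<le> (\<Sum>k<n. cmod (ent A i k) * cmod (ent B k j))\<^sup>2"
      by (intro power_mono) auto
    also have "\<dots> \<le> (\<Sum>k<n. (cmod (ent A i k))\<^sup>2) * (\<Sum>k<n. (cmod (ent B k j))\<^sup>2)"
      by (rule Cauchy_Schwarz_ineq_sum)
    finally show ?thesis .
  qed
  then have "hs n (A * B) \<le> (\<Sum>i<n. \<Sum>j<n. (\<Sum>k<n. (cmod (ent A i k))\<^sup>2) * (\<Sum>k<n. (cmod (ent B k j))\<^sup>2))"
    unfolding hs_def[of n "A * B"] by (intro sum_mono)
  also have "\<dots> = hs n A * (\<Sum>j<n. \<Sum>k<n. (cmod (ent B k j))\<^sup>2)"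
    unfolding hs_def[of n A] by (simp add: sum_product)
  also have "(\<Sum>j<n. \<Sum>k<n. (cmod (ent B k j))\<^sup>2) = hs n B"
    unfolding hs_def by (rule sum.swap)
  finally show ?thesis .
qed

text \<open>If W x = 0 then (W - 1) x = -x, which contradicts hs (W - 1) < 1 unless x = 0.\<close>

lemma near_identity_injective:
  assumes W: "W \<in> corner n" and near: "hs n (W - idm n) < 1" and x: "x \<in> corner n" "W * x = 0"
  shows "x = 0"
proof -
  have "hs n ((W - idm n) * x) \<le> hs n (W - idm n) * hs n x"
    by (rule hs_mult_le) (use W in simp)
  moreover have "(W - idm n) * x = cs (-1) x" using x by (simp add: left_diff_distrib)
  ultimately have "hs n x \<le> hs n (W - idm n) * hs n x" by (simp only: hs_cs) simp
  moreover have "hs n (W - idm n) * hs n x < 1 * hs n x" if "hs n x \<noteq> 0"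
    using near that hs_nonneg[of n x] by (intro mult_strict_right_mono) (auto simp: less_le)
  ultimately have "hs n x = 0" by force
  then show ?thesis by (rule hs_eq_0[OF x(1)])
qed

text \<open>The defect 1 - u u^* is a self-adjoint projection of trace zero.\<close>

lemma unitary_right_inverse:
  assumes u: "u \<in> corner n" "star u * u = idm n"
  shows "u * star u = idm n"
proof -
  define p where "p = idm n - u * star u"
  have uu: "u * star u * (u * star u) = u * star u"
  proof -
    have "u * star u * (u * star u) = u * (star u * u) * star u" by (simp only: mult.assoc)
    then show ?thesis using u by simp
  qed
  have "star p * p = p" using uu u
    by (simp add: p_def left_diff_distrib right_diff_distrib)
  moreover have "tr n p = 0"
    using tr_mult_commute[OF u(1) corner_star[OF u(1)]] u(2) by (simp add: p_def)
  ultimately have "p = 0" using u(1) by (intro hs_eq_0[of _ n]) (auto simp: p_def hs_eq_tr)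
  then show ?thesis by (simp add: p_def)
qed

text \<open>Positive semidefiniteness, tested on matrices instead of vectors. The existential states
  at once that the value is real and that it is nonnegative.\<close>

definition psdm :: "nat \<Rightarrow> fm \<Rightarrow> bool" where
  "psdm n B \<longleftrightarrow> (\<forall>Z\<in>corner n. \<exists>r\<ge>0. tr n (star Z * B * Z) = complex_of_real r)"

text \<open>An affine function of a real variable with values in [0, oo) is constant. Along mu = t
  this gives b + b' = 0, along mu = t i it gives b - b' = 0.\<close>

lemma nonneg_form_linear_part_zero:
  assumes "\<And>\<mu>. \<exists>r\<ge>0. a + \<mu> * b + cnj \<mu> * b' = complex_of_real r"
  shows "b = (0::complex)"
proof -
  have key: "z = 0" if h: "\<And>t::real. \<exists>r\<ge>0. a + complex_of_real t * z = complex_of_real r" for z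
  proof -
    obtain r0 where r0: "a = complex_of_real r0" using h[of 0] by auto
    obtain r1 where r1: "a + z = complex_of_real r1" using h[of 1] by auto
    then have z: "z = complex_of_real (r1 - r0)" using r0 by (metis add_diff_cancel_left' of_real_diff)
    define s where "s = r1 - r0"
    have nn: "0 \<le> r0 + t * s" for t
    proof -
      have "\<exists>r\<ge>0. complex_of_real (r0 + t * s) = complex_of_real r"
        using h[of t] by (simp add: r0 z s_def)
      then show ?thesis by (metis of_real_eq_iff)
    qed
    have "s = 0"
    proof (rule ccontr)
      assume "s \<noteq> 0"
      then show False using nn[of "- (r0 + 1) / s"] by simp
    qed
    then show ?thesis by (simp add: z s_def)
  qed
  have "b + b' = 0"
  proof (rule key)
    fix t :: real
    show "\<exists>r\<ge>0. a + complex_of_real t * (b + b') = complex_of_real r"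
      using assms[of "complex_of_real t"] by (simp add: algebra_simps)
  qed
  moreover have "\<i> * b - \<i> * b' = 0"
  proof (rule key)
    fix t :: real
    show "\<exists>r\<ge>0. a + complex_of_real t * (\<i> * b - \<i> * b') = complex_of_real r"
      using assms[of "complex_of_real t * \<i>"] by (simp add: algebra_simps)
  qed
  ultimately show ?thesis
    by (metis add_cancel_left_left complex_i_not_zero eq_iff_diff_eq_0 mult_cancel_left mult_2 mult_eq_0_iff zero_neq_numeral)
qed

text \<open>Polarisation between \<open>B\<close> and \<open>idm n\<close>: the mixed coefficient is
  the trace of \<open>star B * B\<close>.\<close>

lemma form_zero:
  assumes B: "B \<in> corner n" and z: "\<And>Z. Z \<in> corner n \<Longrightarrow> tr n (star Z * B * Z) = 0"
  shows "B = 0"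
proof -
  have "tr n (star B * B * idm n) = 0"
  proof -
    define s where "s = tr n (star B * B * idm n)"
    define t where "t = tr n (star (idm n) * B * B)"
    have "tr n (star (B + cs \<mu> (idm n)) * B * (B + cs \<mu> (idm n))) = \<mu> * s + cnj \<mu> * t" for \<mu>
    proof -
      have "star (B + cs \<mu> (idm n)) * B * (B + cs \<mu> (idm n)) = star B * B * B + cs \<mu> (star B * B * idm n)
          + cs (cnj \<mu>) (star (idm n) * B * B) + cs (cnj \<mu> * \<mu>) (star (idm n) * B * idm n)"
        by (simp add: distrib_left distrib_right mult.assoc cs_distribs mult.commute)
      then show ?thesis using z[OF B] z[OF corner_idm[of n]] by (simp add: s_def t_def)
    qed
    then have "\<exists>r\<ge>0. 0 + \<mu> * s + cnj \<mu> * t = complex_of_real r" for \<mu>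
      using z[of "B + cs \<mu> (idm n)"] B by (intro exI[of _ 0]) simp
    then show ?thesis unfolding s_def by (rule nonneg_form_linear_part_zero)
  qed
  then have "tr n (star B * B) = 0" using B by simp
  then show ?thesis using B by (intro hs_eq_0) (auto simp: hs_eq_tr)
qed

text \<open>In the form at Z + mu the coefficient of |mu|^2 is the trace of \<open>B\<close>, which
  is zero. Positivity then leaves no room for the part linear in mu.\<close>

lemma psdm_trace_zero:
  assumes B: "B \<in> corner n" and psd: "psdm n B" and t0: "tr n B = 0"
  shows "B = 0"
proof (rule tr_nondegenerate[OF B])
  fix X assume X: "X \<in> corner n"
  define Z where "Z = star X"
  have Z: "Z \<in> corner n" using X by (simp add: Z_def)
  have "\<exists>r\<ge>0. tr n (star Z * B * Z) + \<mu> * tr n (star Z * B * idm n) + cnj \<mu> * tr n (star (idm n) * B * Z)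
      = complex_of_real r" for \<mu>
  proof -
    have "star (Z + cs \<mu> (idm n)) * B * (Z + cs \<mu> (idm n)) = star Z * B * Z + cs \<mu> (star Z * B * idm n)
          + cs (cnj \<mu>) (star (idm n) * B * Z) + cs (cnj \<mu> * \<mu>) (star (idm n) * B * idm n)"
      by (simp add: distrib_left distrib_right mult.assoc cs_distribs mult.commute)
    moreover have "star (idm n) * B * idm n = B" using B by simp
    moreover have "\<exists>r\<ge>0. tr n (star (Z + cs \<mu> (idm n)) * B * (Z + cs \<mu> (idm n))) = complex_of_real r"
      using psd Z unfolding psdm_def by (metis corner_add corner_cs corner_idm)
    ultimately show ?thesis using t0 by simp
  qed
  then have "tr n (star Z * B * idm n) = 0" by (rule nonneg_form_linear_part_zero)
  then show "tr n (X * B) = 0" using B X by (simp add: Z_def)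
qed

text \<open>Complete positivity is represented by two consequences, preservation of adjoints and the
  Schwarz inequality. Both suffice for multiplicative domains and pass to limits easily.\<close>

definition chan :: "nat \<Rightarrow> (fm \<Rightarrow> fm) \<Rightarrow> bool" where
  "chan n T \<longleftrightarrow> op n T \<and> T (idm n) = idm n \<and> (\<forall>X\<in>corner n. tr n (T X) = tr n X) \<and>
     (\<forall>X. T (star X) = star (T X)) \<and> (\<forall>X\<in>corner n. psdm n (T (star X * X) - star (T X) * T X))"

lemma chanD:
  assumes "chan n T"
  shows "op n T" "T (idm n) = idm n" "X \<in> corner n \<Longrightarrow> tr n (T X) = tr n X" "T (star X) = star (T X)"
    "X \<in> corner n \<Longrightarrow> psdm n (T (star X * X) - star (T X) * T X)"
  using assms unfolding chan_def by blast+

text \<open>The trace of the Schwarz defect is the loss of Hilbert-Schmidt norm. So a channel is a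
  contraction, and where no norm is lost the defect vanishes.\<close>

lemma chan_tr_defect:
  assumes T: "chan n T" and X: "X \<in> corner n"
  shows "tr n (T (star X * X) - star (T X) * T X) = complex_of_real (hs n X - hs n (T X))"
  using X chanD(3)[OF T, of "star X * X"] op_corner[OF chanD(1)[OF T]] by (simp add: tr_star_mult)

lemma chan_contraction:
  assumes T: "chan n T" and X: "X \<in> corner n"
  shows "hs n (T X) \<le> hs n X"
proof -
  let ?D = "T (star X * X) - star (T X) * T X"
  have Tc: "T Y \<in> corner n" for Y by (rule op_corner[OF chanD(1)[OF T]])
  obtain r where "r \<ge> 0" "tr n (star (idm n) * ?D * idm n) = complex_of_real r"
    using chanD(5)[OF T X] corner_idm unfolding psdm_def by blast
  moreover have "star (idm n) * ?D * idm n = ?D" using Tc by simp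
  ultimately have "complex_of_real (hs n X - hs n (T X)) = complex_of_real r"
    using chan_tr_defect[OF T X] by simp
  then show ?thesis using \<open>r \<ge> 0\<close> by (simp only: of_real_eq_iff)
qed

text \<open>Choi's multiplicative domain. The sesquilinear defect \<open>D\<close> is positive on
  the diagonal and vanishes at (X, X), because it is positive of trace zero there; positivity at V +
  mu X then kills the mixed term D V X.\<close>

lemma chan_multiplicative:
  assumes T: "chan n T" and X: "X \<in> corner n" and iso: "hs n (T X) = hs n X" and Y: "Y \<in> corner n"
  shows "T (Y * X) = T Y * T X"
proof -
  define D where "D = (\<lambda>X Y. T (star X * Y) - star (T X) * T Y)"
  have top: "op n T" by (rule chanD(1)[OF T])
  have Dc: "D X Y \<in> corner n" for X Y using op_corner[OF top] by (simp add: D_def)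
  have DXX: "D X X = 0" unfolding D_def
    by (rule psdm_trace_zero[OF _ chanD(5)[OF T X]])
      (use op_corner[OF top] chan_tr_defect[OF T X] iso in auto)
  define V where "V = star Y"
  have V: "V \<in> corner n" using Y by (simp add: V_def)
  have "D V X = 0"
  proof (rule form_zero[OF Dc])
    fix Z assume Z: "Z \<in> corner n"
    have "\<exists>r\<ge>0. tr n (star Z * D V V * Z) + \<mu> * tr n (star Z * D V X * Z) + cnj \<mu> * tr n (star Z * D X V * Z)
        = complex_of_real r" for \<mu>
    proof -
      have "D (V + cs \<mu> X) (V + cs \<mu> X) = D V V + cs \<mu> (D V X) + cs (cnj \<mu>) (D X V) + cs (cnj \<mu> * \<mu>) (D X X)"
        unfolding D_def
        by (intro fm_eqI) (simp add: op_add[OF top] op_cs[OF top] distrib_left distrib_right ent_simps algebra_simps)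
      then have "star Z * D (V + cs \<mu> X) (V + cs \<mu> X) * Z = star Z * D V V * Z + cs \<mu> (star Z * D V X * Z)
          + cs (cnj \<mu>) (star Z * D X V * Z)"
        by (simp add: DXX distrib_left distrib_right)
      moreover have "psdm n (D (V + cs \<mu> X) (V + cs \<mu> X))"
        unfolding D_def using chanD(5)[OF T, of "V + cs \<mu> X"] V X by simp
      ultimately show ?thesis using Z unfolding psdm_def by fastforce
    qed
    then show "tr n (star Z * D V X * Z) = 0" by (rule nonneg_form_linear_part_zero)
  qed
  then show ?thesis unfolding D_def V_def chanD(4)[OF T] by simp
qed

lemma hs_star: "hs n (star X) = hs n X"
  unfolding hs_def by (subst sum.swap) (simp add: ent_star)

lemma chan_multiplicative':
  assumes T: "chan n T" and X: "X \<in> corner n" and iso: "hs n (T X) = hs n X" and Y: "Y \<in> corner n"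
  shows "T (X * Y) = T X * T Y"
proof -
  have "T (star Y * star X) = T (star Y) * T (star X)"
    by (rule chan_multiplicative[OF T]) (use X Y iso in \<open>auto simp: chanD(4)[OF T] hs_star\<close>)
  then have "star (T (X * Y)) = star (T X * T Y)"
    unfolding star_mult[symmetric] chanD(4)[OF T] .
  then show ?thesis by (metis star_star)
qed

definition unitaries :: "nat \<Rightarrow> fm set" where
  "unitaries n = {u \<in> corner n. star u * u = idm n}"

lemma unitaries_mult: "u \<in> unitaries n \<Longrightarrow> v \<in> unitaries n \<Longrightarrow> u * v \<in> unitaries n"
proof -
  assume uv: "u \<in> unitaries n" "v \<in> unitaries n"
  have "star (u * v) * (u * v) = star v * (star u * u) * v" by (simp add: mult.assoc)
  then show ?thesis using uv by (simp add: unitaries_def)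
qed

text \<open>The unitary is the polar part of \<open>W\<close>: the modulus of \<open>W\<close> commutes with the range of \<open>al\<close>.\<close>

lemma unitary_intertwiner:
  assumes W: "W \<in> corner n" "hs n (W - idm n) < 1" and N: "\<And>m. m \<in> N \<Longrightarrow> m \<in> corner n \<and> star m \<in> N"
    and al: "\<And>m. m \<in> N \<Longrightarrow> al m \<in> corner n \<and> al (star m) = star (al m)"
    and tw: "\<And>m. m \<in> N \<Longrightarrow> m * W = W * al m"
  shows "\<exists>u\<in>unitaries n. \<forall>m\<in>N. m * u = u * al m"
proof -
  obtain b where b: "b \<in> corner n" "star b = b" "b * (star W * W) * b = idm n"
    "\<And>x. x \<in> corner n \<Longrightarrow> x * (star W * W) = (star W * W) * x \<Longrightarrow> x * b = b * x"
    by (rule inverse_sqrt[OF W(1) near_identity_injective[OF W]]) blast+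
  have "star (W * b) * (W * b) = b * (star W * W) * b" by (simp add: b(2) mult.assoc)
  then have "W * b \<in> unitaries n" using W b by (simp add: unitaries_def)
  moreover have "m * (W * b) = (W * b) * al m" if m: "m \<in> N" for m
  proof -
    have "al m * star W = star W * m"
      using arg_cong[OF tw[of "star m"], of star] N[OF m] al[OF m] by simp
    then have "al m * (star W * W) = (star W * W) * al m"
      using tw[OF m] by (metis mult.assoc)
    then have "al m * b = b * al m" using b(4) al[OF m] by blast
    then show ?thesis using tw[OF m] by (metis mult.assoc)
  qed
  ultimately show ?thesis by blast
qed

section \<open>Channels close to an expectation\<close>

lemma hs_tendsto_sum:
  fixes f :: "'j \<Rightarrow> nat \<Rightarrow> fm"
  assumes "\<And>j. j \<in> J \<Longrightarrow> (\<lambda>k. hs n (f j k)) \<longlonglongrightarrow> 0"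
  shows "(\<lambda>k. hs n (\<Sum>j\<in>J. f j k)) \<longlonglongrightarrow> 0"
  using assms
proof (induction J rule: infinite_finite_induct)
  case (insert j J)
  have "(\<lambda>k. 2 * hs n (f j k) + 2 * hs n (\<Sum>j\<in>J. f j k)) \<longlonglongrightarrow> 2 * 0 + 2 * 0"
    by (intro tendsto_intros insert) auto
  then have lim: "(\<lambda>k. 2 * hs n (f j k) + 2 * hs n (\<Sum>j\<in>J. f j k)) \<longlonglongrightarrow> 0" by simp
  have le: "hs n (\<Sum>j\<in>insert j J. f j k) \<le> 2 * hs n (f j k) + 2 * hs n (\<Sum>j\<in>J. f j k)" for k
    using hs_parallelogram[of n "f j k" "\<Sum>j\<in>J. f j k"]
      hs_nonneg[of n "f j k - (\<Sum>j\<in>J. f j k)"]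
    unfolding sum.insert[OF insert.hyps] by linarith
  show ?case
    by (rule tendsto_sandwich[OF _ _ tendsto_const lim]) (use le in auto)
qed (auto simp: hs_def ent_zero)

lemma hs_tendsto_slice:
  assumes lim: "(\<lambda>k. sz n (T k)) \<longlonglongrightarrow> 0" and g: "g \<in> corner n"
  shows "(\<lambda>k. hs n (slice n (T k) g)) \<longlonglongrightarrow> 0"
  unfolding slice_def
proof (intro hs_tendsto_sum)
  fix p q assume "p \<in> {..<n}" "q \<in> {..<n}"
  then have pq: "p < n" "q < n" by auto
  have "hs n (T k (unit p q)) \<le> sz n (T k)" for k
  proof -
    have "hs n (T k (unit p q)) \<le> (\<Sum>q<n. hs n (T k (unit p q)))"
      by (rule member_le_sum) (use pq in auto)
    also have "\<dots> \<le> sz n (T k)" unfolding sz_def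
      by (rule member_le_sum) (use pq in \<open>auto intro: sum_nonneg\<close>)
    finally show ?thesis .
  qed
  then have le: "hs n (unit q p * g * T k (unit p q)) \<le> hs n (unit q p * g) * sz n (T k)" for k
    using pq g by (intro order_trans[OF hs_mult_le] mult_left_mono) auto
  have "(\<lambda>k. hs n (unit q p * g) * sz n (T k)) \<longlonglongrightarrow> hs n (unit q p * g) * 0"
    by (intro tendsto_intros lim)
  then have lim': "(\<lambda>k. hs n (unit q p * g) * sz n (T k)) \<longlonglongrightarrow> 0" by simp
  show "(\<lambda>k. hs n (unit q p * g * T k (unit p q))) \<longlonglongrightarrow> 0"
    by (rule tendsto_sandwich[OF _ _ tendsto_const lim']) (use le in auto)
qed

lemma slice_diff: "slice n (\<lambda>X. T X - S X) g = slice n T g - slice n S g"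
  by (simp add: slice_def right_diff_distrib sum_subtractf)

text \<open>\<open>N\<close> is the fixed point set of \<open>E\<close>. Both \<open>E\<close> and
  the maps \<open>\<Phi> k\<close> lose no norm on it, so \<open>N\<close> lies in their
  multiplicative domains: \<open>E\<close> is an \<open>N\<close>-bimodule map, and
  \<open>\<Phi> k\<close> is one up to its homomorphism on \<open>N\<close>.\<close>

theorem eventually_mixed_unitary:
  fixes \<Phi> :: "nat \<Rightarrow> fm \<Rightarrow> fm"
  assumes E: "chan n E" and idem: "\<And>X. E (E X) = E X" and Phi: "\<And>k. chan n (\<Phi> k)"
    and lim: "(\<lambda>k. sz n (\<lambda>X. \<Phi> k X - E X)) \<longlonglongrightarrow> 0"
    and iso: "\<And>k X. X \<in> corner n \<Longrightarrow> E X = X \<Longrightarrow> hs n (\<Phi> k X) = hs n X"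
  shows "\<forall>\<^sub>F k in sequentially. \<Phi> k \<in> comb Rnn (unitaries n)"
proof -
  define N where "N = {X \<in> corner n. E X = X}"
  have Nc: "m \<in> corner n" and NE: "E m = m" and Ns: "star m \<in> N" if "m \<in> N" for m
    using that chanD(4)[OF E] by (auto simp: N_def)
  interpret star_alg n N
    by unfold_locales (use Nc Ns in auto)
  have Eop: "op n E" by (rule chanD(1)[OF E])
  have Ec: "E X \<in> corner n" for X by (rule op_corner[OF Eop])
  have EN: "E X \<in> N" for X using Ec idem by (simp add: N_def)
  have ER: "E (X * m) = E X * m" and EL: "E (m * X) = m * E X" if "m \<in> N" "X \<in> corner n" for m X
    using chan_multiplicative[OF E Nc[OF that(1)] _ that(2)]
      chan_multiplicative'[OF E Nc[OF that(1)] _ that(2)] NE[OF that(1)] by simp_all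
  obtain J :: "(nat \<times> nat) set" and x g where repE: "finite J"
    "\<forall>j\<in>J. x j \<in> A \<and> g j \<in> corner n \<and> slice n E (g j) \<in> A"
    and Erep: "\<And>X. E X = (\<Sum>j\<in>J. x j * X * slice n E (g j))"
    using bimodule_representation[OF Eop EL ER] by blast
  have tracial: "E (a * X) = E (X * a)" if a: "a \<in> A" and X: "X \<in> corner n" for a X
  proof -
    define Y where "Y = E (a * X - X * a)"
    have Y: "Y \<in> N" unfolding Y_def by (rule EN)
    have ac: "a \<in> corner n" using a by simp
    have "E (star Y * (a * X - X * a)) = star Y * E (a * X - X * a)"
      by (rule EL[OF Ns[OF Y]]) (use ac X in simp)
    then have "star Y * Y = E (star Y * (a * X - X * a))" by (simp only: Y_def[symmetric])
    then have "tr n (star Y * Y) = tr n (star Y * (a * X - X * a))"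
      using chanD(3)[OF E] Nc[OF Y] ac X by simp
    also have "\<dots> = tr n (star Y * a * X) - tr n ((star Y * X) * a)"
      by (simp add: right_diff_distrib mult.assoc)
    also have "tr n ((star Y * X) * a) = tr n (a * (star Y * X))"
      by (rule tr_mult_commute) (use Nc[OF Y] ac X in auto)
    also have "a * (star Y * X) = star Y * a * X"
      using A_commute[OF a Ns[OF Y]] by (simp add: mult.assoc[symmetric])
    finally have "Y = 0" using Nc[OF Y] by (intro hs_eq_0[of _ n]) (auto simp: hs_eq_tr)
    then show ?thesis by (simp add: Y_def op_diff[OF Eop])
  qed
  \<comment> \<open>\<open>E\<close> is self-adjoint for the trace pairing, and passing to the
    transposed map swaps the two legs of the tensor.\<close>
  have flip: "E X = (\<Sum>j\<in>J. slice n E (g j) * X * x j)" if X: "X \<in> corner n" for X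
  proof -
    let ?F = "\<Sum>j\<in>J. slice n E (g j) * X * x j"
    have "E X - ?F = 0"
    proof (rule tr_nondegenerate)
      show "E X - ?F \<in> corner n"
        using Ec repE(2) by (intro corner_diff corner_sum mult_sandwich_corner) auto
      fix Y assume Y: "Y \<in> corner n"
      have "tr n (Y * ?F) = (\<Sum>j\<in>J. tr n ((Y * slice n E (g j) * X) * x j))"
        by (simp add: sum_distrib_left tr_sum mult.assoc)
      also have "\<dots> = (\<Sum>j\<in>J. tr n (x j * (Y * slice n E (g j) * X)))"
        by (intro sum.cong refl tr_mult_commute) (use repE(2) X Y in auto)
      also have "\<dots> = tr n (E Y * X)"
        by (simp add: Erep[of Y] sum_distrib_right tr_sum mult.assoc)
      also have "\<dots> = tr n (E (E Y * X))" using chanD(3)[OF E] Ec X by simp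
      also have "E (E Y * X) = E Y * E X" by (rule EL[OF EN X])
      also have "\<dots> = E (Y * E X)" by (rule ER[OF EN Y, symmetric])
      also have "tr n \<dots> = tr n (Y * E X)" using chanD(3)[OF E] Ec Y by simp
      finally show "tr n (Y * (E X - ?F)) = 0" by (simp add: right_diff_distrib)
    qed
    then show ?thesis by simp
  qed
  interpret expectation n N E J x "\<lambda>j. slice n E (g j)"
  proof
    show "a * E X = E X * a" if "a \<in> A" for a X by (rule A_commute[OF that EN])
  qed (use repE Erep flip chanD(2)[OF E] idem tracial in blast)+
  obtain \<epsilon> where eps: "0 < \<epsilon>" "\<forall>\<Psi>\<in>S. herm \<Psi> \<longrightarrow> \<Psi> (idm n) = idm n \<longrightarrow>
      sz n (\<lambda>X. \<Psi> X - E X) \<le> \<epsilon> \<longrightarrow> \<Psi> \<in> K"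
    using near_expectation_in_cone by blast
  \<comment> \<open>\<open>slice n E\<close> is linear over \<open>A\<close> and \<open>E (idm n) = idm n\<close>, so the identity is a slice of \<open>E\<close>; the same slice
    of \<open>\<Phi> k\<close> is an intertwiner close to the identity.\<close>
  define h where "h = (\<Sum>j\<in>J. x j * g j)"
  have hc: "h \<in> corner n" unfolding h_def using repE(2) by (intro corner_sum) auto
  have "slice n E h = (\<Sum>j\<in>J. slice n E (x j * g j))" unfolding h_def by (rule slice_sum)
  also have "\<dots> = (\<Sum>j\<in>J. x j * slice n E (g j))"
  proof (rule sum.cong[OF refl])
    fix j assume "j \<in> J"
    then have xA: "x j \<in> A" using repE(2) by blast
    show "slice n E (x j * g j) = x j * slice n E (g j)"
      unfolding slice_left[OF Eop A_corner[OF xA]] slice_mult[OF Eop A_corner[OF xA]]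
      by (intro sum.cong refl) (simp add: tracial[OF xA])
  qed
  also have "\<dots> = idm n" by (rule E_pq)
  finally have sliceE: "slice n E h = idm n" .
  define dl where "dl = (\<lambda>k. sz n (\<lambda>X. \<Phi> k X - E X))"
  have "(\<lambda>k. hs n (slice n (\<Phi> k) h - idm n)) \<longlonglongrightarrow> 0"
    using hs_tendsto_slice[OF lim hc] by (simp add: slice_diff sliceE)
  then have ev1: "\<forall>\<^sub>F k in sequentially. hs n (slice n (\<Phi> k) h - idm n) < 1"
    by (rule order_tendstoD(2)) simp
  have "(\<lambda>k. 2 * dl k + 2 * (sz n E * dl k)) \<longlonglongrightarrow> 2 * 0 + 2 * (sz n E * 0)"
    unfolding dl_def by (intro tendsto_intros lim)
  then have ev2: "\<forall>\<^sub>F k in sequentially. 2 * dl k + 2 * (sz n E * dl k) < \<epsilon>"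
    by (rule order_tendstoD(2)) (use eps(1) in simp)
  show ?thesis
    using ev1 ev2
  proof eventually_elim
    case (elim k)
    have Pop: "op n (\<Phi> k)" by (rule chanD(1)[OF Phi])
    have Pc: "\<Phi> k X \<in> corner n" for X by (rule op_corner[OF Pop])
    have PR: "\<Phi> k (X * m) = \<Phi> k X * \<Phi> k m" and PL: "\<Phi> k (m * X) = \<Phi> k m * \<Phi> k X"
      if "m \<in> N" "X \<in> corner n" for m X
      using chan_multiplicative[OF Phi Nc[OF that(1)] iso[OF Nc[OF that(1)] NE[OF that(1)]] that(2)]
        chan_multiplicative'[OF Phi Nc[OF that(1)] iso[OF Nc[OF that(1)] NE[OF that(1)]] that(2)] by simp_all
    let ?W = "slice n (\<Phi> k) h"
    have "\<exists>u\<in>unitaries n. \<forall>m\<in>N. m * u = u * \<Phi> k m"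
    proof (rule unitary_intertwiner[OF slice_corner[OF Pop hc] elim(1)])
      fix m assume m: "m \<in> N"
      show "m \<in> corner n \<and> star m \<in> N" using Nc Ns m by blast
      show "\<Phi> k m \<in> corner n \<and> \<Phi> k (star m) = star (\<Phi> k m)" using Pc chanD(4)[OF Phi] by blast
      show "m * ?W = ?W * \<Phi> k m"
        unfolding slice_left[OF Pop Nc[OF m]] by (simp add: slice_def sum_distrib_right PR[OF m] mult.assoc)
    qed
    then obtain u where u: "u \<in> corner n" "star u * u = idm n" and tw: "\<And>m. m \<in> N \<Longrightarrow> m * u = u * \<Phi> k m"
      unfolding unitaries_def by blast
    have uu: "u * star u = idm n" by (rule unitary_right_inverse[OF u])
    have tw': "\<Phi> k m * star u = star u * m" if "m \<in> N" for m
      using arg_cong[OF tw[OF Ns[OF that]], of star] chanD(4)[OF Phi] by simp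
    define \<Psi> where "\<Psi> = (\<lambda>X. star (star u) * \<Phi> k X * star u)"
    have Psi: "\<Psi> X = u * \<Phi> k X * star u" for X by (simp add: \<Psi>_def)
    have \<Psi>op: "op n \<Psi>" unfolding \<Psi>_def
      using op_comp[OF op_sandwich[of "star (star u)" n "star u"] Pop] u by simp
    have \<Psi>L: "\<Psi> (m * X) = m * \<Psi> X" and \<Psi>R: "\<Psi> (X * m) = \<Psi> X * m" if "m \<in> N" "X \<in> corner n" for m X
    proof -
      have "\<Psi> (m * X) = (u * \<Phi> k m) * \<Phi> k X * star u" by (simp only: Psi PL[OF that] mult.assoc)
      then show "\<Psi> (m * X) = m * \<Psi> X" by (simp only: tw[OF that(1), symmetric] Psi mult.assoc)
      have "\<Psi> (X * m) = u * \<Phi> k X * (\<Phi> k m * star u)" by (simp only: Psi PR[OF that] mult.assoc)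
      then show "\<Psi> (X * m) = \<Psi> X * m" by (simp only: tw'[OF that(1)] Psi mult.assoc)
    qed
    obtain L :: "(nat \<times> nat) set" and a b where L: "finite L"
      "\<forall>j\<in>L. a j \<in> A \<and> b j \<in> corner n \<and> slice n \<Psi> (b j) \<in> A"
      and rep: "\<And>X. \<Psi> X = (\<Sum>j\<in>L. a j * X * slice n \<Psi> (b j))"
      using bimodule_representation[OF \<Psi>op \<Psi>L \<Psi>R] by blast
    have unital: "\<Psi> (idm n) = idm n" using u uu by (simp add: Psi chanD(2)[OF Phi])
    have trace: "tr n (\<Psi> X) = tr n X" if "X \<in> corner n" for X
    proof -
      have "tr n (\<Psi> X) = tr n (star u * (u * \<Phi> k X))"
        unfolding Psi by (rule tr_mult_commute) (use u Pc in auto)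
      also have "star u * (u * \<Phi> k X) = (star u * u) * \<Phi> k X" by (simp only: mult.assoc)
      finally show ?thesis using u(2) Pc chanD(3)[OF Phi that] by simp
    qed
    have "(\<lambda>X. \<Sum>j\<in>L. a j * X * slice n \<Psi> (b j)) \<in> S"
    proof (rule unital_tp_in_S[OF L(1)])
      show "(\<Sum>j\<in>L. a j * slice n \<Psi> (b j)) = idm n"
        using unital rep[of "idm n"] L(2) by (simp cong: sum.cong)
      \<comment> \<open>Trace preservation is read as an identity of coefficients: the trace of X
        times \<open>?Y\<close> is the trace of \<open>\<Psi> X\<close>.\<close>
      let ?Y = "\<Sum>j\<in>L. slice n \<Psi> (b j) * a j"
      have "?Y - idm n = 0"
      proof (rule tr_nondegenerate)
        show "?Y - idm n \<in> corner n" using L(2) by (intro corner_diff corner_sum) auto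
        fix X assume X: "X \<in> corner n"
        have "tr n (X * ?Y) = (\<Sum>j\<in>L. tr n ((X * slice n \<Psi> (b j)) * a j))"
          by (simp add: sum_distrib_left tr_sum mult.assoc)
        also have "\<dots> = (\<Sum>j\<in>L. tr n (a j * (X * slice n \<Psi> (b j))))"
          by (intro sum.cong refl tr_mult_commute) (use L(2) X in auto)
        also have "\<dots> = tr n (\<Psi> X)" by (simp add: rep[of X] tr_sum mult.assoc)
        finally show "tr n (X * (?Y - idm n)) = 0" using trace[OF X] X by (simp add: right_diff_distrib)
      qed
      then show "?Y = idm n" by simp
    qed (use L(2) in blast)+
    moreover have "\<Psi> = (\<lambda>X. \<Sum>j\<in>L. a j * X * slice n \<Psi> (b j))" by (rule ext) (rule rep)
    ultimately have "\<Psi> \<in> S" by (rule ssubst[rotated])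
    moreover have "herm \<Psi>" unfolding herm_def Psi by (simp add: chanD(4)[OF Phi] mult.assoc)
    moreover have "sz n (\<lambda>X. \<Psi> X - E X) \<le> \<epsilon>"
    proof -
      \<comment> \<open>Because \<open>E X\<close> lies in \<open>N\<close>, untwisting turns
        \<open>\<Phi> k (E X)\<close> into \<open>E X\<close>. The distance from
        \<open>\<Psi>\<close> to \<open>E\<close> therefore equals that from \<open>\<Phi> k\<close>
        to its composite with \<open>E\<close>, and no estimate of \<open>u\<close> is
        needed.\<close>
      have "\<Psi> X - E X = star (star u) * (\<Phi> k X - \<Phi> k (E X)) * star u" for X
      proof -
        have "u * \<Phi> k (E X) * star u = E X * (u * star u)"
          using tw[OF EN[of X]] by (simp add: mult.assoc[symmetric])
        then show ?thesis using uu Ec by (simp add: Psi left_diff_distrib right_diff_distrib)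
      qed
      then have "sz n (\<lambda>X. \<Psi> X - E X) = sz n (\<lambda>X. \<Phi> k X - \<Phi> k (E X))"
        using sz_conj[OF op_diff_map[OF Pop op_comp[OF Pop Eop]], of "star u"] u by simp
      also have "\<dots> = sz n (\<lambda>X. (\<Phi> k X - E X) + cs (-1) (\<Phi> k (E X) - E (E X)))"
        by (simp add: idem algebra_simps)
      also have "\<dots> \<le> 2 * dl k + 2 * sz n (\<lambda>X. cs (-1) (\<Phi> k (E X) - E (E X)))"
        unfolding dl_def by (rule sz_add_le)
      also have "sz n (\<lambda>X. cs (-1) (\<Phi> k (E X) - E (E X))) = sz n (\<lambda>X. \<Phi> k (E X) - E (E X))"
        unfolding sz_cs by simp
      also have "\<dots> \<le> sz n E * dl k"
        unfolding dl_def by (rule sz_comp_le[OF op_diff_map[OF Pop Eop] Eop])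
      finally show ?thesis using elim(2) by linarith
    qed
    ultimately have "\<Psi> \<in> K" using eps(2) unital by blast
    then have "\<Psi> \<in> comb Rnn (unitaries n)"
      by (rule comb_mono) (auto simp: unitaries_def G_def)
    then have "(\<lambda>X. star u * \<Psi> X * u) \<in> comb Rnn (unitaries n)"
    proof (rule comb_conj)
      show "v * u \<in> unitaries n" if "v \<in> unitaries n" for v
        by (rule unitaries_mult[OF that]) (use u in \<open>simp add: unitaries_def\<close>)
    qed
    moreover have "star u * \<Psi> X * u = \<Phi> k X" for X
    proof -
      have "star u * \<Psi> X * u = (star u * u) * \<Phi> k X * (star u * u)" by (simp only: Psi mult.assoc)
      then show ?thesis using u(2) Pc by simp
    qed
    ultimately show ?case by simp
  qed
qed

section \<open>Recurrence\<close>

text \<open>Bolzano-Weierstrass, passing to a further subsequence for each coordinate.\<close>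

lemma bounded_family_convergent_subsequence:
  fixes f :: "nat \<Rightarrow> 'i \<Rightarrow> complex"
  assumes "finite I" "\<And>i k. i \<in> I \<Longrightarrow> cmod (f k i) \<le> B"
  shows "\<exists>r l. strict_mono (r :: nat \<Rightarrow> nat) \<and> (\<forall>i\<in>I. (\<lambda>k. f (r k) i) \<longlonglongrightarrow> l i)"
  using assms
proof (induction I rule: finite_induct)
  case empty
  show ?case by (intro exI[of _ "\<lambda>k. k"]) (auto simp: strict_mono_def)
next
  case (insert i I)
  then obtain r l where r: "strict_mono (r :: nat \<Rightarrow> nat)" "\<forall>i\<in>I. (\<lambda>k. f (r k) i) \<longlonglongrightarrow> l i"
    by auto
  have "bounded (range (\<lambda>k. f (r k) i))"
    unfolding bounded_iff using insert.prems[of i] by auto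
  then obtain z s where s: "strict_mono (s :: nat \<Rightarrow> nat)" "((\<lambda>k. f (r k) i) \<circ> s) \<longlonglongrightarrow> z"
    using bounded_imp_convergent_subsequence by blast
  have "(\<lambda>k. f (r (s k)) j) \<longlonglongrightarrow> (l(i := z)) j" if "j \<in> insert i I" for j
  proof (cases "j = i")
    case True
    then show ?thesis using s(2) by (simp add: o_def)
  next
    case False
    then have "((\<lambda>k. f (r k) j) \<circ> s) \<longlonglongrightarrow> l j"
      using r(2) that by (intro LIMSEQ_subseq_LIMSEQ s(1)) auto
    then show ?thesis using False by (simp add: o_def)
  qed
  moreover have "strict_mono (\<lambda>k. r (s k))"
    using strict_mono_o[OF r(1) s(1)] by (simp add: o_def)
  ultimately show ?case by blast
qed

section \<open>Limits of matrices and of maps\<close>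

definition mk :: "nat \<Rightarrow> (nat \<Rightarrow> nat \<Rightarrow> complex) \<Rightarrow> fm" where
  "mk n f = Fm (\<lambda>i j. if i < n \<and> j < n then f i j else 0)"

lemma ent_mk: "ent (mk n f) i j = (if i < n \<and> j < n then f i j else 0)"
  unfolding mk_def by (subst ent_Fm[of _ n]) (auto split: if_splits)

lemma mk_corner [simp]: "mk n f \<in> corner n"
  by (rule cornerI) (auto simp: ent_mk)

definition tends :: "(nat \<Rightarrow> fm) \<Rightarrow> fm \<Rightarrow> bool" where
  "tends X L \<longleftrightarrow> (\<forall>i j. (\<lambda>k. ent (X k) i j) \<longlonglongrightarrow> ent L i j)"

lemma tendsI:
  assumes "\<And>k. X k \<in> corner n" "L \<in> corner n"
    "\<And>i j. i < n \<Longrightarrow> j < n \<Longrightarrow> (\<lambda>k. ent (X k) i j) \<longlonglongrightarrow> ent L i j"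
  shows "tends X L"
  unfolding tends_def
proof (intro allI)
  fix i j
  show "(\<lambda>k. ent (X k) i j) \<longlonglongrightarrow> ent L i j"
  proof (cases "i < n \<and> j < n")
    case False
    then show ?thesis using corner_ent[OF assms(1)] corner_ent[OF assms(2)] by simp
  qed (use assms(3) in blast)
qed

lemma tends_unique: "tends X L \<Longrightarrow> tends X M \<Longrightarrow> L = M"
  by (rule fm_eqI) (metis tends_def LIMSEQ_unique)

lemma tends_const [intro]: "tends (\<lambda>k. X) X"
  by (simp add: tends_def)

lemma tends_diff: "tends X L \<Longrightarrow> tends Y M \<Longrightarrow> tends (\<lambda>k. X k - Y k) (L - M)"
  by (auto simp: tends_def ent_diff intro: tendsto_diff)

lemma tends_star: "tends X L \<Longrightarrow> tends (\<lambda>k. star (X k)) (star L)"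
  by (auto simp: tends_def ent_star intro: tendsto_cnj)

lemma tends_cs: "c \<longlonglongrightarrow> b \<Longrightarrow> tends X L \<Longrightarrow> tends (\<lambda>k. cs (c k) (X k)) (cs b L)"
  by (auto simp: tends_def ent_cs intro: tendsto_mult)

lemma tends_sum: "(\<And>j. j \<in> J \<Longrightarrow> tends (\<lambda>k. X j k) (L j)) \<Longrightarrow> tends (\<lambda>k. \<Sum>j\<in>J. X j k) (\<Sum>j\<in>J. L j)"
  unfolding tends_def ent_sum by (auto intro: tendsto_sum)

lemma tends_mult:
  assumes "\<And>k. X k \<in> corner n" "L \<in> corner n" "tends X L" "tends Y M"
  shows "tends (\<lambda>k. X k * Y k) (L * M)"
  using assms(3,4) unfolding tends_def ent_mult[OF assms(1)] ent_mult[OF assms(2)]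
  by (auto intro!: tendsto_sum tendsto_mult)

lemma tends_tr: "tends X L \<Longrightarrow> (\<lambda>k. tr n (X k)) \<longlonglongrightarrow> tr n L"
  unfolding tends_def tr_def by (auto intro!: tendsto_sum)

lemma tends_hs: "tends X L \<Longrightarrow> (\<lambda>k. hs n (X k)) \<longlonglongrightarrow> hs n L"
  unfolding tends_def hs_def by (auto intro!: tendsto_sum tendsto_power tendsto_norm)

lemma hs_tends:
  assumes "\<And>k. X k \<in> corner n" "L \<in> corner n" "(\<lambda>k. hs n (X k - L)) \<longlonglongrightarrow> 0"
  shows "tends X L"
proof (rule tendsI[OF assms(1,2)])
  fix i j assume ij: "i < n" "j < n"
  have "(\<lambda>k. sqrt (hs n (X k - L))) \<longlonglongrightarrow> sqrt 0" by (intro tendsto_intros assms(3))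
  then have lim: "(\<lambda>k. sqrt (hs n (X k - L))) \<longlonglongrightarrow> 0" by simp
  have "cmod (ent (X k) i j - ent L i j) \<le> sqrt (hs n (X k - L))" for k
    using real_le_rsqrt[OF ent_le_hs[OF ij, of "X k - L"]] by (simp add: ent_diff)
  then have "(\<lambda>k. ent (X k) i j - ent L i j) \<longlonglongrightarrow> 0"
    by (intro Lim_null_comparison[OF _ lim]) auto
  then show "(\<lambda>k. ent (X k) i j) \<longlonglongrightarrow> ent L i j" by (simp add: LIM_zero_iff)
qed

definition oplim :: "nat \<Rightarrow> (nat \<Rightarrow> fm \<Rightarrow> fm) \<Rightarrow> (fm \<Rightarrow> fm) \<Rightarrow> bool" where
  "oplim n T L \<longleftrightarrow> (\<lambda>k. sz n (\<lambda>X. T k X - L X)) \<longlonglongrightarrow> 0"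

lemma oplim_tends:
  assumes T: "\<And>k. op n (T k)" and L: "op n L" and lim: "oplim n T L"
  shows "tends (\<lambda>k. T k X) (L X)"
proof -
  let ?Y = "idm n * X * idm n"
  have "tends (\<lambda>k. T k ?Y) (L ?Y)"
  proof (rule hs_tends)
    have "(\<lambda>k. hs n ?Y * sz n (\<lambda>X. T k X - L X)) \<longlonglongrightarrow> hs n ?Y * 0"
      using lim unfolding oplim_def by (intro tendsto_intros)
    then have l0: "(\<lambda>k. hs n ?Y * sz n (\<lambda>X. T k X - L X)) \<longlonglongrightarrow> 0" by simp
    have "hs n (T k ?Y - L ?Y) \<le> hs n ?Y * sz n (\<lambda>X. T k X - L X)" for k
      by (rule hs_op_le[OF op_diff_map[OF T L] corner_cut])
    then show "(\<lambda>k. hs n (T k ?Y - L ?Y)) \<longlonglongrightarrow> 0"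
      by (intro tendsto_sandwich[OF _ _ tendsto_const l0]) auto
  qed (use op_corner[OF T] op_corner[OF L] in auto)
  then show ?thesis by (simp only: op_cut[OF T] op_cut[OF L])
qed

lemma tends_oplim:
  assumes "\<And>p q. p < n \<Longrightarrow> q < n \<Longrightarrow> tends (\<lambda>k. T k (unit p q)) (L (unit p q))"
  shows "oplim n T L"
proof -
  have "(\<lambda>k. hs n (T k (unit p q) - L (unit p q))) \<longlonglongrightarrow> 0" if "p < n" "q < n" for p q
    using tends_hs[OF tends_diff[OF assms[OF that] tends_const[of "L (unit p q)"]], of n]
    by (simp add: hs_def ent_zero)
  then have "(\<lambda>k. \<Sum>p<n. \<Sum>q<n. hs n (T k (unit p q) - L (unit p q))) \<longlonglongrightarrow> (\<Sum>p<n. \<Sum>q<n. 0)"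
    by (intro tendsto_sum) auto
  then show ?thesis unfolding oplim_def sz_def by simp
qed

lemma oplim_unique:
  assumes "\<And>k. op n (T k)" "op n L" "op n M" "oplim n T L" "oplim n T M"
  shows "L = M"
  by (rule op_eqI[OF assms(2,3)])
    (rule tends_unique[OF oplim_tends[OF assms(1,2,4)] oplim_tends[OF assms(1,3,5)]])

lemma oplim_subseq: "oplim n T L \<Longrightarrow> strict_mono (r :: nat \<Rightarrow> nat) \<Longrightarrow> oplim n (\<lambda>k. T (r k)) L"
  unfolding oplim_def using LIMSEQ_subseq_LIMSEQ[of _ 0 r] by (simp add: o_def)

lemma tends_chan_limit:
  assumes T: "\<And>k. chan n (T k)" and L: "op n L" and lim: "oplim n T L"
  shows "chan n L"
proof -
  have Top: "op n (T k)" for k by (rule chanD(1)[OF T])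
  have t: "tends (\<lambda>k. T k X) (L X)" for X by (rule oplim_tends[OF Top L lim])
  have c: "T k X \<in> corner n" "L X \<in> corner n" for k X using op_corner[OF Top] op_corner[OF L] by auto
  have "L (idm n) = idm n"
    using tends_unique[OF t[of "idm n"]] tends_const[of "idm n"] by (simp add: chanD(2)[OF T])
  moreover have "tr n (L X) = tr n X" if "X \<in> corner n" for X
    using tends_tr[OF t[of X], of n] by (simp add: chanD(3)[OF T that] LIMSEQ_const_iff)
  moreover have "L (star X) = star (L X)" for X
    using tends_unique[OF t[of "star X"]] tends_star[OF t[of X]] by (simp add: chanD(4)[OF T])
  moreover have "psdm n (L (star X * X) - star (L X) * L X)" if X: "X \<in> corner n" for X
    unfolding psdm_def
  proof
    fix Z assume Z: "Z \<in> corner n"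
    let ?D = "\<lambda>T. T (star X * X) - star (T X) * T X"
    have tD: "tends (\<lambda>k. star Z * ?D (T k) * Z) (star Z * ?D L * Z)"
      by (intro tends_mult[of _ n] tends_diff tends_star t tends_const) (use Z c in auto)
    have "\<forall>k. \<exists>r\<ge>0. tr n (star Z * ?D (T k) * Z) = complex_of_real r"
      using chanD(5)[OF T X] Z unfolding psdm_def by blast
    then obtain r where r: "\<And>k. 0 \<le> r k" "\<And>k. tr n (star Z * ?D (T k) * Z) = complex_of_real (r k)"
      by metis
    have lim: "(\<lambda>k. complex_of_real (r k)) \<longlonglongrightarrow> tr n (star Z * ?D L * Z)"
      using tends_tr[OF tD, of n] by (simp only: r(2))
    have "r \<longlonglongrightarrow> Re (tr n (star Z * ?D L * Z))" using tendsto_Re[OF lim] by simp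
    then have "0 \<le> Re (tr n (star Z * ?D L * Z))" using r(1) by (intro LIMSEQ_le_const) auto
    moreover have "Im (tr n (star Z * ?D L * Z)) = 0"
      using tendsto_Im[OF lim] by (simp add: LIMSEQ_const_iff)
    ultimately show "\<exists>r\<ge>0. tr n (star Z * ?D L * Z) = complex_of_real r"
      by (intro exI[of _ "Re (tr n (star Z * ?D L * Z))"]) (simp add: complex_eq_iff)
  qed
  ultimately show ?thesis using L unfolding chan_def by blast
qed

text \<open>Contractivity bounds all entries at matrix units by the norm of the identity map,
  independently of k.\<close>

lemma chan_subsequence:
  assumes T: "\<And>k. chan n (T k)"
  shows "\<exists>r L. strict_mono (r :: nat \<Rightarrow> nat) \<and> chan n L \<and> oplim n (\<lambda>k. T (r k)) L"
proof -
  let ?I = "{..<n} \<times> {..<n} \<times> {..<n} \<times> {..<n}"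
  define B where "B = sqrt (sz n (\<lambda>X. X))"
  have "cmod (ent (T k (unit p q)) a b) \<le> B" if "a < n" "b < n" "p < n" "q < n" for k a b p q
  proof -
    have "sz n (T k) \<le> sz n (\<lambda>X. X)"
      unfolding sz_def by (intro sum_mono chan_contraction[OF T]) auto
    then show ?thesis using ent_le_sz[OF that, of "T k"] unfolding B_def
      by (meson order_trans real_sqrt_le_mono)
  qed
  then obtain r l where r: "strict_mono (r :: nat \<Rightarrow> nat)"
    "\<forall>i\<in>?I. (\<lambda>k. (\<lambda>(a, b, p, q). ent (T (r k) (unit p q)) a b) i) \<longlonglongrightarrow> l i"
    using bounded_family_convergent_subsequence[of ?I "\<lambda>k (a, b, p, q). ent (T k (unit p q)) a b" B]
    by auto
  define Y where "Y = (\<lambda>p q. mk n (\<lambda>a b. l (a, b, p, q)))"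
  \<comment> \<open>Linear extension of the limits at matrix units; the cut by \<open>idm n\<close>
    makes it an \<open>op n\<close>.\<close>
  define L where "L = (\<lambda>X. \<Sum>p<n. \<Sum>q<n. cs (ent (idm n * X * idm n) p q) (Y p q))"
  have Lop: "op n L"
    unfolding L_def Y_def
    by (rule opI) (auto simp: ent_idm_mult ent_mult_idm ent_simps sum.distrib cs_distribs cs.scale_sum_right
        intro!: corner_sum sum.cong)
  have Lu: "L (unit p q) = Y p q" if "p < n" "q < n" for p q
  proof -
    have "L (unit p q) = (\<Sum>a<n. \<Sum>b<n. if b = q then (if a = p then Y p q else 0) else 0)"
      unfolding L_def using that by (intro sum.cong refl) (auto simp: ent_unit)
    also have "\<dots> = (\<Sum>a<n. if a = p then Y p q else 0)" using that by simp
    finally show ?thesis using that by simp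
  qed
  have lim: "oplim n (\<lambda>k. T (r k)) L"
  proof (rule tends_oplim, rule tendsI)
    fix p q a b assume "p < n" "q < n" "a < n" "b < n"
    then show "(\<lambda>k. ent (T (r k) (unit p q)) a b) \<longlonglongrightarrow> ent (L (unit p q)) a b"
      using r(2)[rule_format, of "(a, b, p, q)"] by (simp add: Lu Y_def ent_mk)
  qed (use op_corner[OF chanD(1)[OF T]] op_corner[OF Lop] in auto)
  then have "chan n L" by (intro tends_chan_limit[OF _ Lop lim] T)
  then show ?thesis using r(1) lim by blast
qed

text \<open>T_k S_k - L M = T_k (S_k - M) + (T_k - L) M, where the contraction T_k does not enlarge
  the first term.\<close>

lemma oplim_comp:
  assumes T: "\<And>k. chan n (T k)" and L: "op n L" and S: "\<And>k. op n (S k)" and M: "op n M"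
    and limT: "oplim n T L" and limS: "oplim n S M"
  shows "oplim n (\<lambda>k X. T k (S k X)) (\<lambda>X. L (M X))"
proof -
  let ?t = "\<lambda>k. sz n (\<lambda>X. T k X - L X)" and ?s = "\<lambda>k. sz n (\<lambda>X. S k X - M X)"
  have Top: "op n (T k)" for k by (rule chanD(1)[OF T])
  have "(\<lambda>k. 2 * ?s k + 2 * (sz n M * ?t k)) \<longlonglongrightarrow> 2 * 0 + 2 * (sz n M * 0)"
    using limT limS unfolding oplim_def by (intro tendsto_intros)
  then have lim: "(\<lambda>k. 2 * ?s k + 2 * (sz n M * ?t k)) \<longlonglongrightarrow> 0" by simp
  have "sz n (\<lambda>X. T k (S k X) - L (M X)) \<le> 2 * ?s k + 2 * (sz n M * ?t k)" for k
  proof -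
    have "sz n (\<lambda>X. T k (S k X) - L (M X)) = sz n (\<lambda>X. T k (S k X - M X) + (T k (M X) - L (M X)))"
      by (simp add: op_diff[OF Top])
    also have "\<dots> \<le> 2 * sz n (\<lambda>X. T k (S k X - M X)) + 2 * sz n (\<lambda>X. T k (M X) - L (M X))"
      by (rule sz_add_le)
    also have "sz n (\<lambda>X. T k (S k X - M X)) \<le> ?s k"
      unfolding sz_def using op_corner[OF S] op_corner[OF M]
      by (intro sum_mono chan_contraction[OF T]) auto
    also have "sz n (\<lambda>X. T k (M X) - L (M X)) \<le> sz n M * ?t k"
      by (rule sz_comp_le[OF op_diff_map[OF Top L] M])
    finally show ?thesis by simp
  qed
  then show ?thesis unfolding oplim_def
    by (intro tendsto_sandwich[OF _ _ tendsto_const lim]) auto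
qed

text \<open>Along a subsequence the semigroup returns to an idempotent: if \<open>\<Phi> (a\<^sub>k)\<close> converges to \<open>P\<close>
  then limits of \<open>\<Phi> (a\<^sub>k\<^sub>+\<^sub>1 - a\<^sub>k)\<close> fix the range of \<open>P\<close> and factor through \<open>P\<close>.\<close>

lemma recurrent_idempotent:
  fixes \<Phi> :: "real \<Rightarrow> fm \<Rightarrow> fm"
  assumes ch: "\<And>t. 0 \<le> t \<Longrightarrow> chan n (\<Phi> t)"
    and sg: "\<And>s t X. 0 \<le> s \<Longrightarrow> 0 \<le> t \<Longrightarrow> \<Phi> (s + t) X = \<Phi> s (\<Phi> t X)"
  shows "\<exists>E s. chan n E \<and> (\<forall>X. E (E X) = E X) \<and> (\<forall>k. real k \<le> s k) \<and> oplim n (\<lambda>k. \<Phi> (s k)) E"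
proof -
  \<comment> \<open>Powers of 3 make each gap \<open>s k\<close> at least twice
    \<open>a (r k)\<close>. So \<open>s k - a (r k)\<close> is a legitimate time and itself tends to
    infinity.\<close>
  define a where "a = (\<lambda>k::nat. (3::real) ^ k)"
  have a0: "0 \<le> a k" for k by (simp add: a_def)
  obtain r P where r: "strict_mono (r :: nat \<Rightarrow> nat)" "chan n P" "oplim n (\<lambda>k. \<Phi> (a (r k))) P"
    using chan_subsequence[of n "\<lambda>k. \<Phi> (a k)"] ch[OF a0] by blast
  define s where "s = (\<lambda>k. a (r (Suc k)) - a (r k))"
  have gap: "a (r k) \<le> s k - a (r k)" for k
  proof -
    have "a (Suc (r k)) \<le> a (r (Suc k))"
      unfolding a_def by (rule power_increasing) (use r(1) in \<open>auto simp: strict_mono_Suc_iff Suc_le_eq\<close>)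
    then show ?thesis by (simp add: s_def a_def)
  qed
  have ak: "real k \<le> a (r k)" for k
  proof -
    have "real k \<le> real (r k)" using seq_suble[OF r(1)] by simp
    moreover have "real m + 1 \<le> 3 ^ m" for m by (induction m) auto
    from this[of "r k"] have "real (r k) \<le> a (r k)" unfolding a_def by linarith
    ultimately show ?thesis by linarith
  qed
  have s_pos: "0 \<le> s k - a (r k)" "0 \<le> s k" "real k \<le> s k" for k
    using gap[of k] a0[of "r k"] ak[of k] by linarith+
  obtain q E where q: "strict_mono (q :: nat \<Rightarrow> nat)" "chan n E" "oplim n (\<lambda>k. \<Phi> (s (q k))) E"
    using chan_subsequence[of n "\<lambda>k. \<Phi> (s k)"] ch[OF s_pos(2)] by blast
  obtain w Q where w: "strict_mono (w :: nat \<Rightarrow> nat)" "chan n Q"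
      "oplim n (\<lambda>k. \<Phi> (s (q (w k)) - a (r (q (w k))))) Q"
    using chan_subsequence[of n "\<lambda>k. \<Phi> (s (q k) - a (r (q k)))"] ch[OF s_pos(1)] by blast
  define z where "z = (\<lambda>k. q (w k))"
  have z: "strict_mono z" using strict_mono_o[OF q(1) w(1)] by (simp add: z_def o_def)
  have limE: "oplim n (\<lambda>k. \<Phi> (s (z k))) E"
    using oplim_subseq[OF q(3) w(1)] by (simp add: z_def)
  have limP: "oplim n (\<lambda>k. \<Phi> (a (r (z k)))) P"
    using oplim_subseq[OF r(3) z] by simp
  have limP': "oplim n (\<lambda>k. \<Phi> (a (r (Suc (z k))))) P"
    using oplim_subseq[OF r(3), of "\<lambda>k. Suc (z k)"] z by (simp add: strict_mono_def)
  have limQ: "oplim n (\<lambda>k. \<Phi> (s (z k) - a (r (z k)))) Q" using w(3) by (simp add: z_def)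
  note oE = chanD(1)[OF q(2)] and oP = chanD(1)[OF r(2)] and oQ = chanD(1)[OF w(2)]
  have o: "op n (\<Phi> t)" if "0 \<le> t" for t by (rule chanD(1)[OF ch[OF that]])
  have EP: "(\<lambda>X. E (P X)) = P"
  proof (rule oplim_unique)
    show "oplim n (\<lambda>k X. \<Phi> (s (z k)) (\<Phi> (a (r (z k))) X)) (\<lambda>X. E (P X))"
      by (rule oplim_comp[OF ch[OF s_pos(2)] oE o[OF a0] oP limE limP])
    have "\<Phi> (s (z k)) (\<Phi> (a (r (z k))) X) = \<Phi> (a (r (Suc (z k)))) X" for k X
      using sg[OF s_pos(2) a0, of "z k" "r (z k)" X] by (simp add: s_def)
    then show "oplim n (\<lambda>k X. \<Phi> (s (z k)) (\<Phi> (a (r (z k))) X)) P" using limP' by simp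
  qed (rule op_comp[OF o[OF s_pos(2)] o[OF a0]] op_comp[OF oE oP] oP)+
  have PQ: "(\<lambda>X. P (Q X)) = E"
  proof (rule oplim_unique)
    show "oplim n (\<lambda>k X. \<Phi> (a (r (z k))) (\<Phi> (s (z k) - a (r (z k))) X)) (\<lambda>X. P (Q X))"
      by (rule oplim_comp[OF ch[OF a0] oP o[OF s_pos(1)] oQ limP limQ])
    have "\<Phi> (a (r (z k))) (\<Phi> (s (z k) - a (r (z k))) X) = \<Phi> (s (z k)) X" for k X
      using sg[OF a0 s_pos(1), of "r (z k)" "z k" X] by simp
    then show "oplim n (\<lambda>k X. \<Phi> (a (r (z k))) (\<Phi> (s (z k) - a (r (z k))) X)) E" using limE by simp
  qed (rule op_comp[OF o[OF a0] o[OF s_pos(1)]] op_comp[OF oP oQ] oE)+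
  \<comment> \<open>E E = E P Q = P Q = E.\<close>
  have "E (E X) = E X" for X
    using fun_cong[OF PQ, of X] fun_cong[OF EP, of "Q X"] by simp
  moreover have "real k \<le> s (z k)" for k
    using seq_suble[OF z, of k] s_pos(3)[of "z k"] by linarith
  ultimately show ?thesis using q(2) limE by (intro exI[of _ E] exI[of _ "\<lambda>k. s (z k)"]) auto
qed

text \<open>The norm of Phi_t X lies between those of Phi_(s_k) X and X once s_k exceeds t, and the
  former tends to the norm of E X = X.\<close>

lemma isometry_on_recurrent_range:
  fixes \<Phi> :: "real \<Rightarrow> fm \<Rightarrow> fm"
  assumes ch: "\<And>t. 0 \<le> t \<Longrightarrow> chan n (\<Phi> t)"
    and sg: "\<And>s t X. 0 \<le> s \<Longrightarrow> 0 \<le> t \<Longrightarrow> \<Phi> (s + t) X = \<Phi> s (\<Phi> t X)"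
    and E: "chan n E" "\<And>k. real k \<le> s k" "oplim n (\<lambda>k. \<Phi> (s k)) E"
    and X: "X \<in> corner n" "E X = X" and t: "0 \<le> t"
  shows "hs n (\<Phi> t X) = hs n X"
proof (rule antisym)
  show "hs n (\<Phi> t X) \<le> hs n X" by (rule chan_contraction[OF ch[OF t] X(1)])
  have s0: "0 \<le> s k" for k using E(2)[of k] by linarith
  have "(\<lambda>k. hs n (\<Phi> (s k) X)) \<longlonglongrightarrow> hs n (E X)"
    by (intro tends_hs oplim_tends[OF chanD(1)[OF ch[OF s0]] chanD(1)[OF E(1)] E(3)])
  then have lim: "(\<lambda>k. hs n (\<Phi> (s k) X)) \<longlonglongrightarrow> hs n X" using X(2) by simp
  obtain k0 :: nat where k0: "t \<le> real k0" using real_arch_simple by blast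
  have "hs n (\<Phi> (s k) X) \<le> hs n (\<Phi> t X)" if "k0 \<le> k" for k
  proof -
    have st: "0 \<le> s k - t" using E(2)[of k] k0 that by linarith
    have "\<Phi> (s k) X = \<Phi> (s k - t) (\<Phi> t X)" using sg[OF st t, of X] by simp
    then show ?thesis using chan_contraction[OF ch[OF st] op_corner[OF chanD(1)[OF ch[OF t]]]] by simp
  qed
  then show "hs n X \<le> hs n (\<Phi> t X)" by (intro LIMSEQ_le_const2[OF lim]) blast
qed

section \<open>Closedness and additive sets of times\<close>

lemma comb_Rnn_explicit:
  assumes "T \<in> comb Rnn U"
  shows "\<exists>(J :: nat set) lam u. finite J \<and> (\<forall>j\<in>J. 0 \<le> lam j \<and> u j \<in> U) \<and>
    T = (\<lambda>X. \<Sum>j\<in>J. cs (complex_of_real (lam j)) (star (u j) * X * u j))"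
  using assms
proof (induction rule: comb.induct)
  case comb_zero
  show ?case by (intro exI[of _ "{}"]) simp
next
  case (comb_step T v c)
  then obtain J :: "nat set" and lam u where J: "finite J" "\<forall>j\<in>J. 0 \<le> lam j \<and> u j \<in> U"
    and T: "T = (\<lambda>X. \<Sum>j\<in>J. cs (complex_of_real (lam j)) (star (u j) * X * u j))" by blast
  obtain k where k: "k \<notin> J" using ex_new_if_finite[OF infinite_UNIV_nat J(1)] by blast
  obtain r where r: "c = complex_of_real r" "0 \<le> r" using comb_step.hyps by (auto simp: Rnn_def)
  have "T X + cs c (star v * X * v)
      = (\<Sum>j\<in>insert k J. cs (complex_of_real ((lam(k := r)) j)) (star ((u(k := v)) j) * X * (u(k := v)) j))" for X
  proof -
    have "(\<Sum>j\<in>J. cs (complex_of_real ((lam(k := r)) j)) (star ((u(k := v)) j) * X * (u(k := v)) j)) = T X"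
      unfolding T by (intro sum.cong) (use k in auto)
    then show ?thesis unfolding sum.insert[OF J(1) k] by (simp add: r add.commute)
  qed
  then show ?case using J k r comb_step.hyps
    by (intro exI[of _ "insert k J"] exI[of _ "lam(k := r)"] exI[of _ "u(k := v)"]) auto
qed

text \<open>Caratheodory's theorem for cones. The bound counts the real and imaginary parts of all
  entries of all images of matrix units, that is, the real dimension of the space of maps.\<close>

lemma caratheodory_cone:
  fixes J :: "nat set"
  assumes "finite J" "\<forall>j\<in>J. 0 \<le> lam j \<and> u j \<in> U" and U: "U \<subseteq> corner n"
  shows "\<exists>J' lam'. J' \<subseteq> J \<and> card J' \<le> 2 * (n * n * (n * n)) \<and> (\<forall>j\<in>J'. 0 \<le> lam' j) \<and>
    (\<lambda>X. \<Sum>j\<in>J. cs (complex_of_real (lam j)) (star (u j) * X * u j)) =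
    (\<lambda>X. \<Sum>j\<in>J'. cs (complex_of_real (lam' j)) (star (u j) * X * u j))"
  using assms(1,2)
proof (induction J arbitrary: lam rule: finite_psubset_induct)
  case (psubset J)
  show ?case
  proof (cases "card J \<le> 2 * (n * n * (n * n))")
    case True
    then show ?thesis using psubset.prems by blast
  next
    case False
    let ?I = "(UNIV :: bool set) \<times> ({..<n} \<times> {..<n}) \<times> ({..<n} \<times> {..<n})"
    define v where "v = (\<lambda>j (t :: bool, (a, b), (p, q)). (if t then Re else Im) (ent (star (u j) * unit p q * u j) a b))"
    have "card ?I < card J" using False by (simp add: card_cartesian_product)
    then obtain c0 :: "nat \<Rightarrow> real" where c0: "\<exists>j\<in>J. c0 j \<noteq> 0" "\<forall>i\<in>?I. (\<Sum>j\<in>J. c0 j * v j i) = 0"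
      using exists_linear_relation[of ?I J v] psubset.hyps by (auto simp del: UNIV_Times_UNIV)
    \<comment> \<open>The sign is chosen so that some coefficient of the relation is
      positive.\<close>
    define c where "c = (if \<exists>j\<in>J. c0 j > 0 then c0 else (\<lambda>j. - c0 j))"
    have cpos: "\<exists>j\<in>J. c j > 0" using c0(1) by (auto simp: c_def) (metis linorder_neqE_linordered_idom)
    have cz: "(\<Sum>j\<in>J. c j * v j i) = 0" if "i \<in> ?I" for i
      using c0(2) that by (auto simp: c_def sum_negf)
    have uc: "u j \<in> corner n" if "j \<in> J" for j using psubset.prems U that by auto
    have "(\<lambda>X. \<Sum>j\<in>J. cs (complex_of_real (c j)) (star (u j) * X * u j)) = (\<lambda>X. 0)"
    proof (rule op_eqI[of n])
      fix p q assume pq: "p < n" "q < n"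
      show "(\<Sum>j\<in>J. cs (complex_of_real (c j)) (star (u j) * unit p q * u j)) = 0"
      proof (rule corner_eqI[of _ n])
        fix a b assume ab: "a < n" "b < n"
        have "(\<Sum>j\<in>J. c j * Re (ent (star (u j) * unit p q * u j) a b)) = 0"
          "(\<Sum>j\<in>J. c j * Im (ent (star (u j) * unit p q * u j) a b)) = 0"
          using cz[of "(True, (a, b), (p, q))"] cz[of "(False, (a, b), (p, q))"] pq ab by (simp_all add: v_def)
        then show "ent (\<Sum>j\<in>J. cs (complex_of_real (c j)) (star (u j) * unit p q * u j)) a b = ent 0 a b"
          by (simp add: ent_simps complex_eq_iff)
      qed (use uc pq in \<open>auto intro!: corner_sum\<close>)
    qed (use uc in \<open>auto intro!: op_sum_map op_cs_map op_sandwich op_zero_map\<close>)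
    then have rel: "(\<Sum>j\<in>J. cs (complex_of_real (c j)) (star (u j) * X * u j)) = 0" for X
      by (rule fun_cong)
    define P where "P = {j \<in> J. c j > 0}"
    have P: "finite P" "P \<noteq> {}" using psubset.hyps cpos by (auto simp: P_def)
    have "Min ((\<lambda>j. lam j / c j) ` P) \<in> (\<lambda>j. lam j / c j) ` P" using P by (intro Min_in) auto
    then obtain k where k: "k \<in> P" "Min ((\<lambda>j. lam j / c j) ` P) = lam k / c k" by blast
    \<comment> \<open>The largest multiple of the relation that can be subtracted with all weights
      staying nonnegative; the weight at \<open>k\<close> becomes zero.\<close>
    define t where "t = lam k / c k"
    have tmin: "t \<le> lam j / c j" if "j \<in> P" for j
      unfolding t_def k(2)[symmetric] using P that by simp
    have kJ: "k \<in> J" "c k > 0" using k by (auto simp: P_def)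
    have t0: "0 \<le> t" using psubset.prems kJ by (simp add: t_def)
    define lam1 where "lam1 = (\<lambda>j. lam j - t * c j)"
    have lam1: "0 \<le> lam1 j" if j: "j \<in> J" for j
    proof (cases "c j > 0")
      case True
      then show ?thesis using tmin[of j] j by (simp add: lam1_def P_def field_simps)
    next
      case False
      then have "t * c j \<le> 0" using t0 by (simp add: mult_nonneg_nonpos)
      moreover have "0 \<le> lam j" using psubset.prems j by blast
      ultimately show ?thesis unfolding lam1_def by linarith
    qed
    have lk: "lam1 k = 0" using kJ by (simp add: lam1_def t_def)
    have eq: "(\<Sum>j\<in>J. cs (complex_of_real (lam j)) (star (u j) * X * u j))
        = (\<Sum>j\<in>J - {k}. cs (complex_of_real (lam1 j)) (star (u j) * X * u j))" for X
    proof -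
      have "(\<Sum>j\<in>J. cs (complex_of_real (lam1 j)) (star (u j) * X * u j))
          = (\<Sum>j\<in>J. cs (complex_of_real (lam j)) (star (u j) * X * u j))
            - cs (complex_of_real t) (\<Sum>j\<in>J. cs (complex_of_real (c j)) (star (u j) * X * u j))"
        by (simp add: lam1_def cs.scale_left_diff_distrib sum_subtractf cs.scale_sum_right)
      then have "(\<Sum>j\<in>J. cs (complex_of_real (lam j)) (star (u j) * X * u j))
          = (\<Sum>j\<in>J. cs (complex_of_real (lam1 j)) (star (u j) * X * u j))" by (simp add: rel)
      also have "\<dots> = cs (complex_of_real (lam1 k)) (star (u k) * X * u k)
          + (\<Sum>j\<in>J - {k}. cs (complex_of_real (lam1 j)) (star (u j) * X * u j))"
        by (rule sum.remove) (use psubset.hyps kJ in auto)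
      finally show ?thesis by (simp add: lk)
    qed
    have "J - {k} \<subset> J" using kJ by blast
    from psubset.IH[OF this, of lam1] lam1 psubset.prems obtain J' lam'
      where J': "J' \<subseteq> J - {k}" "card J' \<le> 2 * (n * n * (n * n))" "\<forall>j\<in>J'. 0 \<le> lam' j"
        "(\<lambda>X. \<Sum>j\<in>J - {k}. cs (complex_of_real (lam1 j)) (star (u j) * X * u j)) =
         (\<lambda>X. \<Sum>j\<in>J'. cs (complex_of_real (lam' j)) (star (u j) * X * u j))" by auto
    show ?thesis unfolding eq using J' by (intro exI[of _ J'] exI[of _ lam']) auto
  qed
qed

text \<open>Shorter combinations are padded with weight 0 and unitary \<open>idm n\<close>, so one
  length serves all maps of a sequence.\<close>

lemma comb_unitaries_bounded_length:
  assumes "T \<in> comb Rnn (unitaries n)"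
  shows "\<exists>lam u. (\<forall>j < 2 * (n * n * (n * n)). 0 \<le> lam j \<and> u j \<in> unitaries n) \<and>
    T = (\<lambda>X. \<Sum>j < 2 * (n * n * (n * n)). cs (complex_of_real (lam j)) (star (u j) * X * u j))"
proof -
  let ?D = "2 * (n * n * (n * n))"
  obtain J0 :: "nat set" and lam0 u where J0: "finite J0" "\<forall>j\<in>J0. 0 \<le> lam0 j \<and> u j \<in> unitaries n"
    and T0: "T = (\<lambda>X. \<Sum>j\<in>J0. cs (complex_of_real (lam0 j)) (star (u j) * X * u j))"
    using comb_Rnn_explicit[OF assms] by blast
  have "unitaries n \<subseteq> corner n" by (auto simp: unitaries_def)
  from caratheodory_cone[OF J0 this] obtain J lam where J: "J \<subseteq> J0" "card J \<le> ?D" "\<forall>j\<in>J. 0 \<le> lam j"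
    and T: "T = (\<lambda>X. \<Sum>j\<in>J. cs (complex_of_real (lam j)) (star (u j) * X * u j))"
    unfolding T0 by auto
  have "finite J" using J(1) J0(1) finite_subset by blast
  then obtain f where f: "bij_betw f {..<card J} J"
    using ex_bij_betw_nat_finite[of J] by (auto simp: atLeast0LessThan)
  define l where "l = (\<lambda>j. if j < card J then lam (f j) else 0)"
  define w where "w = (\<lambda>j. if j < card J then u (f j) else idm n)"
  have fJ: "f j \<in> J" if "j < card J" for j using bij_betwE[OF f] that by blast
  have "\<forall>j<?D. 0 \<le> l j \<and> w j \<in> unitaries n"
    using fJ J(1,3) J0(2) by (auto simp: l_def w_def unitaries_def)
  moreover have "(\<Sum>j\<in>J. cs (complex_of_real (lam j)) (star (u j) * X * u j))
      = (\<Sum>j<?D. cs (complex_of_real (l j)) (star (w j) * X * w j))" for X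
  proof -
    have "(\<Sum>j\<in>J. cs (complex_of_real (lam j)) (star (u j) * X * u j))
        = (\<Sum>j<card J. cs (complex_of_real (lam (f j))) (star (u (f j)) * X * u (f j)))"
      by (rule sum.reindex_bij_betw[OF f, symmetric])
    also have "\<dots> = (\<Sum>j<card J. cs (complex_of_real (l j)) (star (w j) * X * w j))"
      by (intro sum.cong) (auto simp: l_def w_def)
    also have "\<dots> = (\<Sum>j<?D. cs (complex_of_real (l j)) (star (w j) * X * w j))"
      by (rule sum.mono_neutral_left) (use J(2) in \<open>auto simp: l_def\<close>)
    finally show ?thesis .
  qed
  ultimately show ?thesis unfolding T by blast
qed

text \<open>With a fixed number of terms, the weights lie in [0, 1] and the unitaries have bounded
  entries. A subsequence along which all of them converge gives a decomposition of the
  limit.\<close>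

lemma mixed_unitary_closed:
  assumes n: "0 < n" and T: "\<And>k. T k \<in> comb Rnn (unitaries n)" and unital: "\<And>k. T k (idm n) = idm n"
    and L: "op n L" and lim: "oplim n T L"
  shows "L \<in> comb Rnn (unitaries n)"
proof -
  let ?D = "2 * (n * n * (n * n))"
  have "\<forall>k. \<exists>lam u. (\<forall>j < ?D. 0 \<le> lam j \<and> u j \<in> unitaries n) \<and>
    T k = (\<lambda>X. \<Sum>j < ?D. cs (complex_of_real (lam j)) (star (u j) * X * u j))"
    using comb_unitaries_bounded_length[OF T] by blast
  from choice[OF this] obtain lam where "\<forall>k. \<exists>u. (\<forall>j < ?D. 0 \<le> lam k j \<and> u j \<in> unitaries n) \<and>
    T k = (\<lambda>X. \<Sum>j < ?D. cs (complex_of_real (lam k j)) (star (u j) * X * u j))" ..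
  from choice[OF this] obtain u where lu: "\<forall>k. (\<forall>j < ?D. 0 \<le> lam k j \<and> u k j \<in> unitaries n) \<and>
    T k = (\<lambda>X. \<Sum>j < ?D. cs (complex_of_real (lam k j)) (star (u k j) * X * u k j))" ..
  have pos: "0 \<le> lam k j" and u: "u k j \<in> unitaries n" if "j < ?D" for k j
    using lu that by blast+
  have Teq: "T k = (\<lambda>X. \<Sum>j < ?D. cs (complex_of_real (lam k j)) (star (u k j) * X * u k j))" for k
    using lu by blast
  have uc: "u k j \<in> corner n" "star (u k j) * u k j = idm n" if "j < ?D" for k j
    using u[OF that] by (auto simp: unitaries_def)
  have s1: "(\<Sum>j<?D. lam k j) = 1" for k
  proof -
    have "T k (idm n) = (\<Sum>j<?D. cs (complex_of_real (lam k j)) (idm n))"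
      unfolding Teq using uc by (intro sum.cong) auto
    then have "idm n = (\<Sum>j<?D. cs (complex_of_real (lam k j)) (idm n))" by (simp only: unital)
    \<comment> \<open>The entry (0, 0) exists since n > 0; it shows that the weights sum to
      1.\<close>
    then have "ent (idm n) 0 0 = ent (\<Sum>j<?D. cs (complex_of_real (lam k j)) (idm n)) 0 0" by simp
    then have "complex_of_real (\<Sum>j<?D. lam k j) = complex_of_real 1"
      using n by (simp add: ent_simps)
    then show ?thesis by (simp only: of_real_eq_iff)
  qed
  have le1: "lam k j \<le> 1" if "j < ?D" for k j
    unfolding s1[of k, symmetric] by (rule member_le_sum) (use that pos in auto)
  have ule: "cmod (ent (u k j) a b) \<le> sqrt n" if "j < ?D" "a < n" "b < n" for k j a b
  proof -
    have "(cmod (ent (u k j) a b))\<^sup>2 \<le> hs n (u k j)" by (rule ent_le_hs[OF that(2,3)])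
    also have "hs n (u k j) = n"
      using uc[OF that(1)] by (simp add: hs_eq_tr) (simp add: tr_def ent_idm)
    finally show ?thesis by (rule real_le_rsqrt)
  qed
  \<comment> \<open>\<open>None\<close> indexes the weight of the j-th term and
    \<open>Some (a, b)\<close> an entry of its unitary, so that one subsequence serves both.\<close>
  let ?I = "{..<?D} \<times> (insert None (Some ` ({..<n} \<times> {..<n})))"
  define f where "f = (\<lambda>k (j, x). case x of None \<Rightarrow> complex_of_real (lam k j) | Some (a, b) \<Rightarrow> ent (u k j) a b)"
  have "cmod (f k i) \<le> 1 + sqrt n" if "i \<in> ?I" for k i
    using that pos le1 ule unfolding f_def
    by (auto intro: order_trans[of _ "sqrt n"] order_trans[of _ 1])
  then obtain r l where r: "strict_mono (r :: nat \<Rightarrow> nat)" "\<forall>i\<in>?I. (\<lambda>k. f (r k) i) \<longlonglongrightarrow> l i"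
    using bounded_family_convergent_subsequence[of ?I f "1 + sqrt n"] by auto
  define lm where "lm = (\<lambda>j. Re (l (j, None)))"
  define w where "w = (\<lambda>j. mk n (\<lambda>a b. l (j, Some (a, b))))"
  have wl: "tends (\<lambda>k. u (r k) j) (w j)" if j: "j < ?D" for j
  proof (rule tendsI)
    fix a b assume "a < n" "b < n"
    then show "(\<lambda>k. ent (u (r k) j) a b) \<longlonglongrightarrow> ent (w j) a b"
      using r(2)[rule_format, of "(j, Some (a, b))"] j by (simp add: f_def w_def ent_mk)
  qed (use uc[OF j] in \<open>auto simp: w_def\<close>)
  have ll: "(\<lambda>k. lam (r k) j) \<longlonglongrightarrow> lm j" if j: "j < ?D" for j
  proof -
    have "(\<lambda>k. complex_of_real (lam (r k) j)) \<longlonglongrightarrow> l (j, None)"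
      using r(2)[rule_format, of "(j, None)"] j by (simp add: f_def)
    from tendsto_Re[OF this] show ?thesis by (simp add: lm_def)
  qed
  have wc: "w j \<in> corner n" for j by (simp add: w_def)
  have wU: "w j \<in> unitaries n" if j: "j < ?D" for j
  proof -
    have "tends (\<lambda>k. star (u (r k) j) * u (r k) j) (star (w j) * w j)"
      by (intro tends_mult[of _ n] tends_star wl j) (use uc[OF j] wc in auto)
    then have "tends (\<lambda>k. idm n) (star (w j) * w j)" using uc(2)[OF j] by simp
    then have "star (w j) * w j = idm n" by (rule tends_unique) (rule tends_const)
    then show ?thesis using wc by (simp add: unitaries_def)
  qed
  have lpos: "0 \<le> lm j" if j: "j < ?D" for j
    by (rule LIMSEQ_le_const[OF ll[OF j]]) (use pos[OF j] in blast)
  have Top: "op n (T k)" for k by (rule comb_op[OF T]) (auto simp: unitaries_def)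
  have "L = (\<lambda>X. \<Sum>j<?D. cs (complex_of_real (lm j)) (star (w j) * X * w j))"
  proof (rule op_eqI'[OF L])
    show "op n (\<lambda>X. \<Sum>j<?D. cs (complex_of_real (lm j)) (star (w j) * X * w j))"
      by (intro op_sum_map op_cs_map op_sandwich) (use wc in auto)
    fix X assume X: "X \<in> corner n"
    have "tends (\<lambda>k. T (r k) X) (\<Sum>j<?D. cs (complex_of_real (lm j)) (star (w j) * X * w j))"
      unfolding Teq
    proof (intro tends_sum)
      fix j assume "j \<in> {..<?D}"
      then have j: "j < ?D" by simp
      show "tends (\<lambda>k. cs (complex_of_real (lam (r k) j)) (star (u (r k) j) * X * u (r k) j))
          (cs (complex_of_real (lm j)) (star (w j) * X * w j))"
        by (intro tends_cs tendsto_of_real ll[OF j] tends_mult[of _ n] tends_star wl[OF j] tends_const)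
          (use uc[OF j] wc X in auto)
    qed
    moreover have "tends (\<lambda>k. T (r k) X) (L X)"
      by (rule oplim_tends[OF Top L oplim_subseq[OF lim r(1)]])
    ultimately show "L X = (\<Sum>j<?D. cs (complex_of_real (lm j)) (star (w j) * X * w j))"
      using tends_unique by blast
  qed
  also have "\<dots> \<in> comb Rnn (unitaries n)"
    by (intro comb_sum comb_single) (use wU lpos in auto)
  finally show ?thesis .
qed

text \<open>If there is no such interval, every s_k is a limit from the right of times whose maps
  are not mixed unitary. Picking one of them with Phi_tau within squared distance 1/(k+1) of
  Phi_(s_k) yields a sequence that still tends to \<open>E\<close>, against
  \<open>eventually_mixed_unitary\<close>.\<close>

lemma semigroup_contains_mixed_unitary_interval:
  fixes \<Phi> :: "real \<Rightarrow> fm \<Rightarrow> fm"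
  assumes ch: "\<And>t. 0 \<le> t \<Longrightarrow> chan n (\<Phi> t)"
    and sg: "\<And>s t X. 0 \<le> s \<Longrightarrow> 0 \<le> t \<Longrightarrow> \<Phi> (s + t) X = \<Phi> s (\<Phi> t X)"
    and cont: "\<And>\<tau> t. (\<And>k. 0 \<le> \<tau> k) \<Longrightarrow> \<tau> \<longlonglongrightarrow> t \<Longrightarrow> oplim n (\<lambda>k. \<Phi> (\<tau> k)) (\<Phi> t)"
  shows "\<exists>a b. 0 \<le> a \<and> a < b \<and> (\<forall>t. a < t \<and> t < b \<longrightarrow> \<Phi> t \<in> comb Rnn (unitaries n))"
proof (rule ccontr)
  assume neg: "\<not> ?thesis"
  obtain E s where E: "chan n E" "\<And>X. E (E X) = E X" "\<And>k. real k \<le> s k" "oplim n (\<lambda>k. \<Phi> (s k)) E"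
    using recurrent_idempotent[of n \<Phi>] ch sg by blast
  have s0: "0 \<le> s k" for k using E(3)[of k] by linarith
  have "\<exists>t\<ge>0. \<Phi> t \<notin> comb Rnn (unitaries n) \<and> sz n (\<lambda>X. \<Phi> t X - \<Phi> (s k) X) < 1 / Suc k" for k
  proof -
    have "\<exists>t. s k < t \<and> t < s k + 1 / Suc m \<and> \<Phi> t \<notin> comb Rnn (unitaries n)" for m
      using neg[simplified, rule_format, of "s k" "s k + 1 / Suc m"] s0[of k] by auto
    then obtain \<tau> where \<tau>: "\<And>m. s k < \<tau> m" "\<And>m. \<tau> m < s k + 1 / Suc m"
      "\<And>m. \<Phi> (\<tau> m) \<notin> comb Rnn (unitaries n)" by metis
    have "(\<lambda>m. s k + 1 / Suc m) \<longlonglongrightarrow> s k + 0"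
      by (intro tendsto_intros LIMSEQ_Suc lim_1_over_n)
    then have up: "(\<lambda>m. s k + 1 / Suc m) \<longlonglongrightarrow> s k" by simp
    have "\<tau> \<longlonglongrightarrow> s k"
    proof (rule tendsto_sandwich[OF _ _ tendsto_const up])
      show "\<forall>\<^sub>F m in sequentially. s k \<le> \<tau> m"
        by (intro always_eventually allI less_imp_le \<tau>(1))
      show "\<forall>\<^sub>F m in sequentially. \<tau> m \<le> s k + 1 / Suc m"
        by (intro always_eventually allI less_imp_le \<tau>(2))
    qed
    moreover have t0: "0 \<le> \<tau> m" for m using \<tau>(1)[of m] s0[of k] by linarith
    ultimately have "oplim n (\<lambda>m. \<Phi> (\<tau> m)) (\<Phi> (s k))" by (intro cont)
    then have "\<forall>\<^sub>F m in sequentially. sz n (\<lambda>X. \<Phi> (\<tau> m) X - \<Phi> (s k) X) < 1 / Suc k"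
      unfolding oplim_def by (rule order_tendstoD(2)) simp
    then show ?thesis using \<tau>(3) t0 by (auto simp: eventually_sequentially)
  qed
  then obtain \<tau> where \<tau>: "\<And>k. 0 \<le> \<tau> k" "\<And>k. \<Phi> (\<tau> k) \<notin> comb Rnn (unitaries n)"
    "\<And>k. sz n (\<lambda>X. \<Phi> (\<tau> k) X - \<Phi> (s k) X) < 1 / Suc k" by metis
  have "(\<lambda>k. 2 * (1 / real (Suc k)) + 2 * sz n (\<lambda>X. \<Phi> (s k) X - E X)) \<longlonglongrightarrow> 2 * 0 + 2 * 0"
    using E(4) unfolding oplim_def
    by (intro tendsto_add tendsto_mult tendsto_const LIMSEQ_Suc lim_1_over_n)
  then have lim: "(\<lambda>k. 2 * (1 / real (Suc k)) + 2 * sz n (\<lambda>X. \<Phi> (s k) X - E X)) \<longlonglongrightarrow> 0" by simp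
  have le: "sz n (\<lambda>X. \<Phi> (\<tau> k) X - E X) \<le> 2 * (1 / real (Suc k)) + 2 * sz n (\<lambda>X. \<Phi> (s k) X - E X)" for k
    using sz_add_le[of n "\<lambda>X. \<Phi> (\<tau> k) X - \<Phi> (s k) X" "\<lambda>X. \<Phi> (s k) X - E X"] \<tau>(3)[of k]
    by (simp add: algebra_simps)
  have "(\<lambda>k. sz n (\<lambda>X. \<Phi> (\<tau> k) X - E X)) \<longlonglongrightarrow> 0"
    by (rule tendsto_sandwich[OF _ _ tendsto_const lim]) (use le in auto)
  moreover have "hs n (\<Phi> (\<tau> k) X) = hs n X" if "X \<in> corner n" "E X = X" for k X
    by (rule isometry_on_recurrent_range[OF ch sg E(1,3,4) that \<tau>(1)])
  ultimately have "\<forall>\<^sub>F k in sequentially. \<Phi> (\<tau> k) \<in> comb Rnn (unitaries n)"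
    by (intro eventually_mixed_unitary[OF E(1,2) ch[OF \<tau>(1)]])
  then show False using \<tau>(2) by (auto simp: eventually_sequentially)
qed

lemma additive_set_dichotomy:
  fixes T :: "real set"
  assumes T0: "0 \<in> T" "T \<subseteq> {0..}" and add: "\<And>s t. s \<in> T \<Longrightarrow> t \<in> T \<Longrightarrow> s + t \<in> T"
    and closed: "\<And>\<tau> t. (\<And>k. \<tau> k \<in> T) \<Longrightarrow> \<tau> \<longlonglongrightarrow> t \<Longrightarrow> t \<in> T"
    and int: "0 \<le> a" "a < b" "{a<..<b} \<subseteq> T"
  shows "open {t. 0 \<le> t \<and> t \<notin> T} \<and>
    ((\<forall>t\<ge>0. t \<in> T) \<noteq> (\<exists>t0 t1. 0 < t0 \<and> t0 \<le> t1 \<and> (\<forall>t. 0 < t \<and> t < t0 \<longrightarrow> t \<notin> T) \<and> (\<forall>t\<ge>t1. t \<in> T)))"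
proof
  have mult: "real m * t \<in> T" if "t \<in> T" for m t
    by (induction m) (use T0 add that in \<open>auto simp: algebra_simps\<close>)
  have "closed (- {t. 0 \<le> t \<and> t \<notin> T})"
    unfolding closed_sequential_limits
  proof (intro allI impI, elim conjE)
    fix x l assume x: "\<forall>k. x k \<in> - {t. 0 \<le> t \<and> t \<notin> T}" and l: "x \<longlonglongrightarrow> l"
    \<comment> \<open>Negative times belong to the complement but not to \<open>T\<close>; they are
      moved to 0, which is in \<open>T\<close>.\<close>
    have "(\<lambda>k. max (x k) 0) \<longlonglongrightarrow> max l 0" by (intro tendsto_max l tendsto_const)
    moreover have "max (x k) 0 \<in> T" for k using x[rule_format, of k] T0 by (auto simp: max_def)
    ultimately have "max l 0 \<in> T" by (rule closed[rotated])
    then show "l \<in> - {t. 0 \<le> t \<and> t \<notin> T}" by (auto simp: max_def split: if_splits)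
  qed
  then show "open {t. 0 \<le> t \<and> t \<notin> T}" by (simp add: open_closed)
  define c where "c = (a + b) / 2"
  have c: "a < c" "c < b" "0 < c" using int by (auto simp: c_def)
  \<comment> \<open>Division of t by m = ceiling (t / c) gives a quotient of at most c. As m < t / c
    + 1, it exceeds a as soon as t (c - a) > a c; the summand 1 in the bound makes this
    strict.\<close>
  have large: "t \<in> T" if t: "a * c / (c - a) + 1 \<le> t" for t
  proof -
    have "0 \<le> a * c / (c - a)" using c int by simp
    then have tpos: "0 < t" using t by linarith
    define m where "m = nat \<lceil>t / c\<rceil>"
    have tc: "0 < t / c" using tpos c by simp
    then have m: "t / c \<le> real m" "real m < t / c + 1" unfolding m_def by linarith+
    have mpos: "0 < real m" using m(1) tc by linarith
    have "t / real m \<le> c" using m(1) mpos c by (simp add: field_simps)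
    moreover have "a < t / real m"
    proof -
      have "a * c < t * (c - a)" using t c by (simp add: field_simps)
      then have "a * (t + c) < c * t" by (simp add: algebra_simps)
      then have "a * (t / c + 1) < t" using c by (simp add: field_simps)
      moreover have "a * real m \<le> a * (t / c + 1)" using m(2) int by (intro mult_left_mono) auto
      ultimately have "a * real m < t" by linarith
      then show ?thesis using mpos by (simp add: field_simps)
    qed
    ultimately have "t / real m \<in> T" using int(3) c by auto
    from mult[OF this, of m] show ?thesis using mpos by simp
  qed
  show "(\<forall>t\<ge>0. t \<in> T) \<noteq> (\<exists>t0 t1. 0 < t0 \<and> t0 \<le> t1 \<and> (\<forall>t. 0 < t \<and> t < t0 \<longrightarrow> t \<notin> T) \<and> (\<forall>t\<ge>t1. t \<in> T))"
  proof (cases "\<exists>t0>0. \<forall>t. 0 < t \<and> t < t0 \<longrightarrow> t \<notin> T")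
    case True
    then obtain t0 where t0: "0 < t0" "\<forall>t. 0 < t \<and> t < t0 \<longrightarrow> t \<notin> T" by blast
    have "t0 / 2 \<notin> T" using t0 by simp
    then have "\<not> (\<forall>t\<ge>0. t \<in> T)" using t0(1) by (metis half_gt_zero_iff less_imp_le)
    moreover have "\<exists>t0 t1. 0 < t0 \<and> t0 \<le> t1 \<and> (\<forall>t. 0 < t \<and> t < t0 \<longrightarrow> t \<notin> T) \<and> (\<forall>t\<ge>t1. t \<in> T)"
      using t0 large by (intro exI[of _ t0] exI[of _ "max t0 (a * c / (c - a) + 1)"]) auto
    ultimately show ?thesis by blast
  next
    case False
    have "\<exists>s. 0 < s \<and> s < 1 / Suc k \<and> s \<in> T" for k
      using False by (meson of_nat_0_less_iff zero_less_Suc zero_less_divide_1_iff)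
    then obtain s where s: "\<And>k. 0 < s k" "\<And>k. s k < 1 / Suc k" "\<And>k. s k \<in> T" by metis
    \<comment> \<open>The multiple of \<open>s k\<close> by floor (t / s k) misses t by less than
      \<open>s k\<close>, which tends to 0.\<close>
    have "t \<in> T" if t: "0 \<le> t" for t
    proof (rule closed)
      show "real (nat \<lfloor>t / s k\<rfloor>) * s k \<in> T" for k by (rule mult[OF s(3)])
      have fl: "real (nat \<lfloor>t / s k\<rfloor>) \<le> t / s k" "t / s k < real (nat \<lfloor>t / s k\<rfloor>) + 1" for k
        using t s(1)[of k] by (simp_all add: zero_le_divide_iff)
      have "\<bar>real (nat \<lfloor>t / s k\<rfloor>) * s k - t\<bar> \<le> 1 / Suc k" for k
      proof -
        have "real (nat \<lfloor>t / s k\<rfloor>) * s k \<le> t" "t < (real (nat \<lfloor>t / s k\<rfloor>) + 1) * s k"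
          using fl[of k] s(1)[of k] by (simp_all add: pos_le_divide_eq pos_divide_less_eq)
        then show ?thesis using s(2)[of k] by (simp add: distrib_right)
      qed
      then have "(\<lambda>k. real (nat \<lfloor>t / s k\<rfloor>) * s k - t) \<longlonglongrightarrow> 0"
        by (intro Lim_null_comparison[OF _ LIMSEQ_Suc[OF lim_1_over_n]]) auto
      then show "(\<lambda>k. real (nat \<lfloor>t / s k\<rfloor>) * s k) \<longlonglongrightarrow> t" by (simp add: LIM_zero_iff)
    qed
    then show ?thesis using False by blast
  qed
qed

section \<open>Transfer to matrices and the main theorem\<close>

definition toF :: "nat \<Rightarrow> complex mat \<Rightarrow> fm" where
  "toF d A = mk d (\<lambda>i j. A $$ (i, j))"

definition toM :: "nat \<Rightarrow> fm \<Rightarrow> complex mat" where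
  "toM d X = Matrix.mat d d (\<lambda>(i, j). ent X i j)"

lemma ent_toF: "ent (toF d A) i j = (if i < d \<and> j < d then A $$ (i, j) else 0)"
  by (simp add: toF_def ent_mk)

lemma toF_corner [simp]: "toF d A \<in> corner d"
  by (simp add: toF_def)

lemma toM_carrier [simp]: "toM d X \<in> carrier_mat d d"
  by (simp add: toM_def)

lemma toM_toF: "A \<in> carrier_mat d d \<Longrightarrow> toM d (toF d A) = A"
  by (rule eq_matI) (auto simp: toM_def ent_toF)

lemma toF_toM: "toF d (toM d X) = idm d * X * idm d"
  by (rule fm_eqI) (auto simp: toM_def ent_toF ent_idm_mult ent_mult_idm)

lemma toF_toM_corner: "X \<in> corner d \<Longrightarrow> toF d (toM d X) = X"
  by (simp add: toF_toM)

lemma toM_add: "toM d (X + Y) = toM d X + toM d Y"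
  and toM_cs: "toM d (cs c X) = c \<cdot>\<^sub>m toM d X"
  and toM_idm: "toM d (idm d) = 1\<^sub>m d"
  and toM_cut: "toM d (idm d * X * idm d) = toM d X"
  by (rule eq_matI, auto simp: toM_def ent_simps ent_idm_mult ent_mult_idm)+

lemma toF_add: "A \<in> carrier_mat d d \<Longrightarrow> B \<in> carrier_mat d d \<Longrightarrow> toF d (A + B) = toF d A + toF d B"
  and toF_smult: "A \<in> carrier_mat d d \<Longrightarrow> toF d (c \<cdot>\<^sub>m A) = cs c (toF d A)"
  and toF_adj: "A \<in> carrier_mat d d \<Longrightarrow> toF d (adj A) = star (toF d A)"
  and toF_one: "toF d (1\<^sub>m d) = idm d"
  and toF_zero: "toF d (0\<^sub>m d d) = 0"
  by (rule fm_eqI, auto simp: ent_toF ent_simps adj_def)+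

lemma toF_mult:
  assumes "A \<in> carrier_mat d d" "B \<in> carrier_mat d d"
  shows "toF d (A * B) = toF d A * toF d B"
proof (rule corner_eqI[of _ d])
  fix i j assume ij: "i < d" "j < d"
  have "(A * B) $$ (i, j) = (\<Sum>k<d. A $$ (i, k) * B $$ (k, j))"
    using assms ij by (auto simp: scalar_prod_def atLeast0LessThan)
  then show "ent (toF d (A * B)) i j = ent (toF d A * toF d B) i j"
    using ij by (simp add: ent_mult[OF toF_corner] ent_toF)
qed auto

lemma adj_carrier: "A \<in> carrier_mat d d \<Longrightarrow> adj A \<in> carrier_mat d d"
  by (auto simp: adj_def)

lemma Ad_carrier:
  assumes "U \<in> carrier_mat d d" "X \<in> carrier_mat d d"
  shows "Ad U X \<in> carrier_mat d d"
  unfolding Ad_def by (rule mult_carrier_mat[OF mult_carrier_mat[OF adj_carrier[OF assms(1)] assms(2)] assms(1)])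

lemma toF_Ad:
  assumes "U \<in> carrier_mat d d" "X \<in> carrier_mat d d"
  shows "toF d (Ad U X) = star (toF d U) * toF d X * toF d U"
  unfolding Ad_def
  by (simp add: toF_mult[OF mult_carrier_mat[OF adj_carrier[OF assms(1)] assms(2)] assms(1)]
      toF_mult[OF adj_carrier[OF assms(1)] assms(2)] toF_adj[OF assms(1)])

lemma msum_carrier: "(\<And>j. j < l \<Longrightarrow> f j \<in> carrier_mat d d) \<Longrightarrow> msum d f l \<in> carrier_mat d d"
  by (induction l) auto

lemma toF_msum: "(\<And>j. j < l \<Longrightarrow> f j \<in> carrier_mat d d) \<Longrightarrow> toF d (msum d f l) = (\<Sum>j<l. toF d (f j))"
  by (induction l) (auto simp: toF_zero toF_add msum_carrier)

lemma toF_unitary: "unitary_mat d U \<Longrightarrow> toF d U \<in> unitaries d"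
  unfolding unitary_mat_def unitaries_def using toF_mult[of "adj U" d U] adj_carrier[of U d]
  by (auto simp: toF_adj toF_one)

lemma toM_unitary:
  assumes "u \<in> unitaries d"
  shows "unitary_mat d (toM d u)"
proof -
  have u: "u \<in> corner d" "star u * u = idm d" using assms by (auto simp: unitaries_def)
  have c: "adj (toM d u) * toM d u \<in> carrier_mat d d"
    by (rule mult_carrier_mat[OF adj_carrier]) auto
  have "toF d (adj (toM d u) * toM d u) = star u * u"
    using u by (simp add: toF_mult[OF adj_carrier] toF_adj toF_toM_corner)
  then have "toM d (toF d (adj (toM d u) * toM d u)) = 1\<^sub>m d" by (simp add: u toM_idm)
  then show ?thesis unfolding unitary_mat_def toM_toF[OF c] by simp
qed

definition lift :: "nat \<Rightarrow> (complex mat \<Rightarrow> complex mat) \<Rightarrow> fm \<Rightarrow> fm" where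
  "lift d \<Phi> X = toF d (\<Phi> (toM d X))"

lemma lift_op:
  assumes "linear_map_on d \<Phi>"
  shows "op d (lift d \<Phi>)"
proof (rule opI)
  fix X Y c
  note lin = assms[unfolded linear_map_on_def]
  have c: "\<Phi> (toM d X) \<in> carrier_mat d d" "\<Phi> (toM d Y) \<in> carrier_mat d d" using lin by auto
  show "lift d \<Phi> (X + Y) = lift d \<Phi> X + lift d \<Phi> Y"
    using lin c by (simp add: lift_def toM_add toF_add)
  show "lift d \<Phi> (cs c X) = cs c (lift d \<Phi> X)"
    using lin c by (simp add: lift_def toM_cs toF_smult)
qed (simp_all add: lift_def toM_cut)

section \<open>Two-positivity as a statement on traces\<close>

lemma tr_form:
  assumes "Z \<in> corner d" "B \<in> corner d"
  shows "tr d (star Z * B * W) = (\<Sum>c<d. \<Sum>i<d. \<Sum>j<d. cnj (ent Z i c) * ent B i j * ent W j c)"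
proof -
  have "ent (star Z * B * W) c c = (\<Sum>i<d. \<Sum>j<d. cnj (ent Z i c) * ent B i j * ent W j c)" for c
    unfolding mult.assoc ent_mult[OF corner_star[OF assms(1)]] ent_mult[OF assms(2)] ent_star
    by (simp add: sum_distrib_left mult.assoc)
  then show ?thesis by (simp add: tr_def)
qed

definition qform :: "nat \<Rightarrow> fm \<Rightarrow> (nat \<Rightarrow> complex) \<Rightarrow> (nat \<Rightarrow> complex) \<Rightarrow> complex" where
  "qform d B x y = (\<Sum>i<d. \<Sum>j<d. cnj (x i) * ent B i j * y j)"

lemma sum_split_add: "(\<Sum>i<d + m. f i) = (\<Sum>i<d. f i) + (\<Sum>a<m. f (d + a :: nat) :: complex)"
  by (induction m) (auto simp: add.assoc)

lemma block_form:
  fixes B :: "nat \<Rightarrow> nat \<Rightarrow> fm"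
  assumes "0 < d"
  shows "(\<Sum>i<2*d. \<Sum>j<2*d. cnj (v i) * ent (B (i div d) (j div d)) (i mod d) (j mod d) * v j)
    = qform d (B 0 0) v v + qform d (B 0 1) v (\<lambda>a. v (d + a))
      + qform d (B 1 0) (\<lambda>a. v (d + a)) v + qform d (B 1 1) (\<lambda>a. v (d + a)) (\<lambda>a. v (d + a))"
proof -
  have dm: "(d + a) div d = 1" "(d + a) mod d = a" if "a < d" for a
    using that assms by auto
  show ?thesis
    unfolding mult_2 sum_split_add qform_def by (simp add: dm sum.distrib)
qed

text \<open>A vector is encoded as column 0 of a matrix, which turns a sesquilinear form into a
  trace.\<close>

lemma qform_column:
  assumes "0 < d" "B \<in> corner d"
  shows "qform d B x y = tr d (star (mk d (\<lambda>i j. if j = 0 then x i else 0)) * B *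
    mk d (\<lambda>i j. if j = 0 then y i else 0))"
proof -
  have "tr d (star (mk d (\<lambda>i j. if j = 0 then x i else 0)) * B * mk d (\<lambda>i j. if j = 0 then y i else 0))
      = (\<Sum>c<d. if c = 0 then qform d B x y else 0)"
    unfolding tr_form[OF mk_corner assms(2)]
    by (intro sum.cong refl) (auto simp: ent_mk qform_def intro!: sum.cong)
  then show ?thesis using assms(1) by simp
qed

lemma psd_iff: "psd n M \<longleftrightarrow> M \<in> carrier_mat n n \<and>
    (\<forall>v. \<exists>r\<ge>0. (\<Sum>i<n. \<Sum>j<n. cnj (v i) * M $$ (i, j) * v j) = complex_of_real r)"
proof -
  have "(z \<in> \<real> \<and> 0 \<le> Re z) = (\<exists>r\<ge>0. z = complex_of_real r)" for z
    by (auto elim!: Reals_cases)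
  then show ?thesis unfolding psd_def by (simp only:)
qed

text \<open>The 2 x 2 block matrix with rows (1, X) and (X^*, X^* X) is r^* r for the row r = (1,
  X), hence positive. Complete positivity with k = 2 makes its image positive; the claim is that
  image evaluated at the stacked columns of Z and W and summed over the columns.\<close>

lemma cp_block:
  assumes d: "0 < d" and cp: "completely_positive d \<Phi>"
    and unital: "\<Phi> (1\<^sub>m d) = 1\<^sub>m d" and X: "X \<in> corner d" and Z: "Z \<in> corner d" and W: "W \<in> corner d"
  shows "\<exists>r\<ge>0. tr d (star Z * Z) + tr d (star Z * lift d \<Phi> X * W) + tr d (star W * lift d \<Phi> (star X) * Z)
    + tr d (star W * lift d \<Phi> (star X * X) * W) = complex_of_real r"
proof -
  define B where "B = (\<lambda>(s::nat) (t::nat). if s = 0 then (if t = 0 then idm d else X) else (if t = 0 then star X else star X * X))"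
  define M where "M = Matrix.mat (2*d) (2*d) (\<lambda>(i, j). ent (B (i div d) (j div d)) (i mod d) (j mod d))"
  have Bc: "B s t \<in> corner d" for s t using X by (simp add: B_def)
  have B: "B 0 0 = idm d" "B 0 1 = X" "B 1 0 = star X" "B 1 1 = star X * X" by (simp_all add: B_def)
  have "\<exists>r\<ge>0. (\<Sum>i<2*d. \<Sum>j<2*d. cnj (v i) * M $$ (i, j) * v j) = complex_of_real r" for v
  proof -
    define x where "x = mk d (\<lambda>i j. if j = 0 then v i else 0)"
    define y where "y = mk d (\<lambda>i j. if j = 0 then v (d + i) else 0)"
    have xy: "x \<in> corner d" "y \<in> corner d" by (simp_all add: x_def y_def)
    have "(\<Sum>i<2*d. \<Sum>j<2*d. cnj (v i) * M $$ (i, j) * v j)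
        = (\<Sum>i<2*d. \<Sum>j<2*d. cnj (v i) * ent (B (i div d) (j div d)) (i mod d) (j mod d) * v j)"
      by (intro sum.cong refl) (simp add: M_def)
    also have "\<dots> = tr d (star x * B 0 0 * x) + tr d (star x * B 0 1 * y) + tr d (star y * B 1 0 * x)
        + tr d (star y * B 1 1 * y)"
      unfolding block_form[OF d] qform_column[OF d Bc] x_def y_def ..
    also have "\<dots> = tr d (star (x + X * y) * (x + X * y))"
      unfolding B using xy by (simp add: distrib_left distrib_right mult.assoc)
    also have "\<dots> = complex_of_real (hs d (x + X * y))" by (rule tr_star_mult) (use xy X in simp)
    finally show ?thesis using hs_nonneg by blast
  qed
  then have "psd (2*d) M" unfolding psd_iff by (simp add: M_def)
  then have out: "psd (2*d) (block_apply d 2 \<Phi> M)" using cp unfolding completely_positive_def by blast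
  have ent_out: "block_apply d 2 \<Phi> M $$ (i, j) = ent (lift d \<Phi> (B (i div d) (j div d))) (i mod d) (j mod d)"
    if ij: "i < 2*d" "j < 2*d" for i j
  proof -
    have bound: "(k div d) * d + a < 2*d" if "k < 2*d" "a < d" for k a
    proof -
      have "k div d < 2" using that(1) by (simp add: less_mult_imp_div_less)
      then have "k div d \<le> 1" by simp
      then have "k div d * d \<le> 1 * d" by (rule mult_le_mono1)
      then show ?thesis using that(2) by linarith
    qed
    have "Matrix.mat d d (\<lambda>(a, b). M $$ ((i div d) * d + a, (j div d) * d + b)) = toM d (B (i div d) (j div d))"
      unfolding toM_def by (rule eq_matI) (use bound ij in \<open>auto simp: M_def\<close>)
    then show ?thesis using ij d by (simp add: block_apply_def lift_def ent_toF)
  qed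
  have Lc: "lift d \<Phi> Y \<in> corner d" for Y by (simp add: lift_def)
  have L1: "lift d \<Phi> (idm d) = idm d" by (simp add: lift_def toM_idm unital toF_one)
  have "\<exists>r\<ge>0. qform d (idm d) x x + qform d (lift d \<Phi> X) x y + qform d (lift d \<Phi> (star X)) y x
      + qform d (lift d \<Phi> (star X * X)) y y = complex_of_real r" for x y
  proof -
    define v where "v = (\<lambda>i. if i < d then x i else y (i - d))"
    have "(\<Sum>i<2*d. \<Sum>j<2*d. cnj (v i) * block_apply d 2 \<Phi> M $$ (i, j) * v j)
        = (\<Sum>i<2*d. \<Sum>j<2*d. cnj (v i) * ent (lift d \<Phi> (B (i div d) (j div d))) (i mod d) (j mod d) * v j)"
      by (intro sum.cong refl) (simp add: ent_out)
    also have "\<dots> = qform d (lift d \<Phi> (B 0 0)) v v + qform d (lift d \<Phi> (B 0 1)) v (\<lambda>a. v (d + a))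
      + qform d (lift d \<Phi> (B 1 0)) (\<lambda>a. v (d + a)) v + qform d (lift d \<Phi> (B 1 1)) (\<lambda>a. v (d + a)) (\<lambda>a. v (d + a))"
      by (rule block_form[OF d, of v "\<lambda>s t. lift d \<Phi> (B s t)"])
    also have "\<dots> = qform d (idm d) x x + qform d (lift d \<Phi> X) x y + qform d (lift d \<Phi> (star X)) y x
      + qform d (lift d \<Phi> (star X * X)) y y"
      unfolding B L1 qform_def by (simp add: v_def)
    finally have eq: "(\<Sum>i<2*d. \<Sum>j<2*d. cnj (v i) * block_apply d 2 \<Phi> M $$ (i, j) * v j) = \<dots>" .
    show ?thesis using out unfolding psd_iff by (metis eq)
  qed
  then have "\<forall>c. \<exists>r\<ge>0. qform d (idm d) (\<lambda>i. ent Z i c) (\<lambda>i. ent Z i c)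
      + qform d (lift d \<Phi> X) (\<lambda>i. ent Z i c) (\<lambda>i. ent W i c)
      + qform d (lift d \<Phi> (star X)) (\<lambda>i. ent W i c) (\<lambda>i. ent Z i c)
      + qform d (lift d \<Phi> (star X * X)) (\<lambda>i. ent W i c) (\<lambda>i. ent W i c) = complex_of_real r" by blast
  from choice[OF this] obtain r where r: "\<forall>c. 0 \<le> r c \<and> qform d (idm d) (\<lambda>i. ent Z i c) (\<lambda>i. ent Z i c)
      + qform d (lift d \<Phi> X) (\<lambda>i. ent Z i c) (\<lambda>i. ent W i c)
      + qform d (lift d \<Phi> (star X)) (\<lambda>i. ent W i c) (\<lambda>i. ent Z i c)
      + qform d (lift d \<Phi> (star X * X)) (\<lambda>i. ent W i c) (\<lambda>i. ent W i c) = complex_of_real (r c)" ..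
  have trq: "tr d (star V * C * V') = (\<Sum>c<d. qform d C (\<lambda>i. ent V i c) (\<lambda>i. ent V' i c))"
    if "V \<in> corner d" "C \<in> corner d" for V C V'
    unfolding tr_form[OF that] qform_def ..
  have "tr d (star Z * Z) = tr d (star Z * idm d * Z)" using Z by simp
  then have "tr d (star Z * Z) + tr d (star Z * lift d \<Phi> X * W) + tr d (star W * lift d \<Phi> (star X) * Z)
      + tr d (star W * lift d \<Phi> (star X * X) * W) = (\<Sum>c<d. complex_of_real (r c))"
    unfolding trq[OF Z Lc] trq[OF W Lc] trq[OF Z corner_idm] using r by (simp add: sum.distrib[symmetric])
  also have "\<dots> = complex_of_real (\<Sum>c<d. r c)" by simp
  finally show ?thesis using r by (intro exI[of _ "\<Sum>c<d. r c"]) (auto intro: sum_nonneg)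
qed

lemma tr_toF: "A \<in> carrier_mat d d \<Longrightarrow> tr d (toF d A) = mtrace A"
  by (auto simp: tr_def mtrace_def ent_toF)

text \<open>Both properties of a channel that rest on positivity come from \<open>cp_block\<close>:
  the form being real yields preservation of adjoints, and completing the square yields the Schwarz
  inequality.\<close>

lemma lift_chan:
  assumes d: "0 < d" and ch: "unital_quantum_channel d \<Phi>"
  shows "chan d (lift d \<Phi>)"
proof -
  have lin: "linear_map_on d \<Phi>" and cp: "completely_positive d \<Phi>" and unital: "\<Phi> (1\<^sub>m d) = 1\<^sub>m d"
    and tp: "\<And>X. X \<in> carrier_mat d d \<Longrightarrow> mtrace (\<Phi> X) = mtrace X"
    using ch unfolding unital_quantum_channel_def by auto
  define T where "T = lift d \<Phi>"
  have Top: "op d T" unfolding T_def by (rule lift_op[OF lin])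
  have Tc: "T X \<in> corner d" for X by (rule op_corner[OF Top])
  note blk = cp_block[OF d cp unital, folded T_def]
  have "T (idm d) = idm d" by (simp add: T_def lift_def toM_idm unital toF_one)
  moreover have "tr d (T X) = tr d X" if "X \<in> corner d" for X
  proof -
    have "\<Phi> (toM d X) \<in> carrier_mat d d" using lin unfolding linear_map_on_def by simp
    then have "tr d (T X) = mtrace (toM d X)" by (simp add: T_def lift_def tr_toF tp)
    also have "\<dots> = tr d (toF d (toM d X))" by (simp add: tr_toF)
    finally show ?thesis by (simp add: toF_toM_corner that)
  qed
  moreover have herm: "T (star X) = star (T X)" for X
  proof -
    have star_cut: "T (star Y) = star (T Y)" if Y: "Y \<in> corner d" for Y
    proof -
      have "T (star Y) - star (T Y) = 0"
      proof (rule tr_nondegenerate)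
        show "T (star Y) - star (T Y) \<in> corner d" using Tc by simp
        fix Z assume Z: "Z \<in> corner d"
        define s where "s = tr d (star Z * T Y)"
        define t where "t = tr d (T (star Y) * Z)"
        \<comment> \<open>The values z = 0, 1 and i of this real expression suffice to conclude that
          t is the conjugate of s.\<close>
        have r: "\<exists>r. complex_of_real ((cmod z)\<^sup>2 * hs d Z) + cnj z * s + z * t + tr d (T (star Y * Y)) = complex_of_real r" for z
        proof -
          have "tr d (star (cs z Z) * cs z Z) = complex_of_real ((cmod z)\<^sup>2 * hs d Z)"
            using Z by (subst tr_star_mult) (auto simp: hs_cs)
          then show ?thesis
            using blk[OF Y corner_cs[OF Z, of z] corner_idm] Tc Z by (auto simp: s_def t_def)
        qed
        have "Im (tr d (T (star Y * Y))) = 0" using r[of 0] by (auto simp: complex_eq_iff)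
        then have "Im (s + t) = 0" "Im (- \<i> * s + \<i> * t) = 0"
          using r[of 1] r[of \<i>] by (auto simp: complex_eq_iff)
        then have "t = cnj s" by (simp add: complex_eq_iff)
        then have "tr d (T (star Y) * Z) = tr d (star (star Z * T Y))" unfolding s_def t_def by (simp only: tr_simps)
        then have "tr d ((T (star Y) - star (T Y)) * Z) = 0" by (simp add: left_diff_distrib)
        then show "tr d (Z * (T (star Y) - star (T Y))) = 0"
          using tr_mult_commute[OF Z, of "T (star Y) - star (T Y)"] Tc by simp
      qed
      then show ?thesis by simp
    qed
    have "T (star X) = T (idm d * star X * idm d)" by (simp only: op_cut[OF Top])
    also have "idm d * star X * idm d = star (idm d * X * idm d)" by (simp add: mult.assoc)
    also have "T \<dots> = star (T (idm d * X * idm d))" by (rule star_cut) simp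
    finally show ?thesis by (simp only: op_cut[OF Top])
  qed
  moreover have "psdm d (T (star X * X) - star (T X) * T X)" if X: "X \<in> corner d" for X
    unfolding psdm_def
  proof
    fix W assume W: "W \<in> corner d"
    \<comment> \<open>This choice of Z completes the square: the first three terms of the form add
      up to minus W^* T(X)^* T(X) W.\<close>
    have Z: "- (T X * W) \<in> corner d" using Tc W by simp
    have "tr d (star W * (T (star X * X) - star (T X) * T X) * W)
        = tr d (star (- (T X * W)) * - (T X * W)) + tr d (star (- (T X * W)) * T X * W)
          + tr d (star W * T (star X) * - (T X * W)) + tr d (star W * T (star X * X) * W)"
      by (simp add: herm right_diff_distrib left_diff_distrib mult.assoc)
    then show "\<exists>r\<ge>0. tr d (star W * (T (star X * X) - star (T X) * T X) * W) = complex_of_real r"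
      using blk[OF X Z W] by simp
  qed
  ultimately show ?thesis using Top unfolding chan_def T_def by blast
qed

text \<open>The cone replaces the convex hull: the map fixes the unit, so the weights of any
  representation in the cone sum to 1, as entry (0, 0) shows for d > 0.\<close>

lemma mixed_unitary_iff:
  assumes d: "0 < d" and lin: "linear_map_on d \<Phi>" and unital: "\<Phi> (1\<^sub>m d) = 1\<^sub>m d"
  shows "mixed_unitary d \<Phi> \<longleftrightarrow> lift d \<Phi> \<in> comb Rnn (unitaries d)"
proof
  assume "mixed_unitary d \<Phi>"
  then obtain l lam U where U: "\<And>j. j < l \<Longrightarrow> 0 \<le> lam j \<and> unitary_mat d (U j)"
    and eq: "\<And>X. X \<in> carrier_mat d d \<Longrightarrow>
      \<Phi> X = msum d (\<lambda>j. complex_of_real (lam j) \<cdot>\<^sub>m Ad (U j) X) l"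
    unfolding mixed_unitary_def by blast
  have Uc: "U j \<in> carrier_mat d d" if "j < l" for j using U[OF that] by (simp add: unitary_mat_def)
  have R: "(\<lambda>X. \<Sum>j<l. cs (complex_of_real (lam j)) (star (toF d (U j)) * X * toF d (U j))) \<in> comb Rnn (unitaries d)"
    by (intro comb_sum comb_single) (use U toF_unitary in auto)
  have "lift d \<Phi> = (\<lambda>X. \<Sum>j<l. cs (complex_of_real (lam j)) (star (toF d (U j)) * X * toF d (U j)))"
  proof (rule op_eqI'[OF lift_op[OF lin] comb_op[OF R]])
    show "unitaries d \<subseteq> corner d" by (auto simp: unitaries_def)
    fix X assume X: "X \<in> corner d"
    have "lift d \<Phi> X = (\<Sum>j<l. toF d (complex_of_real (lam j) \<cdot>\<^sub>m Ad (U j) (toM d X)))"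
      unfolding lift_def eq[OF toM_carrier] by (rule toF_msum) (use Ad_carrier[OF Uc toM_carrier] in auto)
    also have "\<dots> = (\<Sum>j<l. cs (complex_of_real (lam j)) (star (toF d (U j)) * X * toF d (U j)))"
      by (intro sum.cong refl)
        (simp add: toF_smult[OF Ad_carrier[OF Uc toM_carrier]] toF_Ad[OF Uc toM_carrier] toF_toM_corner[OF X])
    finally show "lift d \<Phi> X = (\<Sum>j<l. cs (complex_of_real (lam j)) (star (toF d (U j)) * X * toF d (U j)))" .
  qed
  then show "lift d \<Phi> \<in> comb Rnn (unitaries d)" using R by simp
next
  assume "lift d \<Phi> \<in> comb Rnn (unitaries d)"
  define l where "l = 2 * (d * d * (d * d))"
  from comb_unitaries_bounded_length[OF \<open>lift d \<Phi> \<in> _\<close>, folded l_def] obtain lam u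
    where u': "\<forall>j<l. 0 \<le> lam j \<and> u j \<in> unitaries d"
    and eq: "lift d \<Phi> = (\<lambda>X. \<Sum>j<l. cs (complex_of_real (lam j)) (star (u j) * X * u j))"
    by (elim exE conjE)
  have u: "0 \<le> lam j \<and> u j \<in> unitaries d" if "j < l" for j using u' that by blast
  have uc: "u j \<in> corner d" "star (u j) * u j = idm d" if "j < l" for j
    using u[OF that] by (auto simp: unitaries_def)
  have Ac: "complex_of_real (lam j) \<cdot>\<^sub>m Ad (toM d (u j)) X \<in> carrier_mat d d" if "X \<in> carrier_mat d d" for j X
    using Ad_carrier[OF toM_carrier that] by simp
  have "idm d = lift d \<Phi> (idm d)" by (simp add: lift_def toM_idm unital toF_one)
  also have "\<dots> = (\<Sum>j<l. cs (complex_of_real (lam j)) (idm d))"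
    unfolding eq using uc by (intro sum.cong) auto
  finally have "ent (idm d) 0 0 = ent (\<Sum>j<l. cs (complex_of_real (lam j)) (idm d)) 0 0" by simp
  then have "complex_of_real (\<Sum>j<l. lam j) = complex_of_real 1" using d by (simp add: ent_simps)
  then have s1: "(\<Sum>j<l. lam j) = 1" by (simp only: of_real_eq_iff)
  have "\<Phi> X = msum d (\<lambda>j. complex_of_real (lam j) \<cdot>\<^sub>m Ad (toM d (u j)) X) l" if X: "X \<in> carrier_mat d d" for X
  proof -
    have \<Phi>c: "\<Phi> X \<in> carrier_mat d d" using lin X unfolding linear_map_on_def by blast
    have "toF d (\<Phi> X) = lift d \<Phi> (toF d X)" by (simp add: lift_def toM_toF[OF X])
    also have "\<dots> = (\<Sum>j<l. toF d (complex_of_real (lam j) \<cdot>\<^sub>m Ad (toM d (u j)) X))"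
      unfolding eq by (intro sum.cong refl)
        (simp add: toF_smult[OF Ad_carrier[OF toM_carrier X]] toF_Ad[OF toM_carrier X] toF_toM_corner uc)
    also have "\<dots> = toF d (msum d (\<lambda>j. complex_of_real (lam j) \<cdot>\<^sub>m Ad (toM d (u j)) X) l)"
      by (rule toF_msum[symmetric]) (rule Ac[OF X])
    finally have "toM d (toF d (\<Phi> X)) = toM d (toF d (msum d (\<lambda>j. complex_of_real (lam j) \<cdot>\<^sub>m Ad (toM d (u j)) X) l))"
      by simp
    then show ?thesis using toM_toF[OF \<Phi>c] toM_toF[OF msum_carrier] Ac[OF X] by simp
  qed
  then show "mixed_unitary d \<Phi>" unfolding mixed_unitary_def
    using u toM_unitary s1 by (intro exI[of _ l] exI[of _ lam] exI[of _ "\<lambda>j. toM d (u j)"]) auto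
qed

theorem theorem5p4:
  fixes d :: nat and \<Phi> :: "real \<Rightarrow> complex mat \<Rightarrow> complex mat"
  assumes "0 < d" and "qds_unital d \<Phi>"
  shows "open {t::real. 0 \<le> t \<and> \<not> mixed_unitary d (\<Phi> t)} \<and>
    ((\<forall>t\<ge>0. mixed_unitary d (\<Phi> t)) \<noteq>
     (\<exists>t0 t1. 0 < t0 \<and> t0 \<le> t1 \<and>
        (\<forall>t. 0 < t \<and> t < t0 \<longrightarrow> \<not> mixed_unitary d (\<Phi> t)) \<and>
        (\<forall>t\<ge>t1. mixed_unitary d (\<Phi> t))))"
proof -
  have ch: "unital_quantum_channel d (\<Phi> t)" if "0 \<le> t" for t
    using assms(2) that unfolding qds_unital_def by blast
  have id0: "\<Phi> 0 X = X" if "X \<in> carrier_mat d d" for X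
    using assms(2) that unfolding qds_unital_def by blast
  have add: "\<Phi> (s + t) X = \<Phi> s (\<Phi> t X)" if "0 \<le> s" "0 \<le> t" "X \<in> carrier_mat d d" for s t X
    using assms(2) that unfolding qds_unital_def by blast
  have cont: "continuous_on {0..} (\<lambda>t. \<Phi> t X $$ (i, j))" if "X \<in> carrier_mat d d" "i < d" "j < d" for X i j
    using assms(2) that unfolding qds_unital_def by blast
  have lin: "linear_map_on d (\<Phi> t)" and un: "\<Phi> t (1\<^sub>m d) = 1\<^sub>m d" if "0 \<le> t" for t
    using ch[OF that] unfolding unital_quantum_channel_def by auto
  define F where "F = (\<lambda>t. lift d (\<Phi> t))"
  define T where "T = {t. 0 \<le> t \<and> F t \<in> comb Rnn (unitaries d)}"
  have F_chan: "chan d (F t)" if "0 \<le> t" for t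
    unfolding F_def by (rule lift_chan[OF assms(1) ch[OF that]])
  have F_add: "F (s + t) X = F s (F t X)" if "0 \<le> s" "0 \<le> t" for s t X
  proof -
    have "\<Phi> t (toM d X) \<in> carrier_mat d d" using lin[OF that(2)] unfolding linear_map_on_def by simp
    then show ?thesis using add[OF that toM_carrier] by (simp add: F_def lift_def toM_toF)
  qed
  have F_cont: "oplim d (\<lambda>k. F (\<tau> k)) (F t)" if \<tau>: "\<And>k. 0 \<le> \<tau> k" "\<tau> \<longlonglongrightarrow> t" for \<tau> t
  proof (rule tends_oplim, rule tendsI)
    have t: "0 \<le> t" by (rule LIMSEQ_le_const[OF \<tau>(2)]) (use \<tau>(1) in blast)
    fix p q i j assume "p < d" "q < d" "i < d" "j < d"
    then show "(\<lambda>k. ent (F (\<tau> k) (unit p q)) i j) \<longlonglongrightarrow> ent (F t (unit p q)) i j"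
      using continuous_on_tendsto_compose[OF cont[OF toM_carrier, of i j "unit p q"] \<tau>(2)] t \<tau>(1)
      by (simp add: F_def lift_def ent_toF)
  qed (auto simp: F_def lift_def)
  obtain a b where ab: "0 \<le> a" "a < b" "\<forall>t. a < t \<and> t < b \<longrightarrow> F t \<in> comb Rnn (unitaries d)"
    using semigroup_contains_mixed_unitary_interval[of d F] F_chan F_add F_cont by blast
  have mu: "mixed_unitary d (\<Phi> t) \<longleftrightarrow> t \<in> T" if "0 \<le> t" for t
    using mixed_unitary_iff[OF assms(1) lin[OF that] un[OF that]] that by (simp add: T_def F_def)
  have "open {t. 0 \<le> t \<and> t \<notin> T} \<and>
    ((\<forall>t\<ge>0. t \<in> T) \<noteq> (\<exists>t0 t1. 0 < t0 \<and> t0 \<le> t1 \<and> (\<forall>t. 0 < t \<and> t < t0 \<longrightarrow> t \<notin> T) \<and> (\<forall>t\<ge>t1. t \<in> T)))"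
  proof (rule additive_set_dichotomy[OF _ _ _ _ ab(1,2)])
    have "F 0 = (\<lambda>X. cs 1 (star (idm d) * X * idm d))"
      by (rule ext) (simp add: F_def lift_def id0 toF_toM)
    also have "\<dots> \<in> comb Rnn (unitaries d)"
      by (rule comb_single) (auto simp: unitaries_def)
    finally show "0 \<in> T" by (simp add: T_def)
    show "T \<subseteq> {0..}" by (auto simp: T_def)
    show "s + t \<in> T" if "s \<in> T" "t \<in> T" for s t
    proof -
      have st: "0 \<le> s" "0 \<le> t" "F s \<in> comb Rnn (unitaries d)" "F t \<in> comb Rnn (unitaries d)"
        using that by (auto simp: T_def)
      have "(\<lambda>X. F s (F t X)) \<in> comb Rnn (unitaries d)"
        by (rule comb_comp[OF st(3,4) unitaries_mult Rnn_mult])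
      moreover have "(\<lambda>X. F s (F t X)) = F (s + t)" using F_add[OF st(1,2)] by (intro ext) simp
      ultimately show ?thesis using st(1,2) by (simp add: T_def)
    qed
    show "t \<in> T" if \<tau>: "\<And>k. \<tau> k \<in> T" "\<tau> \<longlonglongrightarrow> t" for \<tau> t
    proof -
      have pos: "0 \<le> \<tau> k" and mem: "F (\<tau> k) \<in> comb Rnn (unitaries d)" for k using \<tau>(1)[of k] by (auto simp: T_def)
      have t: "0 \<le> t" by (rule LIMSEQ_le_const[OF \<tau>(2)]) (use pos in blast)
      have "F t \<in> comb Rnn (unitaries d)"
        by (rule mixed_unitary_closed[OF assms(1) mem chanD(2)[OF F_chan[OF pos]] chanD(1)[OF F_chan[OF t]]
              F_cont[OF pos \<tau>(2)]])
      then show ?thesis using t by (simp add: T_def)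
    qed
    show "{a<..<b} \<subseteq> T" using ab by (auto simp: T_def)
  qed
  moreover have "{t. 0 \<le> t \<and> \<not> mixed_unitary d (\<Phi> t)} = {t. 0 \<le> t \<and> t \<notin> T}" using mu by auto
  moreover have "(\<forall>t\<ge>0. mixed_unitary d (\<Phi> t)) = (\<forall>t\<ge>0. t \<in> T)" using mu by auto
  moreover have "(\<exists>t0 t1. 0 < t0 \<and> t0 \<le> t1 \<and> (\<forall>t. 0 < t \<and> t < t0 \<longrightarrow> \<not> mixed_unitary d (\<Phi> t)) \<and>
        (\<forall>t\<ge>t1. mixed_unitary d (\<Phi> t)))
    = (\<exists>t0 t1. 0 < t0 \<and> t0 \<le> t1 \<and> (\<forall>t. 0 < t \<and> t < t0 \<longrightarrow> t \<notin> T) \<and> (\<forall>t\<ge>t1. t \<in> T))"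
  proof -
    have "(0 < t0 \<and> t0 \<le> t1 \<and> (\<forall>t. 0 < t \<and> t < t0 \<longrightarrow> \<not> mixed_unitary d (\<Phi> t)) \<and>
        (\<forall>t\<ge>t1. mixed_unitary d (\<Phi> t)))
      = (0 < t0 \<and> t0 \<le> t1 \<and> (\<forall>t. 0 < t \<and> t < t0 \<longrightarrow> t \<notin> T) \<and> (\<forall>t\<ge>t1. t \<in> T))" for t0 t1
    \<comment> \<open>Membership in \<open>T\<close> matches mixed unitarity only at nonnegative
      times; 0 < t0 and t0 <= t1 ensure that no other times occur.\<close>
    proof (cases "0 < t0 \<and> t0 \<le> t1")
      case True
      have "(\<forall>t. 0 < t \<and> t < t0 \<longrightarrow> \<not> mixed_unitary d (\<Phi> t)) = (\<forall>t. 0 < t \<and> t < t0 \<longrightarrow> t \<notin> T)"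
        using mu by auto
      moreover have "(\<forall>t\<ge>t1. mixed_unitary d (\<Phi> t)) = (\<forall>t\<ge>t1. t \<in> T)" using mu True by auto
      ultimately show ?thesis by (simp only:)
    qed auto
    then show ?thesis by (intro arg_cong[of _ _ Ex] ext)
  qed
  ultimately show ?thesis by (simp only: simp_thms)
qed

end
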